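(* Let $\mathcal W$ be a finite set of arms. Let $(Y_t(w))_{w\in\mathcal W}$, $t=1,2,\dots$, be independent and identically distributed vectors of real-valued potential outcomes, each $Y_t(w)$ having nonzero variance and $\mathbb E|Y_t(w)|^{2+\delta}<\infty$ for some $\delta>0$ and all $w$. At each time $t$ an arm $W_t$ is drawn and $Y_t=Y_t(W_t)$ is observed; $H^{t-1}=\{(W_s,Y_s)\}_{s<t}$. The assignment probabilities $e_t(w)=\mathbb P[W_t=w\mid H^{t-1}]$ are known, strictly positive, and the conditional law of $W_t$ given $H^{t-1}$ and all potential outcomes $(Y_s(\cdot))_{s\ge t}$ depends only on $H^{t-1}$. Fix $w\in\mathcal W$ and let $Q(w)=\mathbb E[Y_t(w)]$. Let $\hat m_t(w)$ be $H^{t-1}$-measurable, uniformly bounded, and converge almost surely to some constant $m_\infty(w)$. Define the AIPW scores $$\hat\Gamma_t(w)=\frac{\mathbb 1\{W_t=w\}}{e_t(w)}Y_t+\Big(1-\frac{\mathbb 1\{W_t=w\}}{e_t(w)}\Big)\hat m_t(w).$$ Let $h_t(w)\ge 0$ be $H^{t-1}$-measurable weights (possibly depending on $T$) satisfying: (i) $\big(\sum_{t=1}^T h_t(w)\big)^2\big/\mathbb E\big[\sum_{t=1}^T h_t^2(w)/e_t(w)\big]\to\infty$ in probability as $T\to\infty$; (ii) for some $p>1$, $\sum_{t=1}^T \frac{h_t^2(w)}{e_t(w)}\Big/\mathbb E\Big[\sum_{t=1}^T\frac{h_t^2(w)}{e_t(w)}\Big]\to 1$ in $L_p$ as $T\to\infty$;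 (iii) for some $\delta>0$, $\sum_{t=1}^T \frac{h_t^{2+\delta}(w)}{e_t^{1+\delta}(w)}\Big/\mathbb E\Big[\sum_{t=1}^T\frac{h_t^2(w)}{e_t(w)}\Big]^{1+\delta/2}\to 0$ in probability as $T\to\infty$. Suppose moreover that either $\hat m_t(w)\to Q(w)$ almost surely as $t\to\infty$, or $e_t(w)\to e_\infty(w)$ almost surely for some $e_\infty(w)\in[0,1]$. Then the adaptively-weighted estimator $$\hat Q_T^h(w)=\frac{\sum_{t=1}^T h_t(w)\hat\Gamma_t(w)}{\sum_{t=1}^T h_t(w)}$$ is consistent for $Q(w)$, and $$\frac{\hat Q^h_T(w)-Q(w)}{\hat V^h_T(w)^{1/2}}\xrightarrow{d}\mathcal N(0,1),\qquad \hat V^h_T(w)=\frac{\sum_{t=1}^T h_t^2(w)\big(\hat\Gamma_t(w)-\hat Q^h_T(w)\big)^2}{\big(\sum_{t=1}^T h_t(w)\big)^2}.$$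
   Context: "$H^{t-1}$-measurable" (history-adapted) means a function of the history of arms and outcomes up to time $t-1$. *)

theory Defs
  imports "HOL-Probability.Probability"
begin

text \<open>History sigma-algebra H^{t-1}: generated by (W_s, Y_s(W_s)) for 1 <= s < t.
  W :: time => outcome => arm, Y :: time => outcome => arm => real (potential outcomes).\<close>
definition hist :: "'a measure \<Rightarrow> (nat \<Rightarrow> 'a \<Rightarrow> 'w) \<Rightarrow> (nat \<Rightarrow> 'a \<Rightarrow> 'w \<Rightarrow> real) \<Rightarrow> nat \<Rightarrow> 'a measure" where
  "hist M W Y t = sigma (space M)
     (\<Union>s\<in>{1..<t}. {(\<lambda>\<omega>. W s \<omega>) -` A \<inter> space M | A. True}
                 \<union> {(\<lambda>\<omega>. Y s \<omega> (W s \<omega>)) -` B \<inter> space M | B. B \<in> sets borel})"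

definition hist_future :: "'a measure \<Rightarrow> (nat \<Rightarrow> 'a \<Rightarrow> 'w) \<Rightarrow> (nat \<Rightarrow> 'a \<Rightarrow> 'w \<Rightarrow> real) \<Rightarrow> nat \<Rightarrow> 'a measure" where
  "hist_future M W Y t = sigma (space M)
     ((\<Union>s\<in>{1..<t}. {(\<lambda>\<omega>. W s \<omega>) -` A \<inter> space M | A. True}
                 \<union> {(\<lambda>\<omega>. Y s \<omega> (W s \<omega>)) -` B \<inter> space M | B. B \<in> sets borel})
      \<union> (\<Union>s\<in>{t..}. \<Union>v. {(\<lambda>\<omega>. Y s \<omega> v) -` B \<inter> space M | B. B \<in> sets borel}))"

definition aipw :: "(nat \<Rightarrow> 'a \<Rightarrow> 'w) \<Rightarrow> (nat \<Rightarrow> 'a \<Rightarrow> 'w \<Rightarrow> real) \<Rightarrow> (nat \<Rightarrow> 'w \<Rightarrow> 'a \<Rightarrow> real)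
    \<Rightarrow> (nat \<Rightarrow> 'a \<Rightarrow> real) \<Rightarrow> 'w \<Rightarrow> nat \<Rightarrow> 'a \<Rightarrow> real" where
  "aipw W Y e m w t \<omega> =
     indicator {\<omega>. W t \<omega> = w} \<omega> / e t w \<omega> * Y t \<omega> (W t \<omega>)
     + (1 - indicator {\<omega>. W t \<omega> = w} \<omega> / e t w \<omega>) * m t \<omega>"

definition Qhat :: "(nat \<Rightarrow> nat \<Rightarrow> 'a \<Rightarrow> real) \<Rightarrow> (nat \<Rightarrow> 'a \<Rightarrow> real) \<Rightarrow> nat \<Rightarrow> 'a \<Rightarrow> real" where
  "Qhat h G T \<omega> = (\<Sum>t=1..T. h T t \<omega> * G t \<omega>) / (\<Sum>t=1..T. h T t \<omega>)"

definition Vhat :: "(nat \<Rightarrow> nat \<Rightarrow> 'a \<Rightarrow> real) \<Rightarrow> (nat \<Rightarrow> 'a \<Rightarrow> real) \<Rightarrow> nat \<Rightarrow> 'a \<Rightarrow> real" where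
  "Vhat h G T \<omega> = (\<Sum>t=1..T. (h T t \<omega>)\<^sup>2 * (G t \<omega> - Qhat h G T \<omega>)\<^sup>2) / (\<Sum>t=1..T. h T t \<omega>)\<^sup>2"

definition conv_in_prob :: "'a measure \<Rightarrow> (nat \<Rightarrow> 'a \<Rightarrow> real) \<Rightarrow> real \<Rightarrow> bool" where
  "conv_in_prob M X c \<longleftrightarrow>
     (\<forall>\<epsilon>>0. (\<lambda>T. measure M {\<omega>\<in>space M. \<bar>X T \<omega> - c\<bar> > \<epsilon>}) \<longlonglongrightarrow> 0)"

definition conv_in_prob_infty :: "'a measure \<Rightarrow> (nat \<Rightarrow> 'a \<Rightarrow> real) \<Rightarrow> bool" where
  "conv_in_prob_infty M X \<longleftrightarrow>
     (\<forall>K. (\<lambda>T. measure M {\<omega>\<in>space M. X T \<omega> \<le> K}) \<longlonglongrightarrow> 0)"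

definition conv_in_Lp :: "'a measure \<Rightarrow> real \<Rightarrow> (nat \<Rightarrow> 'a \<Rightarrow> real) \<Rightarrow> real \<Rightarrow> bool" where
  "conv_in_Lp M p X c \<longleftrightarrow>
     (\<forall>T. integrable M (\<lambda>\<omega>. \<bar>X T \<omega> - c\<bar> powr p)) \<and>
     (\<lambda>T. integral\<^sup>L M (\<lambda>\<omega>. \<bar>X T \<omega> - c\<bar> powr p)) \<longlonglongrightarrow> 0"

end

theory Submission
  imports Defs
begin

text \<open>
  Normalise the weights as \<open>a = h / sqrt A\<close> with \<open>A = E (\<Sum> h\<^sup>2 / e)\<close>. Unconfoundedness makes the
  history independent of the future potential outcomes, so \<open>X = a * (\<Gamma> - Q)\<close> is a martingale
  difference array with conditional variance \<open>a\<^sup>2 / e * (\<sigma>\<^sup>2 + (1 - e) * (m - Q)\<^sup>2)\<close>. Condition (iii)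
  makes the individual weights \<open>a\<^sup>2 / e\<close> negligible, and by (ii) they sum to one in the limit; so a
  Toeplitz argument shows that the conditional variances sum to a positive constant \<open>V\<close> in
  probability under either alternative hypothesis. The central limit theorem then follows by
  telescoping \<open>E (\<Prod> exp (\<i> u X + u\<^sup>2 v / 2))\<close>, stopped by a predictable rule which keeps all factors
  bounded, and telescoping \<open>E (\<Prod> exp (\<i> u (X\<^sup>2 - v)))\<close> in the same way gives \<open>\<Sum> X\<^sup>2 \<rightarrow> V\<close>. Since
  \<open>\<Sum> X\<close> is bounded in \<open>L\<^sub>2\<close>, condition (i) yields consistency, and the studentised statistic differs
  from \<open>\<Sum> X / sqrt V\<close> by a term vanishing in probability.
\<close>

section \<open>Convergence in probability\<close>

text \<open>The conditional variances are random, so the characteristic function of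
  \<open>\<Sum> X\<close> cannot be compared factor by factor with a Gaussian one. The compensator
  \<open>exp (u\<^sup>2 v / 2)\<close> gives every factor a conditional mean of one up to an error
  of order \<open>L\<close>, so that only the distance of the whole product from 1 has to be
  estimated. The main obstacle is that the propensities have no positive lower bound. The bound
  \<open>L\<close> on the p-th moments may therefore fail to be integrable, and the moment estimate
  is formulated only against predictable weights that make it integrable; the stopping rule supplies
  such weights. The exponent \<open>p\<close> must serve three masters: at most 3 for the Taylor
  remainder, at most two plus the moment exponent of the outcomes, and at most two plus the exponent
  of condition (iii); an interpolation inequality lowers the exponent in (iii) to \<open>p\<close>.
  Limits in probability are handled path by path: along a subsequence all inputs converge almost
  surely, so each limit argument becomes one about real sequences.\<close>

context prob_space begin

text \<open>Condenses the family of limits over all \<open>\<epsilon>\<close> into a single real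
  sequence, the truncated L1 distance. This is the form on which dominated convergence and
  subsequence arguments can act.\<close>

lemma conv_in_prob_iff_expectation_min:
  assumes [measurable]: "\<And>n. X n \<in> borel_measurable M"
  shows "conv_in_prob M X c \<longleftrightarrow> (\<lambda>n. expectation (\<lambda>x. min 1 \<bar>X n x - c\<bar>)) \<longlonglongrightarrow> 0"
proof
  have int: "integrable M (\<lambda>x. min 1 \<bar>X n x - c\<bar>)" for n
    by (rule integrable_const_bound[where B=1]) auto
  have nn: "0 \<le> expectation (\<lambda>x. min 1 \<bar>X n x - c\<bar>)" for n
    by (rule Bochner_Integration.integral_nonneg) auto
  {
    assume c: "conv_in_prob M X c"
    show "(\<lambda>n. expectation (\<lambda>x. min 1 \<bar>X n x - c\<bar>)) \<longlonglongrightarrow> 0"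
    proof (rule LIMSEQ_I)
      fix r :: real assume "0 < r"
      then have "(\<lambda>n. measure M {x\<in>space M. \<bar>X n x - c\<bar> > r/2}) \<longlonglongrightarrow> 0"
        using c half_gt_zero[OF \<open>0 < r\<close>] unfolding conv_in_prob_def by blast
      from LIMSEQ_D[OF this, of "r/2"] \<open>0 < r\<close> obtain N where
        N: "\<And>n. n \<ge> N \<Longrightarrow> measure M {x\<in>space M. \<bar>X n x - c\<bar> > r/2} < r/2" by auto
      have "norm (expectation (\<lambda>x. min 1 \<bar>X n x - c\<bar>) - 0) < r" if "n \<ge> N" for n
      proof -
        have "{x\<in>space M. \<bar>X n x - c\<bar> > r/2} \<in> sets M" by measurable
        then have ind: "integrable M (indicat_real {x\<in>space M. \<bar>X n x - c\<bar> > r/2})"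
          by (rule integrable_real_indicator) (simp add: emeasure_eq_measure)
        have "expectation (\<lambda>x. min 1 \<bar>X n x - c\<bar>)
            \<le> expectation (\<lambda>x. r/2 + indicator {x\<in>space M. \<bar>X n x - c\<bar> > r/2} x)"
        proof (intro integral_mono int Bochner_Integration.integrable_add ind)
          show "min 1 \<bar>X n x - c\<bar> \<le> r/2 + indicator {x\<in>space M. \<bar>X n x - c\<bar> > r/2} x"
            if "x \<in> space M" for x
            using \<open>0 < r\<close> that by (cases "\<bar>X n x - c\<bar> > r/2") (auto simp: min_def)
        qed simp
        also have "\<dots> = r/2 + measure M {x\<in>space M. \<bar>X n x - c\<bar> > r/2}"
          using ind by (subst Bochner_Integration.integral_add)
            (simp_all add: prob_space Int_absorb2 Collect_conj_eq)
        also have "\<dots> < r" using N[OF that] by simp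
        finally show ?thesis using nn by simp
      qed
      then show "\<exists>no. \<forall>n\<ge>no. norm (expectation (\<lambda>x. min 1 \<bar>X n x - c\<bar>) - 0) < r" by blast
    qed
  next
    assume l: "(\<lambda>n. expectation (\<lambda>x. min 1 \<bar>X n x - c\<bar>)) \<longlonglongrightarrow> 0"
    show "conv_in_prob M X c" unfolding conv_in_prob_def
    proof (intro allI impI)
      fix \<epsilon> :: real assume e: "0 < \<epsilon>"
      \<comment> \<open>Markov is applied at level \<open>min 1 \<epsilon>\<close> because the
        truncated distance never exceeds 1.\<close>
      have b: "measure M {x\<in>space M. \<bar>X n x - c\<bar> > \<epsilon>} \<le> expectation (\<lambda>x. min 1 \<bar>X n x - c\<bar>) / min 1 \<epsilon>" for n
      proof -
        have "measure M {x\<in>space M. \<bar>X n x - c\<bar> > \<epsilon>} \<le> measure M {x\<in>space M. min 1 \<bar>X n x - c\<bar> \<ge> min 1 \<epsilon>}"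
          by (rule finite_measure_mono) auto
        also have "\<dots> \<le> expectation (\<lambda>x. min 1 \<bar>X n x - c\<bar>) / min 1 \<epsilon>"
          using e by (intro integral_Markov_inequality_measure[where A="space M"] int) auto
        finally show ?thesis .
      qed
      show "(\<lambda>n. measure M {x\<in>space M. \<bar>X n x - c\<bar> > \<epsilon>}) \<longlonglongrightarrow> 0"
        by (rule tendsto_sandwich[OF _ _ tendsto_const tendsto_divide_zero[OF l, of "min 1 \<epsilon>"]])
          (auto intro!: always_eventually b)
    qed
  }
qed

text \<open>L1 convergence of the truncated distance yields an almost surely convergent subsequence,
  and the truncation is eventually inactive on any path where the limit is 0.\<close>

lemma conv_in_prob_AE_subseq:
  assumes [measurable]: "\<And>n. X n \<in> borel_measurable M" and "conv_in_prob M X c"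
  obtains r :: "nat \<Rightarrow> nat" where "strict_mono r" "AE x in M. (\<lambda>n. X (r n) x) \<longlonglongrightarrow> c"
proof -
  have "(\<lambda>n. expectation (\<lambda>x. norm (min 1 \<bar>X n x - c\<bar>))) \<longlonglongrightarrow> 0"
    using assms by (simp add: conv_in_prob_iff_expectation_min)
  moreover have "integrable M (\<lambda>x. min 1 \<bar>X n x - c\<bar>)" for n
    by (rule integrable_const_bound[where B=1]) auto
  ultimately obtain r :: "nat \<Rightarrow> nat" where r: "strict_mono r"
    "AE x in M. (\<lambda>n. min 1 \<bar>X (r n) x - c\<bar>) \<longlonglongrightarrow> 0"
    using tendsto_L1_AE_subseq[of M "\<lambda>n x. min 1 \<bar>X n x - c\<bar>"] by blast
  have "(\<lambda>n. y n) \<longlonglongrightarrow> c" if l: "(\<lambda>n. min 1 \<bar>y n - c\<bar>) \<longlonglongrightarrow> 0" for y :: "nat \<Rightarrow> real"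
  proof -
    have "eventually (\<lambda>n. min 1 \<bar>y n - c\<bar> < 1) sequentially"
      using order_tendstoD(2)[OF l, of 1] by simp
    then have "eventually (\<lambda>n. min 1 \<bar>y n - c\<bar> = \<bar>y n - c\<bar>) sequentially"
      by eventually_elim auto
    from Lim_transform_eventually[OF l this] show ?thesis
      by (simp add: LIM_zero_iff tendsto_rabs_zero_iff)
  qed
  then have "AE x in M. (\<lambda>n. X (r n) x) \<longlonglongrightarrow> c" using r(2) by auto
  with r(1) that show ?thesis by blast
qed

lemma conv_in_prob_subseq:
  assumes "strict_mono r" "conv_in_prob M X c"
  shows "conv_in_prob M (\<lambda>n. X (r n)) c"
  using assms LIMSEQ_subseq_LIMSEQ unfolding conv_in_prob_def o_def by fastforce

lemma AE_conv_imp_conv_in_prob: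
  assumes [measurable]: "\<And>n. X n \<in> borel_measurable M" and l: "AE x in M. (\<lambda>n. X n x) \<longlonglongrightarrow> c"
  shows "conv_in_prob M X c"
proof -
  have "(\<lambda>n. expectation (\<lambda>x. min 1 \<bar>X n x - c\<bar>)) \<longlonglongrightarrow> expectation (\<lambda>x. 0)"
  proof (rule integral_dominated_convergence[where w="\<lambda>_. 1"])
    show "AE x in M. (\<lambda>n. min 1 \<bar>X n x - c\<bar>) \<longlonglongrightarrow> 0"
      using l
    proof eventually_elim
      case (elim x)
      from tendsto_min[OF tendsto_const[of 1] tendsto_rabs[OF LIM_zero[OF elim]]]
      show ?case by simp
    qed
  qed auto
  then show ?thesis by (simp add: conv_in_prob_iff_expectation_min)
qed

text \<open>Convergence in probability is metrizable, so it may be tested on subsequences, and there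
  almost sure convergence of a further subsequence is enough.\<close>

lemma conv_in_probI_subseq:
  assumes [measurable]: "\<And>n. X n \<in> borel_measurable M"
    and sub: "\<And>r :: nat \<Rightarrow> nat. strict_mono r \<Longrightarrow>
      \<exists>s :: nat \<Rightarrow> nat. strict_mono s \<and> (AE x in M. (\<lambda>n. X (r (s n)) x) \<longlonglongrightarrow> c)"
  shows "conv_in_prob M X c"
proof -
  define f where "f n = expectation (\<lambda>x. min 1 \<bar>X n x - c\<bar>)" for n
  have "f \<longlonglongrightarrow> 0"
  proof (rule ccontr)
    assume "\<not> f \<longlonglongrightarrow> 0"
    then obtain \<epsilon> where e: "\<epsilon> > 0" "\<And>N. \<exists>n\<ge>N. \<not> dist (f n) 0 < \<epsilon>"
      unfolding lim_sequentially by blast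
    \<comment> \<open>Enumerating the infinitely many indices that stay away from the limit gives a
      subsequence for which no further subsequence can converge almost surely to
      \<open>c\<close>.\<close>
    define S where "S = {n. \<not> dist (f n) 0 < \<epsilon>}"
    have inf: "infinite S" unfolding S_def infinite_nat_iff_unbounded_le using e(2) by auto
    define r where "r = enumerate S"
    have r: "strict_mono r" "\<And>n. r n \<in> S"
      using inf by (auto simp: r_def strict_mono_enumerate enumerate_in_set)
    from sub[OF r(1)] obtain s :: "nat \<Rightarrow> nat" where s: "strict_mono s" "AE x in M. (\<lambda>n. X (r (s n)) x) \<longlonglongrightarrow> c"
      by blast
    have "conv_in_prob M (\<lambda>n. X (r (s n))) c"
      by (rule AE_conv_imp_conv_in_prob) (use s in auto)
    then have "(\<lambda>n. f (r (s n))) \<longlonglongrightarrow> 0"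
      by (simp add: conv_in_prob_iff_expectation_min f_def)
    from metric_LIMSEQ_D[OF this e(1)] obtain n where "dist (f (r (s n))) 0 < \<epsilon>" by auto
    then show False using r(2)[of "s n"] by (auto simp: S_def)
  qed
  then show ?thesis by (simp add: conv_in_prob_iff_expectation_min f_def[abs_def])
qed

text \<open>The subsequence is thinned once for each member of the list; limits already secured
  survive further thinning.\<close>

lemma conv_in_prob_list_AE_subseq:
  assumes "\<And>X c n. (X, c) \<in> set Xs \<Longrightarrow> X n \<in> borel_measurable M"
    and "\<And>X c. (X, c) \<in> set Xs \<Longrightarrow> conv_in_prob M X c"
  shows "\<exists>r :: nat \<Rightarrow> nat. strict_mono r \<and>
    (AE x in M. \<forall>(X, c)\<in>set Xs. (\<lambda>n. X (r n) x) \<longlonglongrightarrow> c)"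
  using assms
proof (induction Xs)
  case Nil
  then show ?case by (intro exI[of _ id]) (auto simp: strict_mono_def)
next
  case (Cons Xc Xs)
  obtain X c where Xc: "Xc = (X, c)" by (cases Xc)
  obtain r :: "nat \<Rightarrow> nat" where r: "strict_mono r"
    "AE x in M. \<forall>(X, c)\<in>set Xs. (\<lambda>n. X (r n) x) \<longlonglongrightarrow> c"
    using Cons.IH Cons.prems by (metis (no_types, lifting) list.set_intros(2))
  have [measurable]: "\<And>n. X n \<in> borel_measurable M" using Cons.prems(1)[of X c] Xc by simp
  have "conv_in_prob M (\<lambda>n. X (r n)) c"
    by (rule conv_in_prob_subseq[OF r(1)]) (use Cons.prems(2) Xc in auto)
  then obtain s :: "nat \<Rightarrow> nat" where s: "strict_mono s" "AE x in M. (\<lambda>n. X (r (s n)) x) \<longlonglongrightarrow> c"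
    using conv_in_prob_AE_subseq[of "\<lambda>n. X (r n)" c] by auto
  show ?case
  proof (intro exI[of _ "r \<circ> s"] conjI)
    show "strict_mono (r \<circ> s)" using r(1) s(1) by (rule strict_mono_o)
    show "AE x in M. \<forall>(X, c)\<in>set (Xc # Xs). (\<lambda>n. X ((r \<circ> s) n) x) \<longlonglongrightarrow> c"
      using r(2) s(2)
    proof eventually_elim
      case (elim x)
      have "(\<lambda>n. X' (r (s n)) x) \<longlonglongrightarrow> c'" if "(X', c') \<in> set Xs" for X' c'
        using LIMSEQ_subseq_LIMSEQ[OF _ s(1), of "\<lambda>n. X' (r n) x" c'] elim(1) that by (auto simp: o_def)
      with elim(2) Xc show ?case by auto
    qed
  qed
qed

text \<open>Every pointwise limit theorem for real sequences that is stable under passing to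
  subsequences carries over to convergence in probability.\<close>

lemma conv_in_prob_transfer:
  fixes Xs :: "((nat \<Rightarrow> 'a \<Rightarrow> real) \<times> real) list"
  assumes "\<And>X c n. (X, c) \<in> set Xs \<Longrightarrow> X n \<in> borel_measurable M"
    and "\<And>X c. (X, c) \<in> set Xs \<Longrightarrow> conv_in_prob M X c"
    and "\<And>n. Z n \<in> borel_measurable M"
    and "AE x in M. \<forall>r :: nat \<Rightarrow> nat. strict_mono r \<longrightarrow>
      (\<forall>(X, c)\<in>set Xs. (\<lambda>n. X (r n) x) \<longlonglongrightarrow> c) \<longrightarrow> (\<lambda>n. Z (r n) x) \<longlonglongrightarrow> d"
  shows "conv_in_prob M Z d"
proof (rule conv_in_probI_subseq[OF assms(3)])
  fix r :: "nat \<Rightarrow> nat" assume r: "strict_mono r"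
  define Ys where "Ys = map (\<lambda>(X, c). (\<lambda>n. X (r n), c)) Xs"
  have "\<exists>s :: nat \<Rightarrow> nat. strict_mono s \<and> (AE x in M. \<forall>(X, c)\<in>set Ys. (\<lambda>n. X (s n) x) \<longlonglongrightarrow> c)"
    by (rule conv_in_prob_list_AE_subseq)
      (use assms(1,2) in \<open>auto simp: Ys_def intro!: conv_in_prob_subseq[OF r]\<close>)
  then obtain s :: "nat \<Rightarrow> nat" where s: "strict_mono s"
    "AE x in M. \<forall>(X, c)\<in>set Ys. (\<lambda>n. X (s n) x) \<longlonglongrightarrow> c" by blast
  have rs: "strict_mono (r \<circ> s)" using r s(1) by (rule strict_mono_o)
  have "AE x in M. (\<lambda>n. Z (r (s n)) x) \<longlonglongrightarrow> d"
    using s(2) assms(4)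
  proof eventually_elim
    case (elim x)
    have "\<forall>(X, c)\<in>set Xs. (\<lambda>n. X ((r \<circ> s) n) x) \<longlonglongrightarrow> c"
      using elim(1) by (force simp: Ys_def)
    with elim(2) rs show ?case by (auto simp: o_def)
  qed
  with s(1) show "\<exists>s. strict_mono s \<and> (AE x in M. (\<lambda>n. Z (r (s n)) x) \<longlonglongrightarrow> d)" by blast
qed

text \<open>Versions for one, two and three inputs. \<open>P\<close> carries almost sure facts about
  whole paths, such as an almost sure limit or an equality of two sequences, into the pathwise
  argument.\<close>

lemma conv_in_prob_transfer1:
  assumes "\<And>n. X n \<in> borel_measurable M" "conv_in_prob M X c"
    and "\<And>n. Z n \<in> borel_measurable M" "AE x in M. P x"
    and "\<And>x r. x \<in> space M \<Longrightarrow> P x \<Longrightarrow> strict_mono r \<Longrightarrow> (\<lambda>n. X (r n) x) \<longlonglongrightarrow> c \<Longrightarrow> (\<lambda>n. Z (r n) x) \<longlonglongrightarrow> d"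
  shows "conv_in_prob M Z d"
proof (rule conv_in_prob_transfer[where Xs="[(X, c)]"])
  show "AE x in M. \<forall>r :: nat \<Rightarrow> nat. strict_mono r \<longrightarrow>
      (\<forall>(X, c)\<in>set [(X, c)]. (\<lambda>n. X (r n) x) \<longlonglongrightarrow> c) \<longrightarrow> (\<lambda>n. Z (r n) x) \<longlonglongrightarrow> d"
    using assms(4) AE_space by eventually_elim (use assms(5) in simp)
qed (use assms in auto)

lemma conv_in_prob_transfer2:
  assumes "\<And>n. X n \<in> borel_measurable M" "conv_in_prob M X c"
    and "\<And>n. X' n \<in> borel_measurable M" "conv_in_prob M X' c'"
    and "\<And>n. Z n \<in> borel_measurable M" "AE x in M. P x"
    and "\<And>x r. x \<in> space M \<Longrightarrow> P x \<Longrightarrow> strict_mono r \<Longrightarrow> (\<lambda>n. X (r n) x) \<longlonglongrightarrow> c \<Longrightarrow>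
      (\<lambda>n. X' (r n) x) \<longlonglongrightarrow> c' \<Longrightarrow> (\<lambda>n. Z (r n) x) \<longlonglongrightarrow> d"
  shows "conv_in_prob M Z d"
proof (rule conv_in_prob_transfer[where Xs="[(X, c), (X', c')]"])
  show "AE x in M. \<forall>r :: nat \<Rightarrow> nat. strict_mono r \<longrightarrow>
      (\<forall>(X, c)\<in>set [(X, c), (X', c')]. (\<lambda>n. X (r n) x) \<longlonglongrightarrow> c) \<longrightarrow> (\<lambda>n. Z (r n) x) \<longlonglongrightarrow> d"
    using assms(6) AE_space by eventually_elim (use assms(7) in simp)
qed (use assms in auto)

lemma conv_in_prob_transfer3:
  assumes "\<And>n. X n \<in> borel_measurable M" "conv_in_prob M X c"
    and "\<And>n. X' n \<in> borel_measurable M" "conv_in_prob M X' c'"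
    and "\<And>n. X'' n \<in> borel_measurable M" "conv_in_prob M X'' c''"
    and "\<And>n. Z n \<in> borel_measurable M" "AE x in M. P x"
    and "\<And>x r. x \<in> space M \<Longrightarrow> P x \<Longrightarrow> strict_mono r \<Longrightarrow> (\<lambda>n. X (r n) x) \<longlonglongrightarrow> c \<Longrightarrow>
      (\<lambda>n. X' (r n) x) \<longlonglongrightarrow> c' \<Longrightarrow> (\<lambda>n. X'' (r n) x) \<longlonglongrightarrow> c'' \<Longrightarrow> (\<lambda>n. Z (r n) x) \<longlonglongrightarrow> d"
  shows "conv_in_prob M Z d"
proof (rule conv_in_prob_transfer[where Xs="[(X, c), (X', c'), (X'', c'')]"])
  show "AE x in M. \<forall>r :: nat \<Rightarrow> nat. strict_mono r \<longrightarrow>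
      (\<forall>(X, c)\<in>set [(X, c), (X', c'), (X'', c'')]. (\<lambda>n. X (r n) x) \<longlonglongrightarrow> c) \<longrightarrow> (\<lambda>n. Z (r n) x) \<longlonglongrightarrow> d"
    using assms(8) AE_space by eventually_elim (use assms(9) in simp)
qed (use assms in auto)

lemma conv_in_prob_cong_AE:
  assumes "\<And>n. X n \<in> borel_measurable M" "\<And>n. Z n \<in> borel_measurable M"
    and "\<And>n. AE x in M. X n x = Z n x" "conv_in_prob M X c"
  shows "conv_in_prob M Z c"
proof (rule conv_in_prob_transfer1[OF assms(1,4,2)])
  show "AE x in M. \<forall>n. X n x = Z n x" using assms(3) by (simp add: AE_all_countable)
qed simp

text \<open>For values bounded by \<open>B\<close>, the absolute value is at most
  \<open>max 1 B\<close> times its truncation at 1.\<close>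

lemma conv_in_prob_bounded_expectation:
  assumes [measurable]: "\<And>n. X n \<in> borel_measurable M"
    and "conv_in_prob M X 0" and B: "\<And>n x. x \<in> space M \<Longrightarrow> \<bar>X n x\<bar> \<le> B"
  shows "(\<lambda>n. expectation (\<lambda>x. \<bar>X n x\<bar>)) \<longlonglongrightarrow> 0"
proof -
  have l: "(\<lambda>n. max 1 B * expectation (\<lambda>x. min 1 \<bar>X n x\<bar>)) \<longlonglongrightarrow> 0"
    using conv_in_prob_iff_expectation_min[of X 0] assms by (intro tendsto_mult_right_zero) simp
  have "expectation (\<lambda>x. \<bar>X n x\<bar>) \<le> max 1 B * expectation (\<lambda>x. min 1 \<bar>X n x\<bar>)" for n
  proof -
    have "expectation (\<lambda>x. \<bar>X n x\<bar>) \<le> expectation (\<lambda>x. max 1 B * min 1 \<bar>X n x\<bar>)"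
    proof (rule integral_mono)
      show "integrable M (\<lambda>x. \<bar>X n x\<bar>)" by (rule integrable_const_bound[where B=B]) (use B in auto)
      show "integrable M (\<lambda>x. max 1 B * min 1 \<bar>X n x\<bar>)"
        by (intro integrable_mult_right integrable_const_bound[where B=1]) auto
      fix x assume "x \<in> space M"
      from B[OF this, of n] show "\<bar>X n x\<bar> \<le> max 1 B * min 1 \<bar>X n x\<bar>"
        by (cases "\<bar>X n x\<bar> \<le> 1") (auto simp: min_def max_def intro: mult_right_mono[of 1 B, simplified])
    qed
    then show ?thesis by simp
  qed
  then show ?thesis
    by (intro tendsto_sandwich[OF _ _ tendsto_const l] always_eventually allI) auto
qed

text \<open>A Slutsky argument for a factor \<open>S\<close> that need not converge in probability:
  an L2 bound makes \<open>S\<close> tight, and a tight sequence times one vanishing in probability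
  vanishes in probability.\<close>

lemma conv_in_prob_L2_bounded_mult:
  assumes [measurable]: "\<And>n. S n \<in> borel_measurable M" "\<And>n. Z n \<in> borel_measurable M"
    and int: "\<And>n. integrable M (\<lambda>x. (S n x)\<^sup>2)"
    and C: "eventually (\<lambda>n. expectation (\<lambda>x. (S n x)\<^sup>2) \<le> C) sequentially"
    and Z: "conv_in_prob M Z 0"
  shows "conv_in_prob M (\<lambda>n x. S n x * Z n x) 0"
  unfolding conv_in_prob_def
proof (intro allI impI LIMSEQ_I)
  fix \<epsilon> r :: real assume e: "0 < \<epsilon>" and r: "0 < r"
  \<comment> \<open>Chebyshev bounds the probability of \<open>\<bar>S\<bar> \<ge> K\<close> by
    \<open>(\<bar>C\<bar> + 1) / K\<^sup>2\<close>, which this choice makes equal to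
    \<open>r/2\<close>. The added 1 keeps \<open>K\<close> positive.\<close>
  define K where "K = sqrt (2 * (\<bar>C\<bar> + 1) / r)"
  have K: "K > 0" "K\<^sup>2 = 2 * (\<bar>C\<bar> + 1) / r" using r by (auto simp: K_def)
  have "(\<lambda>n. measure M {x\<in>space M. \<bar>Z n x - 0\<bar> > \<epsilon> / K}) \<longlonglongrightarrow> 0"
    using Z e K(1) by (simp add: conv_in_prob_def)
  from order_tendstoD(2)[OF this, of "r/2"] r
  have "eventually (\<lambda>n. measure M {x\<in>space M. \<bar>Z n x - 0\<bar> > \<epsilon> / K} < r/2) sequentially" by simp
  with C have "eventually (\<lambda>n. measure M {x\<in>space M. \<bar>S n x * Z n x - 0\<bar> > \<epsilon>} < r) sequentially"
  proof eventually_elim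
    case (elim n)
    have "measure M {x\<in>space M. \<bar>S n x * Z n x - 0\<bar> > \<epsilon>}
      \<le> measure M ({x\<in>space M. (S n x)\<^sup>2 \<ge> K\<^sup>2} \<union> {x\<in>space M. \<bar>Z n x - 0\<bar> > \<epsilon> / K})"
    proof (rule finite_measure_mono)
      show "{x\<in>space M. \<bar>S n x * Z n x - 0\<bar> > \<epsilon>} \<subseteq>
        {x\<in>space M. (S n x)\<^sup>2 \<ge> K\<^sup>2} \<union> {x\<in>space M. \<bar>Z n x - 0\<bar> > \<epsilon> / K}"
      proof (clarsimp, rule ccontr)
        fix x assume a: "\<epsilon> < \<bar>S n x * Z n x\<bar>" "\<not> K\<^sup>2 \<le> (S n x)\<^sup>2" "\<not> \<epsilon> / K < \<bar>Z n x\<bar>"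
        then have "\<bar>S n x\<bar> \<le> K" using K(1) abs_le_square_iff[of "S n x" K] by linarith
        moreover have "\<bar>Z n x\<bar> \<le> \<epsilon> / K" using a by simp
        ultimately have "\<bar>S n x\<bar> * \<bar>Z n x\<bar> \<le> K * (\<epsilon> / K)" by (intro mult_mono) (use K in auto)
        with a(1) K(1) show False by (simp add: abs_mult)
      qed
    qed auto
    also have "\<dots> \<le> measure M {x\<in>space M. (S n x)\<^sup>2 \<ge> K\<^sup>2} + measure M {x\<in>space M. \<bar>Z n x - 0\<bar> > \<epsilon> / K}"
      by (rule measure_Un_le) auto
    also have "measure M {x\<in>space M. (S n x)\<^sup>2 \<ge> K\<^sup>2} \<le> expectation (\<lambda>x. (S n x)\<^sup>2) / K\<^sup>2"
      using K(1) by (intro integral_Markov_inequality_measure[where A="space M"] int) auto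
    also have "\<dots> \<le> (\<bar>C\<bar> + 1) / K\<^sup>2" using elim K(1) by (intro divide_right_mono) auto
    also have "\<dots> = r/2" using r by (simp add: K(2) field_simps)
    finally show ?case using elim(2) by simp
  qed
  then show "\<exists>no. \<forall>n\<ge>no. norm (measure M {x\<in>space M. \<bar>S n x * Z n x - 0\<bar> > \<epsilon>} - 0) < r"
    by (auto simp: eventually_sequentially)
qed

section \<open>Characteristic functions and limits in probability\<close>

lemma char_distr:
  assumes [measurable]: "X \<in> borel_measurable M"
  shows "char (distr M borel X) u = expectation (\<lambda>x. iexp (u * X x))"
  unfolding char_def by (subst integral_distr) auto

text \<open>The exponentials differ by at most \<open>\<bar>u\<bar> * \<bar>X - Z\<bar>\<close>,
  which vanishes in probability, and by at most 2, so the expectations of the differences vanish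
  too.\<close>

lemma char_diff_conv_in_prob:
  assumes [measurable]: "\<And>n. X n \<in> borel_measurable M" "\<And>n. Z n \<in> borel_measurable M"
    and d: "conv_in_prob M (\<lambda>n x. X n x - Z n x) 0"
  shows "(\<lambda>n. expectation (\<lambda>x. iexp (u * X n x)) - expectation (\<lambda>x. iexp (u * Z n x))) \<longlonglongrightarrow> 0"
proof -
  define D where "D n x = cmod (iexp (u * X n x) - iexp (u * Z n x))" for n x
  have [measurable]: "\<And>n. D n \<in> borel_measurable M" unfolding D_def by measurable
  have int: "integrable M (\<lambda>x. iexp (u * X n x))" "integrable M (\<lambda>x. iexp (u * Z n x))" for n
    by (rule integrable_const_bound[where B=1]; simp)+
  have D: "D n x \<le> \<bar>u\<bar> * \<bar>X n x - Z n x\<bar>" for n x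
  proof -
    have "iexp (u * X n x) - iexp (u * Z n x) = iexp (u * Z n x) * (iexp (u * (X n x - Z n x)) - 1)"
      by (simp add: algebra_simps flip: exp_add)
    then have "D n x = cmod (iexp (u * (X n x - Z n x)) - 1)"
      by (simp add: D_def norm_mult)
    also have "\<dots> \<le> \<bar>u * (X n x - Z n x)\<bar>" using iexp_approx1[of "u * (X n x - Z n x)" 0] by simp
    finally show ?thesis by (simp add: abs_mult)
  qed
  have D0: "conv_in_prob M D 0"
  proof (rule conv_in_prob_transfer1[OF _ d])
    show "(\<lambda>n. D (r n) x) \<longlonglongrightarrow> 0" if "(\<lambda>n. X (r n) x - Z (r n) x) \<longlonglongrightarrow> 0" for r x
    proof (rule tendsto_sandwich[OF _ _ tendsto_const])
      show "(\<lambda>n. \<bar>u\<bar> * \<bar>X (r n) x - Z (r n) x\<bar>) \<longlonglongrightarrow> 0"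
        by (intro tendsto_mult_right_zero tendsto_rabs_zero that)
    qed (use D in \<open>auto simp: D_def\<close>)
    show "AE x in M. True" by simp
  qed simp_all
  have lim: "(\<lambda>n. expectation (\<lambda>x. \<bar>D n x\<bar>)) \<longlonglongrightarrow> 0"
  proof (rule conv_in_prob_bounded_expectation[OF _ D0])
    show "\<bar>D n x\<bar> \<le> 2" for n x
      unfolding D_def using norm_triangle_ineq4[of "iexp (u * X n x)" "iexp (u * Z n x)"] by simp
  qed simp
  have le: "cmod (expectation (\<lambda>x. iexp (u * X n x)) - expectation (\<lambda>x. iexp (u * Z n x)))
      \<le> expectation (\<lambda>x. \<bar>D n x\<bar>)" for n
    using integral_norm_bound[of M "\<lambda>x. iexp (u * X n x) - iexp (u * Z n x)"]
      Bochner_Integration.integral_diff[OF int, of n n] unfolding D_def by (simp only: abs_norm_cancel)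
  show ?thesis
    by (rule Lim_null_comparison[OF _ lim]) (intro always_eventually allI le)
qed

text \<open>The limit 1 is the characteristic function of the point mass at 0. Its distribution
  function jumps only at 0, so Levy continuity gives the limits at \<open>\<epsilon>\<close> and
  \<open>-\<epsilon>\<close>, and these control both tails.\<close>

lemma conv_in_prob_of_char:
  assumes [measurable]: "\<And>n. X n \<in> borel_measurable M"
    and lim: "\<And>u. (\<lambda>n. expectation (\<lambda>x. iexp (u * X n x))) \<longlonglongrightarrow> 1"
  shows "conv_in_prob M X 0"
proof -
  have rd: "real_distribution (distr M borel (X n))" for n by (rule real_distribution_distr) simp
  interpret R: real_distribution "return borel (0::real)"
    by (intro real_distribution.intro prob_space_return real_distribution_axioms.intro) auto
  have wc: "weak_conv_m (\<lambda>n. distr M borel (X n)) (return borel 0)"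
  proof (rule levy_continuity[OF rd])
    show "real_distribution (return borel (0::real))" ..
    show "(\<lambda>n. char (distr M borel (X n)) u) \<longlonglongrightarrow> char (return borel 0) u" for u
      using lim[of u] by (simp add: char_distr) (simp add: char_def integral_return)
  qed
  have cdf: "(\<lambda>n. measure M {x\<in>space M. X n x \<le> z}) \<longlonglongrightarrow> (if 0 \<le> z then 1 else 0)" if z: "z \<noteq> 0" for z
  proof -
    have c: "cdf (return borel (0::real)) y = (if 0 \<le> y then 1 else 0)" for y
      by (simp add: cdf_def measure_return indicator_def)
    have "isCont (cdf (return borel (0::real))) z"
      using z by (subst R.isCont_cdf) (auto simp: measure_return indicator_def)
    then have "(\<lambda>n. cdf (distr M borel (X n)) z) \<longlonglongrightarrow> cdf (return borel 0) z"
      using wc by (auto simp: weak_conv_m_def weak_conv_def)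
    moreover have "cdf (distr M borel (X n)) z = measure M {x\<in>space M. X n x \<le> z}" for n
      unfolding cdf_def by (subst measure_distr) (auto intro!: arg_cong[where f="measure M"])
    ultimately show ?thesis by (simp add: c)
  qed
  show ?thesis unfolding conv_in_prob_def
  proof (intro allI impI)
    fix \<epsilon> :: real assume e: "0 < \<epsilon>"
    have "(\<lambda>n. measure M {x\<in>space M. X n x \<le> -\<epsilon>} + (1 - measure M {x\<in>space M. X n x \<le> \<epsilon>})) \<longlonglongrightarrow> 0 + (1 - 1)"
      by (intro tendsto_intros) (use cdf[of \<epsilon>] cdf[of "-\<epsilon>"] e in auto)
    then have l: "(\<lambda>n. measure M {x\<in>space M. X n x \<le> -\<epsilon>} + (1 - measure M {x\<in>space M. X n x \<le> \<epsilon>})) \<longlonglongrightarrow> 0"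
      by simp
    have b: "measure M {x\<in>space M. \<bar>X n x - 0\<bar> > \<epsilon>} \<le>
      measure M {x\<in>space M. X n x \<le> -\<epsilon>} + (1 - measure M {x\<in>space M. X n x \<le> \<epsilon>})" for n
    proof -
      have "measure M {x\<in>space M. \<bar>X n x - 0\<bar> > \<epsilon>} \<le>
        measure M ({x\<in>space M. X n x \<le> -\<epsilon>} \<union> {x\<in>space M. \<not> X n x \<le> \<epsilon>})"
        by (rule finite_measure_mono) auto
      also have "\<dots> \<le> measure M {x\<in>space M. X n x \<le> -\<epsilon>} + measure M {x\<in>space M. \<not> X n x \<le> \<epsilon>}"
        by (rule measure_Un_le) auto
      also have "measure M {x\<in>space M. \<not> X n x \<le> \<epsilon>} = 1 - measure M {x\<in>space M. X n x \<le> \<epsilon>}"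
        by (rule prob_neg) measurable
      finally show ?thesis .
    qed
    show "(\<lambda>n. measure M {x\<in>space M. \<bar>X n x - 0\<bar> > \<epsilon>}) \<longlonglongrightarrow> 0"
      by (rule tendsto_sandwich[OF _ _ tendsto_const l]) (intro always_eventually allI b measure_nonneg)+
  qed
qed

end

section \<open>Martingale difference arrays\<close>

text \<open>Interpolates between two Taylor bounds: the one with the lower power is used for
  \<open>\<bar>x\<bar> \<ge> 1\<close>, the one with the higher power for
  \<open>\<bar>x\<bar> < 1\<close>. The powers are 2 and 3 in the first claim and 1 and 2 in the
  second, whence the range of \<open>p\<close>.\<close>

lemma iexp_taylor_powr:
  fixes x :: real
  assumes p: "2 < p" "p \<le> 3"
  shows "cmod (iexp x - 1 - \<i> * x + x\<^sup>2 / 2) \<le> \<bar>x\<bar> powr p"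
    and "cmod (iexp x - 1 - \<i> * x) \<le> 2 * \<bar>x\<bar> powr (p / 2)"
proof -
  have s2: "iexp x - (\<Sum>k\<le>2. (\<i> * x)^k / fact k) = iexp x - 1 - \<i> * x + x\<^sup>2 / 2"
    by (simp add: numeral_2_eq_2 power_mult_distrib)
  have s1: "iexp x - (\<Sum>k\<le>1. (\<i> * x)^k / fact k) = iexp x - 1 - \<i> * x" by simp
  show "cmod (iexp x - 1 - \<i> * x + x\<^sup>2 / 2) \<le> \<bar>x\<bar> powr p"
  proof (cases "1 \<le> \<bar>x\<bar>")
    case True
    have "cmod (iexp x - 1 - \<i> * x + x\<^sup>2 / 2) \<le> \<bar>x\<bar> powr 2"
      using iexp_approx2[of x 2] True unfolding s2 by (simp add: fact_numeral)
    also have "\<dots> \<le> \<bar>x\<bar> powr p" using True p by (intro powr_mono) auto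
    finally show ?thesis .
  next
    case False
    have "cmod (iexp x - 1 - \<i> * x + x\<^sup>2 / 2) \<le> \<bar>x\<bar> ^ 3 / 6"
      using iexp_approx1[of x 2] unfolding s2 by (simp add: fact_numeral numeral_eq_Suc)
    also have "\<dots> \<le> \<bar>x\<bar> ^ 3" by simp
    also have "\<dots> \<le> \<bar>x\<bar> powr p"
    proof (cases "x = 0")
      case False
      then have "\<bar>x\<bar> ^ 3 = \<bar>x\<bar> powr 3" by (simp add: powr_numeral)
      also have "\<dots> \<le> \<bar>x\<bar> powr p" using \<open>\<not> 1 \<le> \<bar>x\<bar>\<close> p by (intro powr_mono') auto
      finally show ?thesis .
    qed simp
    finally show ?thesis .
  qed
  show "cmod (iexp x - 1 - \<i> * x) \<le> 2 * \<bar>x\<bar> powr (p / 2)"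
  proof (cases "1 \<le> \<bar>x\<bar>")
    case True
    have "cmod (iexp x - 1 - \<i> * x) \<le> 2 * \<bar>x\<bar> powr 1"
      using iexp_approx2[of x 1] True unfolding s1 by simp
    also have "\<dots> \<le> 2 * \<bar>x\<bar> powr (p / 2)" using True p by (intro mult_left_mono powr_mono) auto
    finally show ?thesis .
  next
    case False
    have "cmod (iexp x - 1 - \<i> * x) \<le> \<bar>x\<bar> ^ 2 / 2"
      using iexp_approx1[of x 1] unfolding s1 by (simp add: numeral_eq_Suc)
    also have "\<dots> \<le> 2 * \<bar>x\<bar> ^ 2" by simp
    also have "\<dots> \<le> 2 * \<bar>x\<bar> powr (p / 2)"
    proof (cases "x = 0")
      case nz: False
      then have "\<bar>x\<bar> ^ 2 = \<bar>x\<bar> powr 2" by (simp add: powr_numeral)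
      also have "\<dots> \<le> \<bar>x\<bar> powr (p/2)" using False p nz by (intro powr_mono') auto
      finally show ?thesis by simp
    qed simp
    finally show ?thesis .
  qed
qed

text \<open>\<open>exp y * (1 - y)\<close> is what remains of a compensated factor after
  second-order expansion and after replacing the square by its conditional mean. Factoring out
  \<open>exp y\<close> leaves \<open>exp (-y) - 1 + y\<close>, bounded by
  \<open>y\<^sup>2 / (1 + y)\<close>; this lies below both \<open>y\<close> and
  \<open>y\<^sup>2\<close>, hence below every power in between.\<close>

lemma exp_mult_one_minus_bound:
  fixes y q :: real
  assumes y: "0 \<le> y" and q: "1 \<le> q" "q \<le> 2"
  shows "\<bar>exp y * (1 - y) - 1\<bar> \<le> exp y * y powr q"
proof -
  have pos: "0 \<le> exp (-y) - 1 + y" using exp_ge_add_one_self[of "-y"] by simp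
  have "exp (-y) \<le> 1 / (1 + y)"
    using exp_ge_add_one_self[of y] y by (simp add: exp_minus field_simps)
  then have "exp (-y) - 1 + y \<le> y\<^sup>2 / (1 + y)"
    using y by (simp add: field_simps power2_eq_square)
  also have "\<dots> \<le> y powr q"
  proof (cases "1 \<le> y")
    case True
    have "y\<^sup>2 / (1 + y) \<le> y powr 1" using y True by (simp add: field_simps power2_eq_square)
    also have "\<dots> \<le> y powr q" using True q by (intro powr_mono) auto
    finally show ?thesis .
  next
    case False
    show ?thesis
    proof (cases "y = 0")
      case nz: False
      have "y\<^sup>2 / (1 + y) \<le> y\<^sup>2" using y by (simp add: field_simps)
      also have "\<dots> = y powr 2" using y nz by (simp add: powr_numeral)
      also have "\<dots> \<le> y powr q" using False q y nz by (intro powr_mono') auto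
      finally show ?thesis .
    qed simp
  qed
  finally have b: "exp (-y) - 1 + y \<le> y powr q" .
  have "exp y * (1 - y) - 1 = - (exp y * (exp (-y) - 1 + y))" by (simp add: algebra_simps flip: exp_add)
  then have "\<bar>exp y * (1 - y) - 1\<bar> = exp y * (exp (-y) - 1 + y)" using pos by simp
  also have "\<dots> \<le> exp y * y powr q" using b by simp
  finally show ?thesis .
qed

lemma powr_abs_diff_le:
  fixes a b q :: real
  assumes "0 \<le> a" "0 \<le> b" "0 \<le> q"
  shows "\<bar>a - b\<bar> powr q \<le> a powr q + b powr q"
proof -
  have "\<bar>a - b\<bar> \<le> max a b" using assms by auto
  then have "\<bar>a - b\<bar> powr q \<le> max a b powr q" using assms by (intro powr_mono2) auto
  also have "\<dots> \<le> a powr q + b powr q" by (auto simp: max_def)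
  finally show ?thesis .
qed

lemma norm_integral_le_integral:
  fixes f :: "'a \<Rightarrow> 'b::{banach, second_countable_topology}"
  assumes "integrable M f" "integrable M g" "\<And>x. x \<in> space M \<Longrightarrow> norm (f x) \<le> g x"
  shows "norm (integral\<^sup>L M f) \<le> integral\<^sup>L M g"
  using assms by (intro order_trans[OF integral_norm_bound integral_mono]) auto

text \<open>One row of a martingale difference array: \<open>H t\<close> is the information before time \<open>t\<close>,
  \<open>v\<close> the conditional variance and \<open>L\<close> a predictable bound for the conditional \<open>p\<close>-th moment.\<close>

locale martingale_row = prob_space M for M :: "'a measure" +
  fixes H :: "nat \<Rightarrow> 'a measure" and N :: nat and X v L :: "nat \<Rightarrow> 'a \<Rightarrow> real" and p :: real
  assumes p: "2 < p" "p \<le> 3"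
    and subalg: "\<And>t. subalgebra M (H t)"
    and H_Suc: "\<And>t. subalgebra (H (Suc t)) (H t)"
    and X_meas: "\<And>t. 1 \<le> t \<Longrightarrow> t \<le> N \<Longrightarrow> X t \<in> borel_measurable (H (Suc t))"
    and v_meas: "\<And>t. 1 \<le> t \<Longrightarrow> t \<le> N \<Longrightarrow> v t \<in> borel_measurable (H t)"
    and L_meas: "\<And>t. 1 \<le> t \<Longrightarrow> t \<le> N \<Longrightarrow> L t \<in> borel_measurable (H t)"
    and v_nonneg: "\<And>t x. 1 \<le> t \<Longrightarrow> t \<le> N \<Longrightarrow> x \<in> space M \<Longrightarrow> 0 \<le> v t x"
    and v_le_L: "\<And>t x. 1 \<le> t \<Longrightarrow> t \<le> N \<Longrightarrow> x \<in> space M \<Longrightarrow> v t x powr (p / 2) \<le> L t x"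
    and X_sq: "\<And>t. 1 \<le> t \<Longrightarrow> t \<le> N \<Longrightarrow> integrable M (\<lambda>x. (X t x)\<^sup>2)"
    and X_mean: "\<And>t. 1 \<le> t \<Longrightarrow> t \<le> N \<Longrightarrow> AE x in M. real_cond_exp M (H t) (X t) x = 0"
    and X_var: "\<And>t. 1 \<le> t \<Longrightarrow> t \<le> N \<Longrightarrow>
      AE x in M. real_cond_exp M (H t) (\<lambda>x. (X t x)\<^sup>2) x = v t x"
    and X_mom: "\<And>t Z. 1 \<le> t \<Longrightarrow> t \<le> N \<Longrightarrow> Z \<in> borel_measurable (H t) \<Longrightarrow>
      (\<And>x. x \<in> space M \<Longrightarrow> 0 \<le> Z x) \<Longrightarrow> integrable M (\<lambda>x. Z x * L t x) \<Longrightarrow>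
      integrable M (\<lambda>x. Z x * \<bar>X t x\<bar> powr p) \<and>
      expectation (\<lambda>x. Z x * \<bar>X t x\<bar> powr p) \<le> expectation (\<lambda>x. Z x * L t x)"
begin

section \<open>Predictable test functions and orthogonality\<close>

sublocale H: sigma_finite_subalgebra M "H t" for t
  by (intro finite_measure_subalgebra_is_sigma_finite finite_measure_subalgebra.intro
      finite_measure_axioms finite_measure_subalgebra_axioms.intro subalg)

lemma space_H [simp]: "space (H t) = space M"
  using subalg by (simp add: subalgebra_def)

lemma H_mono: "s \<le> t \<Longrightarrow> subalgebra (H t) (H s)"
  by (induction rule: dec_induct) (use H_Suc in \<open>auto simp: subalgebra_def\<close>)

lemma H_meas_mono: "s \<le> t \<Longrightarrow> f \<in> borel_measurable (H s) \<Longrightarrow> f \<in> borel_measurable (H t)"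
  using measurable_from_subalg[OF H_mono] .

lemma M_meas: "f \<in> borel_measurable (H s) \<Longrightarrow> f \<in> borel_measurable M"
  using measurable_from_subalg[OF subalg] .

lemma X_M [measurable]: "1 \<le> t \<Longrightarrow> t \<le> N \<Longrightarrow> X t \<in> borel_measurable M"
  using X_meas M_meas by blast

lemma v_M [measurable]: "1 \<le> t \<Longrightarrow> t \<le> N \<Longrightarrow> v t \<in> borel_measurable M"
  using v_meas M_meas by blast

lemma L_M [measurable]: "1 \<le> t \<Longrightarrow> t \<le> N \<Longrightarrow> L t \<in> borel_measurable M"
  using L_meas M_meas by blast

lemma L_nonneg: "1 \<le> t \<Longrightarrow> t \<le> N \<Longrightarrow> x \<in> space M \<Longrightarrow> 0 \<le> L t x"
  using v_le_L[of t x] powr_ge_zero[of "v t x" "p/2"] by linarith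

lemma X_int: "1 \<le> t \<Longrightarrow> t \<le> N \<Longrightarrow> integrable M (X t)"
  using square_integrable_imp_integrable[OF X_M X_sq] by auto

lemma expectation_mult_X:
  assumes t: "1 \<le> t" "t \<le> N" and Z: "Z \<in> borel_measurable (H t)"
    and i: "integrable M (\<lambda>x. Z x * X t x)"
  shows "expectation (\<lambda>x. Z x * X t x) = 0"
proof -
  note [measurable] = M_meas[OF Z]
  have "expectation (\<lambda>x. Z x * X t x) = expectation (\<lambda>x. Z x * real_cond_exp M (H t) (X t) x)"
    using H.real_cond_exp_intg(2)[OF i Z] t by simp
  also have "\<dots> = expectation (\<lambda>x. 0)"
    by (rule integral_cong_AE) (use X_mean[OF t] in auto)
  finally show ?thesis by simp
qed

lemma integrable_v: "1 \<le> t \<Longrightarrow> t \<le> N \<Longrightarrow> integrable M (v t)"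
  using H.real_cond_exp_int(1)[OF X_sq] X_var[of t]
  by (subst integrable_cong_AE[where g="real_cond_exp M (H t) (\<lambda>x. (X t x)\<^sup>2)"]) auto

lemma expectation_mult_X_sq:
  assumes t: "1 \<le> t" "t \<le> N" and Z: "Z \<in> borel_measurable (H t)"
    and i: "integrable M (\<lambda>x. Z x * (X t x)\<^sup>2)"
  shows "expectation (\<lambda>x. Z x * (X t x)\<^sup>2) = expectation (\<lambda>x. Z x * v t x)"
proof -
  note [measurable] = M_meas[OF Z]
  have "expectation (\<lambda>x. Z x * (X t x)\<^sup>2)
      = expectation (\<lambda>x. Z x * real_cond_exp M (H t) (\<lambda>x. (X t x)\<^sup>2) x)"
    using H.real_cond_exp_intg(2)[OF i Z] t by simp
  also have "\<dots> = expectation (\<lambda>x. Z x * v t x)"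
    by (rule integral_cong_AE) (use X_var[OF t] t in auto)
  finally show ?thesis .
qed

text \<open>Conditional expectations are real-valued here, so a complex weight is split into its
  real and imaginary parts. These weights will be products of earlier complex exponentials.\<close>

lemma expectation_complex_mult:
  fixes Z :: "'a \<Rightarrow> complex"
  assumes t: "1 \<le> t" "t \<le> N" and Z: "Z \<in> borel_measurable (H t)"
    and b: "\<And>x. x \<in> space M \<Longrightarrow> cmod (Z x) \<le> b"
  shows "integrable M (\<lambda>x. Z x * X t x)" "expectation (\<lambda>x. Z x * X t x) = 0"
    and "integrable M (\<lambda>x. Z x * of_real ((X t x)\<^sup>2 - v t x))"
      "expectation (\<lambda>x. Z x * of_real ((X t x)\<^sup>2 - v t x)) = 0"
proof -
  have [measurable]: "Z \<in> borel_measurable M" using M_meas[OF Z] .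
  have Z': "(\<lambda>x. Re (Z x)) \<in> borel_measurable (H t)" "(\<lambda>x. Im (Z x)) \<in> borel_measurable (H t)"
    using Z by measurable
  have bdd: "integrable M (\<lambda>x. Z x * of_real (f x))" if f: "integrable M f" for f
  proof (rule Bochner_Integration.integrable_bound[where f="\<lambda>x. b * f x"])
    show "AE x in M. norm (Z x * of_real (f x)) \<le> norm (b * f x)"
    proof (rule AE_I2)
      fix x assume w: "x \<in> space M"
      have "cmod (Z x) \<le> \<bar>b\<bar>" using b[OF w] by linarith
      then show "norm (Z x * of_real (f x)) \<le> norm (b * f x)"
        by (simp add: norm_mult abs_mult mult_right_mono)
    qed
  qed (use f in auto)
  show i1: "integrable M (\<lambda>x. Z x * X t x)" by (rule bdd[OF X_int[OF t]])
  have iv: "integrable M (v t)" by (rule integrable_v[OF t])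
  have i2: "integrable M (\<lambda>x. Z x * of_real ((X t x)\<^sup>2))" by (rule bdd[OF X_sq[OF t]])
  have i3: "integrable M (\<lambda>x. Z x * of_real (v t x))" by (rule bdd[OF iv])
  show i4: "integrable M (\<lambda>x. Z x * of_real ((X t x)\<^sup>2 - v t x))"
    by (rule bdd[OF Bochner_Integration.integrable_diff[OF X_sq[OF t] iv]])
  have r: "integrable M (\<lambda>x. Re (Z x) * f x)" "integrable M (\<lambda>x. Im (Z x) * f x)"
    "Re (expectation (\<lambda>x. Z x * of_real (f x))) = expectation (\<lambda>x. Re (Z x) * f x)"
    "Im (expectation (\<lambda>x. Z x * of_real (f x))) = expectation (\<lambda>x. Im (Z x) * f x)"
    if f: "integrable M f" for f
    using integrable_Re[OF bdd[OF f]] integrable_Im[OF bdd[OF f]]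
      integral_Re[OF bdd[OF f]] integral_Im[OF bdd[OF f]] by simp_all
  show "expectation (\<lambda>x. Z x * X t x) = 0"
    using r[OF X_int[OF t]] expectation_mult_X[OF t Z'(1)] expectation_mult_X[OF t Z'(2)]
    by (simp add: complex_eq_iff)
  have "expectation (\<lambda>x. Z x * of_real ((X t x)\<^sup>2)) = expectation (\<lambda>x. Z x * of_real (v t x))"
    using r[OF X_sq[OF t]] r[OF iv] expectation_mult_X_sq[OF t Z'(1)] expectation_mult_X_sq[OF t Z'(2)]
    by (simp add: complex_eq_iff)
  moreover have "expectation (\<lambda>x. Z x * of_real ((X t x)\<^sup>2 - v t x)) =
    expectation (\<lambda>x. Z x * of_real ((X t x)\<^sup>2)) - expectation (\<lambda>x. Z x * of_real (v t x))"
    unfolding Bochner_Integration.integral_diff[OF i2 i3, symmetric] by (simp add: right_diff_distrib)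
  ultimately show "expectation (\<lambda>x. Z x * of_real ((X t x)\<^sup>2 - v t x)) = 0" by simp
qed

text \<open>Martingale differences are orthogonal: the earlier partial sum is known at
  \<open>H (Suc k)\<close>, so the cross term has mean zero. Its integrability comes from
  \<open>2 * \<bar>S * X\<bar> \<le> S\<^sup>2 + X\<^sup>2\<close>.\<close>

lemma expectation_square_sum:
  assumes "k \<le> N"
  shows "integrable M (\<lambda>x. (\<Sum>t=1..k. X t x)\<^sup>2) \<and>
    expectation (\<lambda>x. (\<Sum>t=1..k. X t x)\<^sup>2) = (\<Sum>t=1..k. expectation (v t))"
  using assms
proof (induction k)
  case (Suc k)
  define S where "S x = (\<Sum>t=1..k. X t x)" for x
  have t: "1 \<le> Suc k" "Suc k \<le> N" using Suc.prems by auto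
  have S_H: "S \<in> borel_measurable (H (Suc k))"
    unfolding S_def using Suc.prems by (intro borel_measurable_sum H_meas_mono[OF _ X_meas]) auto
  note [measurable] = M_meas[OF S_H]
  have iS: "integrable M (\<lambda>x. (S x)\<^sup>2)" "expectation (\<lambda>x. (S x)\<^sup>2) = (\<Sum>t=1..k. expectation (v t))"
    using Suc by (auto simp: S_def)
  have iSX: "integrable M (\<lambda>x. S x * X (Suc k) x)"
  proof (rule Bochner_Integration.integrable_bound[OF Bochner_Integration.integrable_add[OF iS(1) X_sq[OF t]]])
    show "AE x in M. norm (S x * X (Suc k) x) \<le> norm ((S x)\<^sup>2 + (X (Suc k) x)\<^sup>2)"
    proof (rule AE_I2)
      fix x
      have "2 * (\<bar>S x\<bar> * \<bar>X (Suc k) x\<bar>) \<le> (S x)\<^sup>2 + (X (Suc k) x)\<^sup>2"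
        using sum_squares_bound[of "\<bar>S x\<bar>" "\<bar>X (Suc k) x\<bar>"] by simp
      moreover have "0 \<le> \<bar>S x\<bar> * \<bar>X (Suc k) x\<bar>" by simp
      ultimately show "norm (S x * X (Suc k) x) \<le> norm ((S x)\<^sup>2 + (X (Suc k) x)\<^sup>2)"
        unfolding real_norm_def abs_mult by linarith
    qed
  qed (use t in auto)
  have eq: "(\<Sum>t=1..Suc k. X t x)\<^sup>2 = (S x)\<^sup>2 + (X (Suc k) x)\<^sup>2 + 2 * (S x * X (Suc k) x)" for x
    by (simp add: S_def power2_sum)
  have int: "integrable M (\<lambda>x. (S x)\<^sup>2 + (X (Suc k) x)\<^sup>2 + 2 * (S x * X (Suc k) x))"
    using iS(1) X_sq[OF t] iSX by (intro Bochner_Integration.integrable_add integrable_mult_right)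
  have "expectation (\<lambda>x. (X (Suc k) x)\<^sup>2) = expectation (v (Suc k))"
    using expectation_mult_X_sq[OF t, of "\<lambda>_. 1"] X_sq[OF t] by simp
  moreover have "expectation (\<lambda>x. (S x)\<^sup>2 + (X (Suc k) x)\<^sup>2 + 2 * (S x * X (Suc k) x)) =
    expectation (\<lambda>x. (S x)\<^sup>2) + expectation (\<lambda>x. (X (Suc k) x)\<^sup>2) + 2 * expectation (\<lambda>x. S x * X (Suc k) x)"
    using iS(1) X_sq[OF t] iSX by (simp add: Bochner_Integration.integral_add)
  moreover have "expectation (\<lambda>x. S x * X (Suc k) x) = 0"
    by (rule expectation_mult_X[OF t S_H iSX])
  ultimately show ?case unfolding eq using int iS(2) by simp
qed simp

text \<open>A weight with values 0 and 1 in place of a stopping time, so that stopping is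
  multiplication of each term. The sums run up to and including \<open>t\<close>, but
  \<open>v t\<close> and \<open>L t\<close> are known at \<open>H t\<close>; hence the weight of
  \<open>X t\<close> is predictable, and the current term is already counted in the bounds.\<close>

definition stop :: "real \<Rightarrow> real \<Rightarrow> nat \<Rightarrow> 'a \<Rightarrow> real" where
  "stop K \<eta> t x = (if (\<Sum>s=1..t. v s x) \<le> K \<and> (\<Sum>s=1..t. L s x) \<le> \<eta> then 1 else 0)"

lemma stop_cases: "stop K \<eta> t x = 0 \<or> stop K \<eta> t x = 1"
  by (simp add: stop_def)

lemma stop_nonneg: "0 \<le> stop K \<eta> t x"
  by (simp add: stop_def)

lemma stop_meas:
  assumes "t \<le> N"
  shows "stop K \<eta> t \<in> borel_measurable (H t)"
proof -
  have "(\<lambda>x. \<Sum>s=1..t. v s x) \<in> borel_measurable (H t)" "(\<lambda>x. \<Sum>s=1..t. L s x) \<in> borel_measurable (H t)"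
    using assms by (intro borel_measurable_sum H_meas_mono[OF _ v_meas] H_meas_mono[OF _ L_meas]; simp)+
  then show ?thesis unfolding stop_def by measurable
qed

text \<open>Induction on the time: a vanishing weight leaves the previous sum unchanged, while a
  weight of one says that even the unstopped sum obeys the bound.\<close>

lemma stop_sum_le:
  assumes "t \<le> N" "x \<in> space M" "0 \<le> K" "0 \<le> \<eta>"
  shows "(\<Sum>s=1..t. v s x * stop K \<eta> s x) \<le> K" and "(\<Sum>s=1..t. L s x * stop K \<eta> s x) \<le> \<eta>"
proof -
  have "(\<Sum>s=1..t. f s x * stop K \<eta> s x) \<le> c"
    if f: "\<And>s. 1 \<le> s \<Longrightarrow> s \<le> t \<Longrightarrow> 0 \<le> f s x"
      and c: "0 \<le> c" and st: "\<And>s. stop K \<eta> s x \<noteq> 0 \<Longrightarrow> (\<Sum>r=1..s. f r x) \<le> c" for f :: "nat \<Rightarrow> 'a \<Rightarrow> real" and c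
    using f
  proof (induction t)
    case (Suc k)
    show ?case
    proof (cases "stop K \<eta> (Suc k) x = 0")
      case True
      then show ?thesis using Suc by simp
    next
      case False
      have "(\<Sum>s=1..Suc k. f s x * stop K \<eta> s x) \<le> (\<Sum>s=1..Suc k. f s x)"
        by (rule sum_mono) (use Suc.prems stop_cases in \<open>force simp: mult_left_le stop_def\<close>)
      also have "\<dots> \<le> c" by (rule st[OF False])
      finally show ?thesis .
    qed
  qed (use c in simp)
  note * = this
  show "(\<Sum>s=1..t. v s x * stop K \<eta> s x) \<le> K"
    by (rule *) (use assms v_nonneg in \<open>auto simp: stop_def split: if_splits\<close>)
  show "(\<Sum>s=1..t. L s x * stop K \<eta> s x) \<le> \<eta>"
    by (rule *) (use assms L_nonneg in \<open>auto simp: stop_def split: if_splits\<close>)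
qed

lemma stop_eq_1:
  assumes "x \<in> space M" "(\<Sum>s=1..N. v s x) \<le> K" "(\<Sum>s=1..N. L s x) \<le> \<eta>" "t \<le> N"
  shows "stop K \<eta> t x = 1"
proof -
  have "(\<Sum>s=1..t. v s x) \<le> (\<Sum>s=1..N. v s x)" "(\<Sum>s=1..t. L s x) \<le> (\<Sum>s=1..N. L s x)"
    using assms v_nonneg L_nonneg by (intro sum_mono2; auto)+
  then show ?thesis using assms by (simp add: stop_def)
qed

lemma stop_L_bound:
  assumes "1 \<le> t" "t \<le> N" "x \<in> space M" "0 \<le> K" "0 \<le> \<eta>"
  shows "L t x * stop K \<eta> t x \<le> \<eta>" "v t x * stop K \<eta> t x \<le> K"
proof -
  have "L t x * stop K \<eta> t x \<le> (\<Sum>s=1..t. L s x * stop K \<eta> s x)"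
    "v t x * stop K \<eta> t x \<le> (\<Sum>s=1..t. v s x * stop K \<eta> s x)"
    using assms by (intro member_le_sum; auto intro!: mult_nonneg_nonneg L_nonneg v_nonneg stop_nonneg)+
  then show "L t x * stop K \<eta> t x \<le> \<eta>" "v t x * stop K \<eta> t x \<le> K"
    using stop_sum_le[OF assms(2-5)] by auto
qed


text \<open>Telescoping: each new factor changes the expectation by that of
  \<open>P k * (\<zeta> - 1)\<close>, and the earlier product \<open>P k\<close> is a bounded weight
  known at \<open>H (Suc k)\<close>, so \<open>step\<close> applies. The changes add up to at most
  \<open>C * exp \<kappa>\<close> times the expectation of \<open>\<Sum> g\<close>.\<close>

lemma expectation_prod_minus_1_le:
  fixes \<zeta> :: "nat \<Rightarrow> 'a \<Rightarrow> complex" and y g :: "nat \<Rightarrow> 'a \<Rightarrow> real"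
  assumes \<zeta>_meas: "\<And>t. 1 \<le> t \<Longrightarrow> t \<le> N \<Longrightarrow> \<zeta> t \<in> borel_measurable (H (Suc t))"
    and g_meas: "\<And>t. 1 \<le> t \<Longrightarrow> t \<le> N \<Longrightarrow> g t \<in> borel_measurable (H t)"
    and y_meas: "\<And>t. 1 \<le> t \<Longrightarrow> t \<le> N \<Longrightarrow> y t \<in> borel_measurable (H t)"
    and norm_\<zeta>: "\<And>t x. 1 \<le> t \<Longrightarrow> t \<le> N \<Longrightarrow> x \<in> space M \<Longrightarrow> cmod (\<zeta> t x) = exp (y t x)"
    and sum_y: "\<And>t x. t \<le> N \<Longrightarrow> x \<in> space M \<Longrightarrow> (\<Sum>s=1..t. y s x) \<le> \<kappa>"
    and g_nonneg: "\<And>t x. 1 \<le> t \<Longrightarrow> t \<le> N \<Longrightarrow> x \<in> space M \<Longrightarrow> 0 \<le> g t x"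
    and sum_g: "\<And>x. x \<in> space M \<Longrightarrow> (\<Sum>t=1..N. g t x) \<le> \<eta>"
    and C: "0 \<le> C"
    and step: "\<And>t Z b. 1 \<le> t \<Longrightarrow> t \<le> N \<Longrightarrow> Z \<in> borel_measurable (H t) \<Longrightarrow>
      (\<And>x. x \<in> space M \<Longrightarrow> cmod (Z x) \<le> b) \<Longrightarrow>
      cmod (expectation (\<lambda>x. Z x * (\<zeta> t x - 1))) \<le> C * expectation (\<lambda>x. cmod (Z x) * exp (y t x) * g t x)"
  shows "cmod (expectation (\<lambda>x. \<Prod>t=1..N. \<zeta> t x) - 1) \<le> C * exp \<kappa> * \<eta>"
proof -
  define P where "P k x = (\<Prod>t=1..k. \<zeta> t x)" for k x
  have P_meas: "P k \<in> borel_measurable (H (Suc k))" if "k \<le> N" for k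
    unfolding P_def using that by (intro borel_measurable_prod H_meas_mono[OF _ \<zeta>_meas]) auto
  have P_norm: "cmod (P k x) = exp (\<Sum>t=1..k. y t x)" if "k \<le> N" "x \<in> space M" for k x
    using that norm_\<zeta> by (simp add: P_def exp_sum prod_norm[symmetric])
  have P_bdd: "cmod (P k x) \<le> exp \<kappa>" if "k \<le> N" "x \<in> space M" for k x
    using P_norm[OF that] sum_y[OF that] by simp
  have P_int: "integrable M (P k)" if "k \<le> N" for k
    by (rule integrable_const_bound[where B="exp \<kappa>"]) (use P_bdd that M_meas[OF P_meas] in auto)
  have g_le: "g t x \<le> \<eta>" if "1 \<le> t" "t \<le> N" "x \<in> space M" for t x
  proof -
    have "g t x \<le> (\<Sum>t=1..N. g t x)" using that g_nonneg by (intro member_le_sum) auto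
    then show ?thesis using sum_g[OF that(3)] by simp
  qed
  have g_int: "integrable M (g t)" if "1 \<le> t" "t \<le> N" for t
    by (rule integrable_const_bound[where B=\<eta>]) (use g_le g_nonneg that M_meas[OF g_meas] in auto)
  have "cmod (expectation (P k) - 1) \<le> C * exp \<kappa> * (\<Sum>t=1..k. expectation (g t))" if "k \<le> N" for k
    using that
  proof (induction k)
    case 0
    then show ?case by (simp add: P_def prob_space)
  next
    case (Suc k)
    then have t: "1 \<le> Suc k" "Suc k \<le> N" "k \<le> N" by auto
    have eq: "P (Suc k) x = P k x + P k x * (\<zeta> (Suc k) x - 1)" for x
      by (simp add: P_def algebra_simps)
    have "integrable M (\<lambda>x. P (Suc k) x - P k x)" using P_int t by auto
    then have i2: "integrable M (\<lambda>x. P k x * (\<zeta> (Suc k) x - 1))" unfolding eq by simp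
    have "expectation (P (Suc k)) - 1 = (expectation (P k) - 1) + expectation (\<lambda>x. P k x * (\<zeta> (Suc k) x - 1))"
      unfolding eq[abs_def] using P_int[OF t(3)] i2 by (subst Bochner_Integration.integral_add) auto
    then have "cmod (expectation (P (Suc k)) - 1) \<le>
        cmod (expectation (P k) - 1) + cmod (expectation (\<lambda>x. P k x * (\<zeta> (Suc k) x - 1)))"
      using norm_triangle_ineq by metis
    also have "cmod (expectation (\<lambda>x. P k x * (\<zeta> (Suc k) x - 1)))
        \<le> C * expectation (\<lambda>x. cmod (P k x) * exp (y (Suc k) x) * g (Suc k) x)"
      by (rule step[OF t(1,2) P_meas[OF t(3)]]) (use P_bdd[OF t(3)] in auto)
    finally have le: "cmod (expectation (P (Suc k)) - 1) \<le> cmod (expectation (P k) - 1)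
        + C * expectation (\<lambda>x. cmod (P k x) * exp (y (Suc k) x) * g (Suc k) x)" by simp
    have "expectation (\<lambda>x. cmod (P k x) * exp (y (Suc k) x) * g (Suc k) x)
        \<le> expectation (\<lambda>x. exp \<kappa> * g (Suc k) x)"
    proof (rule integral_mono')
      show "integrable M (\<lambda>x. exp \<kappa> * g (Suc k) x)" using g_int[OF t(1,2)] by simp
      fix x assume w: "x \<in> space M"
      \<comment> \<open>The weight produced by \<open>step\<close> is exactly the modulus of the
        next partial product, so \<open>\<kappa>\<close> bounds it without an additional
        constant.\<close>
      have "cmod (P k x) * exp (y (Suc k) x) = exp (\<Sum>t=1..Suc k. y t x)"
        using P_norm[OF t(3) w] by (simp add: exp_add)
      also have "\<dots> \<le> exp \<kappa>" using sum_y[OF t(2) w] by simp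
      finally show "cmod (P k x) * exp (y (Suc k) x) * g (Suc k) x \<le> exp \<kappa> * g (Suc k) x"
        using g_nonneg[OF t(1,2) w] by (intro mult_right_mono)
      show "0 \<le> exp \<kappa> * g (Suc k) x" using g_nonneg[OF t(1,2) w] by simp
    qed
    then have "C * expectation (\<lambda>x. cmod (P k x) * exp (y (Suc k) x) * g (Suc k) x)
        \<le> C * (exp \<kappa> * expectation (g (Suc k)))"
      using C by (intro mult_left_mono) simp_all
    with le Suc.IH t(3) show ?case by (simp add: algebra_simps)
  qed
  from this[of N] have "cmod (expectation (P N) - 1) \<le> C * exp \<kappa> * (\<Sum>t=1..N. expectation (g t))" by simp
  also have "(\<Sum>t=1..N. expectation (g t)) = expectation (\<lambda>x. \<Sum>t=1..N. g t x)"
    using g_int by (subst Bochner_Integration.integral_sum) auto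
  also have "\<dots> \<le> expectation (\<lambda>x. \<eta>)"
    using sum_g g_int by (intro integral_mono) auto
  finally show ?thesis using C by (simp add: P_def[abs_def] prob_space mult_left_mono)
qed

text \<open>\<open>L t\<close> itself may have infinite expectation. A bounded weight that vanishes
  once stopping has occurred sees \<open>L t\<close> only where it is at most \<open>\<eta>\<close>,
  and so meets the integrability premise of \<open>X_mom\<close>.\<close>

lemma stopped_weight_moment:
  fixes P :: "'a \<Rightarrow> complex"
  assumes t: "1 \<le> t" "t \<le> N" and K: "0 \<le> K" and \<eta>: "0 \<le> \<eta>"
    and P: "P \<in> borel_measurable (H t)" and b: "\<And>x. x \<in> space M \<Longrightarrow> cmod (P x) \<le> b"
    and stop: "\<And>x. P x = 0 \<or> stop K \<eta> t x = 1"
  shows "integrable M (\<lambda>x. cmod (P x) * L t x)" "integrable M (\<lambda>x. cmod (P x) * \<bar>X t x\<bar> powr p)"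
    and "expectation (\<lambda>x. cmod (P x) * \<bar>X t x\<bar> powr p) \<le> expectation (\<lambda>x. cmod (P x) * L t x)"
proof -
  note [measurable] = M_meas[OF P] L_M[OF t]
  show wL: "integrable M (\<lambda>x. cmod (P x) * L t x)"
  proof (rule integrable_const_bound[where B="b * \<eta>"])
    show "AE x in M. norm (cmod (P x) * L t x) \<le> b * \<eta>"
    proof (rule AE_I2)
      fix x assume s: "x \<in> space M"
      have "cmod (P x) * L t x = cmod (P x) * (L t x * stop K \<eta> t x)" using stop[of x] by auto
      also have "\<dots> \<le> b * \<eta>"
        using b[OF s] order_trans[OF norm_ge_zero b[OF s]] stop_L_bound(1)[OF t s K \<eta>] L_nonneg[OF t s] stop_nonneg
        by (intro mult_mono) auto
      finally show "norm (cmod (P x) * L t x) \<le> b * \<eta>" using L_nonneg[OF t s] by simp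
    qed
  qed measurable
  have "(\<lambda>x. cmod (P x)) \<in> borel_measurable (H t)" using P by measurable
  from X_mom[OF t this _ wL] show "integrable M (\<lambda>x. cmod (P x) * \<bar>X t x\<bar> powr p)"
    "expectation (\<lambda>x. cmod (P x) * \<bar>X t x\<bar> powr p) \<le> expectation (\<lambda>x. cmod (P x) * L t x)" by auto
qed

text \<open>The linear term and the centred quadratic term have conditional mean zero. What remains
  is the Taylor remainder \<open>R1\<close> and the compensation error \<open>R2\<close>; the two
  summands of the constant belong to these in this order.\<close>

lemma conditional_clt_step:
  fixes Z :: "'a \<Rightarrow> complex" and u :: real
  assumes t: "1 \<le> t" "t \<le> N" and K: "0 \<le> K" and \<eta>: "0 \<le> \<eta>"
    and Z: "Z \<in> borel_measurable (H t)" and b: "\<And>x. x \<in> space M \<Longrightarrow> cmod (Z x) \<le> b"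
  defines "y \<equiv> \<lambda>x. u\<^sup>2 / 2 * (v t x * stop K \<eta> t x)"
  shows "cmod (expectation (\<lambda>x. Z x * (exp (of_real (y x)) * iexp (u * (X t x * stop K \<eta> t x)) - 1)))
    \<le> (\<bar>u\<bar> powr p + (u\<^sup>2 / 2) powr (p / 2)) * expectation (\<lambda>x. cmod (Z x) * exp (y x) * (L t x * stop K \<eta> t x))"
proof -
  define g where "g = stop K \<eta> t"
  define U where "U x = u * (X t x * g x)" for x
  define P where "P x = Z x * of_real (exp (y x) * g x)" for x
  define R1 where "R1 x = Z x * of_real (exp (y x)) * (iexp (U x) - 1 - \<i> * U x + (U x)\<^sup>2 / 2)" for x
  define R2 where "R2 x = Z x * of_real (exp (y x) * (1 - y x) - 1)" for x
  define w where "w x = cmod (Z x) * exp (y x) * g x" for x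
  have gH: "g \<in> borel_measurable (H t)" unfolding g_def by (rule stop_meas[OF t(2)])
  note HM = Z gH v_meas[OF t] L_meas[OF t]
  have yH: "y \<in> borel_measurable (H t)" unfolding y_def g_def[symmetric] using HM by measurable
  have PH: "P \<in> borel_measurable (H t)" unfolding P_def using HM yH by measurable
  note [measurable] = M_meas[OF Z] M_meas[OF gH] M_meas[OF yH] M_meas[OF PH] X_M[OF t] v_M[OF t] L_M[OF t]
  have g01: "g x = 0 \<or> g x = 1" for x unfolding g_def by (rule stop_cases)
  have y0: "0 \<le> y x" if "x \<in> space M" for x
    unfolding y_def using v_nonneg[OF t that] stop_nonneg by simp
  have yK: "y x \<le> u\<^sup>2 / 2 * K" if "x \<in> space M" for x
    unfolding y_def using stop_L_bound(2)[OF t that K \<eta>] by (intro mult_left_mono) auto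
  have Pb: "cmod (P x) \<le> \<bar>b\<bar> * exp (u\<^sup>2 / 2 * K)" if w: "x \<in> space M" for x
  proof -
    have "cmod (P x) \<le> cmod (Z x) * exp (y x)"
      using g01[of x] by (auto simp: P_def norm_mult)
    also have "\<dots> \<le> \<bar>b\<bar> * exp (u\<^sup>2 / 2 * K)"
      using b[OF w] yK[OF w] by (intro mult_mono) auto
    finally show ?thesis .
  qed
  have w_norm: "w x = cmod (P x)" for x
    using g01[of x] by (auto simp: w_def P_def norm_mult)
  have w0: "0 \<le> w x" for x unfolding w_norm by simp
  have Pst: "P x = 0 \<or> stop K \<eta> t x = 1" for x using g01[of x] by (auto simp: P_def g_def)
  note wm = stopped_weight_moment[OF t K \<eta> PH Pb Pst, folded w_norm]
  note wL = wm(1) and mom = wm(2,3)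
  have R1: "cmod (R1 x) \<le> \<bar>u\<bar> powr p * (w x * \<bar>X t x\<bar> powr p)" for x
  proof -
    have "cmod (R1 x) \<le> cmod (Z x) * exp (y x) * \<bar>U x\<bar> powr p"
      unfolding R1_def norm_mult using iexp_taylor_powr(1)[OF p, of "U x"]
      by (intro mult_mono) auto
    also have "\<bar>U x\<bar> powr p = \<bar>u\<bar> powr p * (g x * \<bar>X t x\<bar> powr p)"
      using g01[of x] p by (auto simp: U_def abs_mult powr_mult)
    finally show ?thesis by (simp add: w_def algebra_simps)
  qed
  have R2: "cmod (R2 x) \<le> (u\<^sup>2 / 2) powr (p / 2) * (w x * L t x)" if s: "x \<in> space M" for x
  proof -
    have "cmod (R2 x) = cmod (Z x) * \<bar>exp (y x) * (1 - y x) - 1\<bar>"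
      unfolding R2_def norm_mult by (simp only: norm_of_real)
    also have "\<dots> \<le> cmod (Z x) * (exp (y x) * y x powr (p / 2))"
      using exp_mult_one_minus_bound[OF y0[OF s], of "p/2"] p by (intro mult_left_mono) auto
    also have "y x powr (p / 2) = (u\<^sup>2 / 2) powr (p / 2) * (g x * v t x powr (p / 2))"
      using g01[of x] v_nonneg[OF t s] p powr_mult[of "u\<^sup>2 / 2" "v t x" "p / 2"]
      unfolding y_def g_def[symmetric] by auto
    also have "cmod (Z x) * (exp (y x) * \<dots>) = (u\<^sup>2 / 2) powr (p / 2) * (w x * v t x powr (p / 2))"
      by (simp add: w_def)
    also have "\<dots> \<le> (u\<^sup>2 / 2) powr (p / 2) * (w x * L t x)"
      using v_le_L[OF t s] w0 by (intro mult_left_mono) auto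
    finally show ?thesis .
  qed
  have [measurable]: "R1 \<in> borel_measurable M" unfolding R1_def U_def by measurable
  have R1_int: "integrable M R1"
    by (rule Bochner_Integration.integrable_bound[OF integrable_mult_right[OF mom(1), of "\<bar>u\<bar> powr p"]])
      (use R1 w0 in auto)
  have [measurable]: "R2 \<in> borel_measurable M" unfolding R2_def by measurable
  have R2_int: "integrable M R2"
  proof (rule Bochner_Integration.integrable_bound[OF integrable_mult_right[OF wL, of "(u\<^sup>2 / 2) powr (p / 2)"]])
    show "AE x in M. norm (R2 x) \<le> norm ((u\<^sup>2 / 2) powr (p / 2) * (w x * L t x))"
      by (rule AE_I2) (use R2 w0 L_nonneg[OF t] in auto)
  qed measurable
  \<comment> \<open>Where \<open>g = 1\<close>, \<open>y\<close> equals
    \<open>u\<^sup>2 / 2 * v\<close>. Replacing \<open>X\<^sup>2\<close> by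
    \<open>(X\<^sup>2 - v) + v\<close> in the second-order term therefore leaves
    \<open>exp y * (1 - y) - 1\<close>, the content of \<open>R2\<close>. Where
    \<open>g = 0\<close>, both sides vanish.\<close>
  have eq: "Z x * (exp (of_real (y x)) * iexp (u * (X t x * stop K \<eta> t x)) - 1) =
      R1 x + (\<i> * u * (P x * X t x) + (- (of_real (u\<^sup>2 / 2)) * (P x * of_real ((X t x)\<^sup>2 - v t x)) + R2 x))" for x
  proof (cases "g x = 0")
    case True
    then show ?thesis by (simp add: R1_def R2_def P_def U_def y_def g_def)
  next
    case False
    then have g1: "g x = 1" using g01 by blast
    then have yv: "y x = u\<^sup>2 / 2 * v t x" by (simp add: y_def g_def)
    define c where "c = iexp (u * X t x)"
    define E where "E = complex_of_real (exp (y x))"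
    have e: "R1 x = Z x * E * (c - 1 - \<i> * (u * X t x) + (u * X t x)\<^sup>2 / 2)"
      "P x = Z x * E" "R2 x = Z x * (E * (1 - of_real (y x)) - 1)"
      "exp (of_real (y x)) = E" "iexp (u * (X t x * stop K \<eta> t x)) = c"
      using g1 by (simp_all add: R1_def P_def R2_def U_def E_def c_def exp_of_real g_def)
    have y': "complex_of_real (y x) = of_real u ^ 2 / 2 * of_real (v t x)" unfolding yv by simp
    show ?thesis unfolding e unfolding y' by (simp add: field_simps power2_eq_square)
  qed
  note PX = expectation_complex_mult[OF t PH Pb]
  have "expectation (\<lambda>x. Z x * (exp (of_real (y x)) * iexp (u * (X t x * stop K \<eta> t x)) - 1)) =
      expectation R1 + expectation R2"
    unfolding eq using R1_int R2_int PX
    by (simp add: Bochner_Integration.integral_add)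
  then have "cmod (expectation (\<lambda>x. Z x * (exp (of_real (y x)) * iexp (u * (X t x * stop K \<eta> t x)) - 1)))
      \<le> cmod (expectation R1) + cmod (expectation R2)"
    by (simp add: norm_triangle_ineq)
  also have "cmod (expectation R1) \<le> expectation (\<lambda>x. \<bar>u\<bar> powr p * (w x * \<bar>X t x\<bar> powr p))"
    using R1 mom(1) by (intro norm_integral_le_integral R1_int) auto
  also have "\<dots> \<le> \<bar>u\<bar> powr p * expectation (\<lambda>x. w x * L t x)"
    using mom(2) by (simp add: mult_left_mono)
  also have "cmod (expectation R2) \<le> expectation (\<lambda>x. (u\<^sup>2 / 2) powr (p / 2) * (w x * L t x))"
    using R2 wL by (intro norm_integral_le_integral R2_int) auto
  also have "\<dots> = (u\<^sup>2 / 2) powr (p / 2) * expectation (\<lambda>x. w x * L t x)" by simp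
  finally have "cmod (expectation (\<lambda>x. Z x * (exp (of_real (y x)) * iexp (u * (X t x * stop K \<eta> t x)) - 1)))
      \<le> (\<bar>u\<bar> powr p + (u\<^sup>2 / 2) powr (p / 2)) * expectation (\<lambda>x. w x * L t x)"
    by (simp only: distrib_right add_mono add_le_cancel_left)
  moreover have "(\<lambda>x. w x * L t x) = (\<lambda>x. cmod (Z x) * exp (y x) * (L t x * stop K \<eta> t x))"
    by (auto simp: w_def g_def)
  ultimately show ?thesis by simp
qed

text \<open>The centred squares have only moments of order \<open>p / 2\<close>, possibly less than
  two, so the expansion stops at first order. The 4 is the 2 of the Taylor bound times two
  contributions, \<open>\<bar>X\<bar> powr p\<close> and \<open>v powr (p / 2)\<close>, each
  controlled by \<open>L\<close>.\<close>

lemma conditional_lln_step: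
  fixes Z :: "'a \<Rightarrow> complex" and u :: real
  assumes t: "1 \<le> t" "t \<le> N" and K: "0 \<le> K" and \<eta>: "0 \<le> \<eta>"
    and Z: "Z \<in> borel_measurable (H t)" and b: "\<And>x. x \<in> space M \<Longrightarrow> cmod (Z x) \<le> b"
  shows "cmod (expectation (\<lambda>x. Z x * (iexp (u * (((X t x)\<^sup>2 - v t x) * stop K \<eta> t x)) - 1)))
    \<le> 4 * \<bar>u\<bar> powr (p / 2) * expectation (\<lambda>x. cmod (Z x) * (L t x * stop K \<eta> t x))"
proof -
  define g where "g = stop K \<eta> t"
  define U where "U x = u * (((X t x)\<^sup>2 - v t x) * g x)" for x
  define P where "P x = Z x * of_real (g x)" for x
  define R where "R x = Z x * (iexp (U x) - 1 - \<i> * U x)" for x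
  define w where "w x = cmod (Z x) * g x" for x
  have gH: "g \<in> borel_measurable (H t)" unfolding g_def by (rule stop_meas[OF t(2)])
  note HM = Z gH
  have PH: "P \<in> borel_measurable (H t)" unfolding P_def using HM by measurable
  note [measurable] = M_meas[OF Z] M_meas[OF gH] M_meas[OF PH] X_M[OF t] v_M[OF t] L_M[OF t]
  have g01: "g x = 0 \<or> g x = 1" for x unfolding g_def by (rule stop_cases)
  have w_norm: "w x = cmod (P x)" for x
    using g01[of x] by (auto simp: w_def P_def norm_mult)
  have Pb: "cmod (P x) \<le> \<bar>b\<bar>" if w: "x \<in> space M" for x
    using g01[of x] b[OF w] by (auto simp: P_def norm_mult)
  have w0: "0 \<le> w x" for x unfolding w_norm by simp
  have Pst: "P x = 0 \<or> stop K \<eta> t x = 1" for x using g01[of x] by (auto simp: P_def g_def)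
  note wm = stopped_weight_moment[OF t K \<eta> PH Pb Pst, folded w_norm]
  note wL = wm(1) and mom = wm(2,3)
  have R: "cmod (R x) \<le> 2 * \<bar>u\<bar> powr (p / 2) * (w x * \<bar>X t x\<bar> powr p + w x * L t x)"
    if s: "x \<in> space M" for x
  proof -
    have "cmod (R x) \<le> cmod (Z x) * (2 * \<bar>U x\<bar> powr (p / 2))"
      unfolding R_def norm_mult using iexp_taylor_powr(2)[OF p, of "U x"]
      by (intro mult_mono) auto
    also have "\<bar>U x\<bar> powr (p / 2) = \<bar>u\<bar> powr (p / 2) * (g x * \<bar>(X t x)\<^sup>2 - v t x\<bar> powr (p / 2))"
      using g01[of x] p by (auto simp: U_def abs_mult powr_mult)
    also have "cmod (Z x) * (2 * \<dots>) = 2 * \<bar>u\<bar> powr (p / 2) * (w x * \<bar>(X t x)\<^sup>2 - v t x\<bar> powr (p / 2))"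
      by (simp add: w_def)
    also have "\<dots> \<le> 2 * \<bar>u\<bar> powr (p / 2) * (w x * (\<bar>X t x\<bar> powr p + L t x))"
    proof (intro mult_left_mono)
      have "\<bar>(X t x)\<^sup>2 - v t x\<bar> powr (p / 2) \<le> (X t x)\<^sup>2 powr (p / 2) + v t x powr (p / 2)"
        using v_nonneg[OF t s] p by (intro powr_abs_diff_le) auto
      moreover have "(X t x)\<^sup>2 powr (p / 2) = \<bar>X t x\<bar> powr p"
      proof -
        have "(X t x)\<^sup>2 = \<bar>X t x\<bar> powr 2" by (cases "X t x = 0") (auto simp: powr_numeral)
        then show ?thesis by (simp only: powr_powr) simp
      qed
      ultimately show "\<bar>(X t x)\<^sup>2 - v t x\<bar> powr (p / 2) \<le> \<bar>X t x\<bar> powr p + L t x"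
        using v_le_L[OF t s] by simp
    qed (use w0 in auto)
    finally show ?thesis by (simp add: algebra_simps)
  qed
  have int: "integrable M (\<lambda>x. 2 * \<bar>u\<bar> powr (p / 2) * (w x * \<bar>X t x\<bar> powr p + w x * L t x))"
    using mom(1) wL by (intro integrable_mult_right Bochner_Integration.integrable_add)
  have [measurable]: "R \<in> borel_measurable M" unfolding R_def U_def by measurable
  have R_int: "integrable M R"
  proof (rule Bochner_Integration.integrable_bound[OF int])
    show "AE x in M. norm (R x) \<le> norm (2 * \<bar>u\<bar> powr (p / 2) * (w x * \<bar>X t x\<bar> powr p + w x * L t x))"
      by (rule AE_I2) (use R w0 L_nonneg[OF t] in auto)
  qed measurable
  have eq: "Z x * (iexp (u * (((X t x)\<^sup>2 - v t x) * stop K \<eta> t x)) - 1) =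
      R x + \<i> * u * (P x * of_real ((X t x)\<^sup>2 - v t x))" for x
    unfolding R_def P_def U_def g_def by (simp add: algebra_simps)
  note PX = expectation_complex_mult[OF t PH Pb]
  have "expectation (\<lambda>x. Z x * (iexp (u * (((X t x)\<^sup>2 - v t x) * stop K \<eta> t x)) - 1)) = expectation R"
    unfolding eq using R_int PX by (simp add: Bochner_Integration.integral_add del: of_real_diff)
  also have "cmod \<dots> \<le> expectation (\<lambda>x. 2 * \<bar>u\<bar> powr (p / 2) * (w x * \<bar>X t x\<bar> powr p + w x * L t x))"
    by (rule norm_integral_le_integral[OF R_int int R])
  also have "\<dots> = 2 * \<bar>u\<bar> powr (p / 2) * (expectation (\<lambda>x. w x * \<bar>X t x\<bar> powr p) + expectation (\<lambda>x. w x * L t x))"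
    using mom(1) wL by (simp add: Bochner_Integration.integral_add)
  also have "\<dots> \<le> 2 * \<bar>u\<bar> powr (p / 2) * (expectation (\<lambda>x. w x * L t x) + expectation (\<lambda>x. w x * L t x))"
    using mom(2) by (intro mult_left_mono) auto
  finally show ?thesis by (simp add: w_def g_def algebra_simps)
qed

lemma stopped_clt_bound:
  assumes K: "0 \<le> K" and \<eta>: "0 \<le> \<eta>"
  shows "cmod (expectation (\<lambda>x. exp (of_real (u\<^sup>2 / 2 * (\<Sum>t=1..N. v t x * stop K \<eta> t x))) *
      iexp (u * (\<Sum>t=1..N. X t x * stop K \<eta> t x))) - 1)
    \<le> (\<bar>u\<bar> powr p + (u\<^sup>2 / 2) powr (p / 2)) * exp (u\<^sup>2 / 2 * K) * \<eta>"
proof -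
  define \<zeta> where "\<zeta> t x = exp (complex_of_real (u\<^sup>2 / 2 * (v t x * stop K \<eta> t x))) * iexp (u * (X t x * stop K \<eta> t x))" for t x
  have eq: "exp (of_real (u\<^sup>2 / 2 * (\<Sum>t=1..N. v t x * stop K \<eta> t x))) *
      iexp (u * (\<Sum>t=1..N. X t x * stop K \<eta> t x)) = (\<Prod>t=1..N. \<zeta> t x)" for x
    unfolding \<zeta>_def prod.distrib by (simp add: exp_sum[symmetric] sum_distrib_left)
  show ?thesis unfolding eq
  proof (rule expectation_prod_minus_1_le[where y="\<lambda>t x. u\<^sup>2 / 2 * (v t x * stop K \<eta> t x)" and g="\<lambda>t x. L t x * stop K \<eta> t x"])
    fix t assume t: "1 \<le> t" "t \<le> N"
    note m1 = v_meas[OF t] L_meas[OF t] stop_meas[OF t(2), of K \<eta>]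
    show "(\<lambda>x. L t x * stop K \<eta> t x) \<in> borel_measurable (H t)"
      "(\<lambda>x. u\<^sup>2 / 2 * (v t x * stop K \<eta> t x)) \<in> borel_measurable (H t)"
      using m1 by measurable
    note m2 = H_meas_mono[OF le_SucI[OF order_refl] m1(1)] H_meas_mono[OF le_SucI[OF order_refl] m1(3)] X_meas[OF t]
    show "\<zeta> t \<in> borel_measurable (H (Suc t))" unfolding \<zeta>_def using m2 by measurable
    show "cmod (expectation (\<lambda>x. Z x * (\<zeta> t x - 1))) \<le> (\<bar>u\<bar> powr p + (u\<^sup>2 / 2) powr (p / 2)) *
      expectation (\<lambda>x. cmod (Z x) * exp (u\<^sup>2 / 2 * (v t x * stop K \<eta> t x)) * (L t x * stop K \<eta> t x))"
      if "Z \<in> borel_measurable (H t)" "\<And>x. x \<in> space M \<Longrightarrow> cmod (Z x) \<le> b" for Z b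
      unfolding \<zeta>_def by (rule conditional_clt_step[OF t K \<eta> that])
    show "cmod (\<zeta> t x) = exp (u\<^sup>2 / 2 * (v t x * stop K \<eta> t x))" for x
      unfolding \<zeta>_def norm_mult exp_of_real norm_of_real norm_exp_i_times by simp
    show "0 \<le> L t x * stop K \<eta> t x" if "x \<in> space M" for x
      using L_nonneg[OF t that] stop_nonneg by simp
  next
    show "(\<Sum>s=1..t. u\<^sup>2 / 2 * (v s x * stop K \<eta> s x)) \<le> u\<^sup>2 / 2 * K" if "t \<le> N" "x \<in> space M" for t x
      unfolding sum_distrib_left[symmetric] using stop_sum_le(1)[OF that K \<eta>] by (intro mult_left_mono) auto
    show "(\<Sum>t=1..N. L t x * stop K \<eta> t x) \<le> \<eta>" if "x \<in> space M" for x
      by (rule stop_sum_le(2)[OF order_refl that K \<eta>])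
  qed simp
qed

text \<open>All factors have modulus one, so the telescoping bound is used with \<open>y = 0\<close>
  and \<open>\<kappa> = 0\<close>.\<close>

lemma stopped_lln_bound:
  assumes K: "0 \<le> K" and \<eta>: "0 \<le> \<eta>"
  shows "cmod (expectation (\<lambda>x. iexp (u * (\<Sum>t=1..N. ((X t x)\<^sup>2 - v t x) * stop K \<eta> t x))) - 1)
    \<le> 4 * \<bar>u\<bar> powr (p / 2) * \<eta>"
proof -
  define \<zeta> where "\<zeta> t x = iexp (u * (((X t x)\<^sup>2 - v t x) * stop K \<eta> t x))" for t x
  have eq: "iexp (u * (\<Sum>t=1..N. ((X t x)\<^sup>2 - v t x) * stop K \<eta> t x)) = (\<Prod>t=1..N. \<zeta> t x)" for x
    unfolding \<zeta>_def by (simp add: exp_sum[symmetric] sum_distrib_left)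
  have "cmod (expectation (\<lambda>x. \<Prod>t=1..N. \<zeta> t x) - 1) \<le> 4 * \<bar>u\<bar> powr (p / 2) * exp 0 * \<eta>"
  proof (rule expectation_prod_minus_1_le[where y="\<lambda>t x. 0" and g="\<lambda>t x. L t x * stop K \<eta> t x"])
    fix t assume t: "1 \<le> t" "t \<le> N"
    note m1 = v_meas[OF t] L_meas[OF t] stop_meas[OF t(2), of K \<eta>]
    show "(\<lambda>x. L t x * stop K \<eta> t x) \<in> borel_measurable (H t)"
      using m1 by measurable
    note m2 = H_meas_mono[OF le_SucI[OF order_refl] m1(1)] H_meas_mono[OF le_SucI[OF order_refl] m1(3)] X_meas[OF t]
    show "\<zeta> t \<in> borel_measurable (H (Suc t))" unfolding \<zeta>_def using m2 by measurable
    show "cmod (expectation (\<lambda>x. Z x * (\<zeta> t x - 1))) \<le> 4 * \<bar>u\<bar> powr (p / 2) *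
      expectation (\<lambda>x. cmod (Z x) * exp 0 * (L t x * stop K \<eta> t x))"
      if "Z \<in> borel_measurable (H t)" "\<And>x. x \<in> space M \<Longrightarrow> cmod (Z x) \<le> b" for Z b
      unfolding \<zeta>_def exp_zero mult_1_right by (rule conditional_lln_step[OF t K \<eta> that])
    show "cmod (\<zeta> t x) = exp 0" for x
      unfolding \<zeta>_def norm_exp_i_times by simp
    show "0 \<le> L t x * stop K \<eta> t x" if "x \<in> space M" for x
      using L_nonneg[OF t that] stop_nonneg by simp
  next
    show "(\<Sum>t=1..N. L t x * stop K \<eta> t x) \<le> \<eta>" if "x \<in> space M" for x
      by (rule stop_sum_le(2)[OF order_refl that K \<eta>])
  qed auto
  then show ?thesis unfolding eq by simp
qed

end

section \<open>Limit theorems for martingale difference arrays\<close>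

context prob_space
begin

lemma martingale_array_conv_in_prob:
  fixes X v L :: "nat \<Rightarrow> nat \<Rightarrow> 'a \<Rightarrow> real"
  assumes row: "\<And>n. martingale_row M H n (X n) (v n) (L n) p"
    and vlim: "conv_in_prob M (\<lambda>n x. \<Sum>t=1..n. v n t x) V"
    and Llim: "conv_in_prob M (\<lambda>n x. \<Sum>t=1..n. L n t x) 0"
  shows "conv_in_prob M (\<lambda>n x. \<Sum>t=1..n. (X n t x)\<^sup>2) V"
    and "(\<lambda>n. expectation (\<lambda>x. iexp (u * (\<Sum>t=1..n. X n t x)))) \<longlonglongrightarrow> of_real (exp (- (u\<^sup>2 * V / 2)))"
proof -
  define vs where "vs n x = (\<Sum>t=1..n. v n t x)" for n x
  define Ls where "Ls n x = (\<Sum>t=1..n. L n t x)" for n x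
  note vlim' = vlim[folded vs_def[abs_def]] and Llim' = Llim[folded Ls_def[abs_def]]
  \<comment> \<open>Any level strictly above \<open>V\<close> works: the sums of conditional
    variances stay below it with probability tending to one.\<close>
  define K where "K = \<bar>V\<bar> + 1"
  have K: "0 \<le> K" "V < K" by (auto simp: K_def)
  have vs_meas [measurable]: "vs n \<in> borel_measurable M" for n
    unfolding vs_def by (intro borel_measurable_sum) (auto intro!: martingale_row.v_M[OF row])
  have Ls_meas [measurable]: "Ls n \<in> borel_measurable M" for n
    unfolding Ls_def by (intro borel_measurable_sum) (auto intro!: martingale_row.L_M[OF row])
  have sum_meas: "(\<lambda>x. \<Sum>t=1..n. f t x) \<in> borel_measurable M"
    if "\<And>t. 1 \<le> t \<Longrightarrow> t \<le> n \<Longrightarrow> f t \<in> borel_measurable M" for f :: "nat \<Rightarrow> 'a \<Rightarrow> real" and n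
    using that by (intro borel_measurable_sum) auto
  have row_meas: "X n t \<in> borel_measurable M" "v n t \<in> borel_measurable M"
    if "1 \<le> t" "t \<le> n" for n t
    using martingale_row.X_M[OF row that] martingale_row.v_M[OF row that] by auto
  text \<open>Replacing a stopped quantity by the unstopped one costs nothing in the limit, because
    with probability tending to one no stopping occurs.\<close>
  have limit: "(\<lambda>n. expectation (F n)) \<longlonglongrightarrow> 1"
    if F_meas: "\<And>n. F n \<in> borel_measurable M"
      and F_bdd: "\<And>n x. x \<in> space M \<Longrightarrow> cmod (F n x) \<le> B"
      and G_meas: "\<And>\<eta> n. G \<eta> n \<in> borel_measurable M"
      and G_bdd: "\<And>\<eta> n x. 0 < \<eta> \<Longrightarrow> x \<in> space M \<Longrightarrow> cmod (G \<eta> n x) \<le> B"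
      and G_exp: "\<And>\<eta> n. 0 < \<eta> \<Longrightarrow> cmod (expectation (G \<eta> n) - 1) \<le> C * \<eta>"
      and FG: "\<And>\<eta> n x. 0 < \<eta> \<Longrightarrow> x \<in> space M \<Longrightarrow> vs n x \<le> K \<Longrightarrow> Ls n x \<le> \<eta> \<Longrightarrow>
        cmod (F n x - G \<eta> n x) \<le> h (vs n x)"
      and h: "isCont h V" "h V = 0"
    for F :: "nat \<Rightarrow> 'a \<Rightarrow> complex" and G :: "real \<Rightarrow> nat \<Rightarrow> 'a \<Rightarrow> complex" and B C :: real and h :: "real \<Rightarrow> real"
  proof (rule LIMSEQ_I)
    fix r :: real assume r: "0 < r"
    \<comment> \<open>The level \<open>\<eta>\<close> is fixed before \<open>n\<close> grows: it
      makes the stopped expectation accurate to \<open>r / 2\<close> for all \<open>n\<close>, and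
      the price of removing the stopping falls below \<open>r / 2\<close> for large
      \<open>n\<close>.\<close>
    define \<eta> where "\<eta> = r / (2 * (\<bar>C\<bar> + 1))"
    have \<eta>: "0 < \<eta>" using r by (simp add: \<eta>_def)
    have "C * \<eta> \<le> \<bar>C\<bar> * \<eta>" using \<eta> by (intro mult_right_mono) auto
    also have "\<dots> < (\<bar>C\<bar> + 1) * \<eta>" using \<eta> by (intro mult_strict_right_mono) auto
    also have "\<dots> = r / 2" by (simp add: \<eta>_def field_simps)
    finally have C\<eta>: "C * \<eta> < r / 2" .
    note [measurable] = F_meas G_meas
    have int: "integrable M (F n)" "integrable M (G \<eta> n)" for n
      by (rule integrable_const_bound[where B=B]; use F_bdd G_bdd[OF \<eta>] in auto)+
    define D where "D n x = cmod (F n x - G \<eta> n x)" for n x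
    have [measurable]: "\<And>n. D n \<in> borel_measurable M" unfolding D_def by measurable
    have "conv_in_prob M D 0"
    proof (rule conv_in_prob_transfer2[OF vs_meas vlim' Ls_meas Llim'])
      fix x and r :: "nat \<Rightarrow> nat"
      assume w: "x \<in> space M" and l: "(\<lambda>n. vs (r n) x) \<longlonglongrightarrow> V" "(\<lambda>n. Ls (r n) x) \<longlonglongrightarrow> 0"
      have "eventually (\<lambda>n. norm (D (r n) x) \<le> h (vs (r n) x)) sequentially"
        using order_tendstoD(2)[OF l(1) K(2)] order_tendstoD(2)[OF l(2) \<eta>]
        by eventually_elim (use FG[OF \<eta> w] in \<open>simp add: D_def\<close>)
      moreover have "(\<lambda>n. h (vs (r n) x)) \<longlonglongrightarrow> 0"
        using isCont_tendsto_compose[OF h(1) l(1)] h(2) by simp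
      ultimately show "(\<lambda>n. D (r n) x) \<longlonglongrightarrow> 0" by (rule Lim_null_comparison)
    next
      show "AE x in M. True" by simp
    qed simp
    then have "(\<lambda>n. expectation (\<lambda>x. \<bar>D n x\<bar>)) \<longlonglongrightarrow> 0"
    proof (rule conv_in_prob_bounded_expectation[rotated])
      show "\<bar>D n x\<bar> \<le> 2 * B" if "x \<in> space M" for n x
        unfolding D_def using norm_triangle_ineq4[of "F n x" "G \<eta> n x"] F_bdd[OF that] G_bdd[OF \<eta> that]
        by (smt (verit) norm_ge_zero)
    qed simp
    from LIMSEQ_D[OF this half_gt_zero[OF r]] obtain n0 where
      n0: "\<And>n. n \<ge> n0 \<Longrightarrow> expectation (\<lambda>x. \<bar>D n x\<bar>) < r / 2" by auto
    have "norm (expectation (F n) - 1) < r" if n: "n \<ge> n0" for n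
    proof -
      have "cmod (expectation (F n) - expectation (G \<eta> n)) \<le> expectation (\<lambda>x. \<bar>D n x\<bar>)"
        using integral_norm_bound[of M "\<lambda>x. F n x - G \<eta> n x"]
          Bochner_Integration.integral_diff[OF int, of n n] unfolding D_def by (simp only: abs_norm_cancel)
      then have "cmod (expectation (F n) - expectation (G \<eta> n)) < r / 2" using n0[OF n] by simp
      moreover have "cmod (expectation (G \<eta> n) - 1) < r / 2" using G_exp[OF \<eta>, of n] C\<eta> by simp
      ultimately show ?thesis
        using norm_triangle_ineq[of "expectation (F n) - expectation (G \<eta> n)" "expectation (G \<eta> n) - 1"] by simp
    qed
    then show "\<exists>no. \<forall>n\<ge>no. norm (expectation (F n) - 1) < r" by blast
  qed
  let ?st = "\<lambda>\<eta> n. martingale_row.stop (v n) (L n) K \<eta>"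
  have stop_M: "?st \<eta> n t \<in> borel_measurable M" if "t \<le> n" for n t \<eta>
    using martingale_row.stop_meas[OF row that] martingale_row.M_meas[OF row] by blast
  have st1: "?st \<eta> n t x = 1"
    if "x \<in> space M" "vs n x \<le> K" "Ls n x \<le> \<eta>" "t \<le> n" for n x \<eta> t
    using martingale_row.stop_eq_1[OF row that(1)] that by (simp add: vs_def Ls_def)
  have lln: "(\<lambda>n. expectation (\<lambda>x. iexp (u * (\<Sum>t=1..n. (X n t x)\<^sup>2 - v n t x)))) \<longlonglongrightarrow> 1" for u
  proof -
    let ?F = "\<lambda>n x. iexp (u * (\<Sum>t=1..n. (X n t x)\<^sup>2 - v n t x))"
    let ?G = "\<lambda>\<eta> n x. iexp (u * (\<Sum>t=1..n. ((X n t x)\<^sup>2 - v n t x) * ?st \<eta> n t x))"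
    show ?thesis
    \<comment> \<open>Without stopping, \<open>?F\<close> and \<open>?G\<close> agree exactly, hence
      the zero error function.\<close>
    proof (rule limit[of _ 1 ?G _ "\<lambda>_. 0"])
      show "cmod (expectation (?G \<eta> n) - 1) \<le> 4 * \<bar>u\<bar> powr (p / 2) * \<eta>" if "0 < \<eta>" for \<eta> n
        using martingale_row.stopped_lln_bound[OF row K(1), of \<eta>] that by simp
      have [measurable]: "(\<lambda>x. \<Sum>t=1..n. (X n t x)\<^sup>2 - v n t x) \<in> borel_measurable M"
        "(\<lambda>x. \<Sum>t=1..n. ((X n t x)\<^sup>2 - v n t x) * ?st \<eta> n t x) \<in> borel_measurable M" for n \<eta>
        by (rule sum_meas, use row_meas stop_M in \<open>auto intro!: borel_measurable_diff borel_measurable_power borel_measurable_times\<close>)+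
      show "?F n \<in> borel_measurable M" "?G \<eta> n \<in> borel_measurable M" for \<eta> n by measurable
      show "cmod (?F n x - ?G \<eta> n x) \<le> 0" if "x \<in> space M" "vs n x \<le> K" "Ls n x \<le> \<eta>" for \<eta> n x
        using st1[OF that] by simp
    qed (simp_all only: norm_exp_i_times order_refl continuous_const)
  qed
  have diff: "conv_in_prob M (\<lambda>n x. \<Sum>t=1..n. (X n t x)\<^sup>2 - v n t x) 0"
    by (rule conv_in_prob_of_char[OF _ lln], rule sum_meas)
      (use row_meas in \<open>auto intro!: borel_measurable_diff borel_measurable_power\<close>)
  show "conv_in_prob M (\<lambda>n x. \<Sum>t=1..n. (X n t x)\<^sup>2) V"
  proof (rule conv_in_prob_transfer2[OF _ diff vs_meas vlim'])
    show "(\<lambda>x. \<Sum>t=1..n. (X n t x)\<^sup>2) \<in> borel_measurable M"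
      "(\<lambda>x. \<Sum>t=1..n. (X n t x)\<^sup>2 - v n t x) \<in> borel_measurable M" for n
      by (intro sum_meas borel_measurable_diff borel_measurable_power row_meas; assumption)+
    fix x and r :: "nat \<Rightarrow> nat"
    assume "(\<lambda>n. \<Sum>t=1..r n. (X (r n) t x)\<^sup>2 - v (r n) t x) \<longlonglongrightarrow> 0" "(\<lambda>n. vs (r n) x) \<longlonglongrightarrow> V"
    from tendsto_add[OF this] show "(\<lambda>n. \<Sum>t=1..r n. (X (r n) t x)\<^sup>2) \<longlonglongrightarrow> V"
      by (simp add: vs_def sum_subtractf)
  next
    show "AE x in M. True" by simp
  qed
  define B where "B = max (exp (u\<^sup>2 / 2 * V)) (exp (u\<^sup>2 / 2 * K))"
  let ?F = "\<lambda>n x. of_real (exp (u\<^sup>2 / 2 * V)) * iexp (u * (\<Sum>t=1..n. X n t x))"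
  let ?G = "\<lambda>\<eta> n x. exp (of_real (u\<^sup>2 / 2 * (\<Sum>t=1..n. v n t x * ?st \<eta> n t x))) *
    iexp (u * (\<Sum>t=1..n. X n t x * ?st \<eta> n t x))"
  have "(\<lambda>n. expectation (?F n)) \<longlonglongrightarrow> 1"
  \<comment> \<open>\<open>?F\<close> is compensated by the constant \<open>V\<close>,
    \<open>?G\<close> by the random stopped variance. Where no stopping occurs they differ only in
    this exponential, whose error is a continuous function of \<open>vs n x\<close> vanishing at
    \<open>V\<close>.\<close>
  proof (rule limit[of _ B ?G _ "\<lambda>y. \<bar>exp (u\<^sup>2 / 2 * V) - exp (u\<^sup>2 / 2 * y)\<bar>"])
    show "cmod (expectation (?G \<eta> n) - 1) \<le> (\<bar>u\<bar> powr p + (u\<^sup>2 / 2) powr (p / 2)) * exp (u\<^sup>2 / 2 * K) * \<eta>"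
      if "0 < \<eta>" for \<eta> n
      using martingale_row.stopped_clt_bound[OF row K(1), of \<eta>] that by simp
    have [measurable]: "(\<lambda>x. \<Sum>t=1..n. X n t x) \<in> borel_measurable M"
      "(\<lambda>x. \<Sum>t=1..n. v n t x * ?st \<eta> n t x) \<in> borel_measurable M"
      "(\<lambda>x. \<Sum>t=1..n. X n t x * ?st \<eta> n t x) \<in> borel_measurable M" for n \<eta>
      by (rule sum_meas, use row_meas stop_M in \<open>auto intro!: borel_measurable_times\<close>)+
    show "?F n \<in> borel_measurable M" "?G \<eta> n \<in> borel_measurable M" for \<eta> n by measurable
    show "cmod (?F n x) \<le> B" for n x
      unfolding norm_mult norm_of_real norm_exp_i_times B_def by simp
    show "cmod (?G \<eta> n x) \<le> B" if "0 < \<eta>" "x \<in> space M" for \<eta> n x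
    proof -
      have "exp (u\<^sup>2 / 2 * (\<Sum>t=1..n. v n t x * ?st \<eta> n t x)) \<le> exp (u\<^sup>2 / 2 * K)"
        using martingale_row.stop_sum_le(1)[OF row order_refl that(2) K(1), of \<eta> n] that(1)
        by (intro exp_le_cancel_iff[THEN iffD2] mult_left_mono) auto
      then show ?thesis unfolding norm_mult exp_of_real norm_of_real norm_exp_i_times B_def
        by (simp add: le_max_iff_disj)
    qed
    show "cmod (?F n x - ?G \<eta> n x) \<le> \<bar>exp (u\<^sup>2 / 2 * V) - exp (u\<^sup>2 / 2 * vs n x)\<bar>"
      if "x \<in> space M" "vs n x \<le> K" "Ls n x \<le> \<eta>" for \<eta> n x
    proof -
      have e: "(\<Sum>t=1..n. v n t x * ?st \<eta> n t x) = vs n x"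
        "(\<Sum>t=1..n. X n t x * ?st \<eta> n t x) = (\<Sum>t=1..n. X n t x)"
        unfolding vs_def using st1[OF that] by (auto intro!: sum.cong)
      show ?thesis unfolding e exp_of_real left_diff_distrib[symmetric] of_real_diff[symmetric]
          norm_mult norm_exp_i_times norm_of_real by simp
    qed
    show "isCont (\<lambda>y. \<bar>exp (u\<^sup>2 / 2 * V) - exp (u\<^sup>2 / 2 * y)\<bar>) V"
      by (intro continuous_intros)
  qed simp
  \<comment> \<open>The compensator in \<open>?F\<close> is deterministic, so it leaves the
    expectation and is divided out.\<close>
  from tendsto_mult[OF tendsto_const[of "complex_of_real (exp (- (u\<^sup>2 / 2 * V)))"] this]
  have "(\<lambda>n. of_real (exp (- (u\<^sup>2 / 2 * V))) * (of_real (exp (u\<^sup>2 / 2 * V)) *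
      expectation (\<lambda>x. iexp (u * (\<Sum>t=1..n. X n t x))))) \<longlonglongrightarrow> of_real (exp (- (u\<^sup>2 / 2 * V)))"
    by simp
  moreover have "of_real (exp (- (u\<^sup>2 / 2 * V))) * (of_real (exp (u\<^sup>2 / 2 * V)) * z) = z" for z :: complex
    unfolding mult.assoc[symmetric] of_real_mult[symmetric] exp_add[symmetric] by simp
  moreover have "u\<^sup>2 * V / 2 = u\<^sup>2 / 2 * V" by simp
  ultimately show "(\<lambda>n. expectation (\<lambda>x. iexp (u * (\<Sum>t=1..n. X n t x)))) \<longlonglongrightarrow> of_real (exp (- (u\<^sup>2 * V / 2)))"
    by (simp only:)
qed

end

section \<open>Adaptive experiments\<close>

lemma (in prob_space) indep_set_lebesgue_integral:
  fixes Z U :: "'a \<Rightarrow> real"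
  assumes F: "subalgebra M F" and G: "subalgebra M G" and ind: "indep_set (sets F) (sets G)"
    and Z: "Z \<in> borel_measurable F" "integrable M Z" and U: "U \<in> borel_measurable G" "integrable M U"
  shows "integrable M (\<lambda>x. Z x * U x)"
    and "expectation (\<lambda>x. Z x * U x) = expectation Z * expectation U"
proof -
  have sub: "sigma_sets (space M) {f -` A \<inter> space M |A. A \<in> sets borel} \<subseteq> sets S"
    if S: "subalgebra M S" and f: "f \<in> borel_measurable S" for S :: "'a measure" and f :: "'a \<Rightarrow> real"
  proof -
    have sp: "space S = space M" using S by (simp add: subalgebra_def)
    show ?thesis unfolding sp[symmetric]
      by (rule sets.sigma_sets_subset) (use measurable_sets[OF f] in auto)
  qed
  have "indep_var borel Z borel U" unfolding indep_var_eq
  proof (intro conjI)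
    show "indep_set (sigma_sets (space M) {Z -` A \<inter> space M |A. A \<in> sets borel})
      (sigma_sets (space M) {U -` A \<inter> space M |A. A \<in> sets borel})"
      using sub[OF F Z(1)] sub[OF G U(1)] ind F G
      by (intro indep_setI) (auto simp: subalgebra_def intro: indep_setD[OF ind])
  qed (use Z U in auto)
  then show "integrable M (\<lambda>x. Z x * U x)"
    and "expectation (\<lambda>x. Z x * U x) = expectation Z * expectation U"
    using Z U by (auto intro: indep_var_integrable indep_var_lebesgue_integral)
qed

locale adaptive_experiment = prob_space M for M :: "'a measure" +
  fixes W :: "nat \<Rightarrow> 'a \<Rightarrow> 'w::finite" and Y :: "nat \<Rightarrow> 'a \<Rightarrow> 'w \<Rightarrow> real"
    and e :: "nat \<Rightarrow> 'w \<Rightarrow> 'a \<Rightarrow> real"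
  assumes Y_indep: "indep_vars (\<lambda>_. PiM UNIV (\<lambda>_. borel)) (\<lambda>t x. Y t x) {1..}"
    and Y_ident: "\<And>t. t \<ge> 1 \<Longrightarrow>
        distr M (PiM UNIV (\<lambda>_. borel)) (\<lambda>x. Y t x) = distr M (PiM UNIV (\<lambda>_. borel)) (\<lambda>x. Y 1 x)"
    and W_meas [measurable]: "\<And>t. W t \<in> measurable M (count_space UNIV)"
    and e_meas: "\<And>t v. t \<ge> 1 \<Longrightarrow> e t v \<in> borel_measurable (hist M W Y t)"
    and e_pos: "\<And>t v x. t \<ge> 1 \<Longrightarrow> x \<in> space M \<Longrightarrow> e t v x > 0"
    and unconf: "\<And>t v. t \<ge> 1 \<Longrightarrow> AE x in M.
        real_cond_exp M (hist_future M W Y t) (indicator {x. W t x = v}) x = e t v x"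
begin

section \<open>History and future as sigma-algebras\<close>

abbreviation "H \<equiv> hist M W Y"

abbreviation "HF \<equiv> hist_future M W Y"

definition Y_events :: "nat \<Rightarrow> 'a set set" where
  "Y_events s = {(\<lambda>x. Y s x) -` A \<inter> space M | A. A \<in> sets (PiM UNIV (\<lambda>_. borel))}"

text \<open>Generated by whole outcome vectors, the objects for which independence over time is
  assumed, whereas \<open>hist_future\<close> is generated by single coordinates.\<close>

definition future :: "nat \<Rightarrow> 'a measure" where
  "future t = sigma (space M) (\<Union>s\<in>{t..}. Y_events s)"

lemma coord_meas: "(\<lambda>y. y v) \<in> borel_measurable (PiM UNIV (\<lambda>_::'w. borel :: real measure))"
  by (rule measurable_component_singleton) simp

lemma Y_rv [measurable]: "1 \<le> t \<Longrightarrow> Y t \<in> measurable M (PiM UNIV (\<lambda>_. borel))"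
  using Y_indep by (auto simp: indep_vars_def)

lemma Y_meas [measurable]: "1 \<le> t \<Longrightarrow> (\<lambda>x. Y t x v) \<in> borel_measurable M"
  by (rule measurable_compose[OF Y_rv coord_meas])

lemma Y_obs_meas [measurable]: "1 \<le> t \<Longrightarrow> (\<lambda>x. Y t x (W t x)) \<in> borel_measurable M"
  by (rule measurable_compose_countable[OF Y_meas W_meas])

lemma space_hist [simp]: "space (H t) = space M"
  and sets_hist: "sets (H t) = sigma_sets (space M)
     (\<Union>s\<in>{1..<t}. {(\<lambda>x. W s x) -` A \<inter> space M | A. True}
                 \<union> {(\<lambda>x. Y s x (W s x)) -` B \<inter> space M | B. B \<in> sets borel})"
  unfolding hist_def by (subst space_measure_of sets_measure_of; blast)+

lemma space_hist_future [simp]: "space (HF t) = space M"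
  and sets_hist_future: "sets (HF t) = sigma_sets (space M)
     ((\<Union>s\<in>{1..<t}. {(\<lambda>x. W s x) -` A \<inter> space M | A. True}
                 \<union> {(\<lambda>x. Y s x (W s x)) -` B \<inter> space M | B. B \<in> sets borel})
      \<union> (\<Union>s\<in>{t..}. \<Union>v. {(\<lambda>x. Y s x v) -` B \<inter> space M | B. B \<in> sets borel}))"
  unfolding hist_future_def by (subst space_measure_of sets_measure_of; blast)+

lemma space_future [simp]: "space (future t) = space M"
  and sets_future: "sets (future t) = sigma_sets (space M) (\<Union>s\<in>{t..}. Y_events s)"
  unfolding future_def by (subst space_measure_of sets_measure_of; auto simp: Y_events_def)+

lemma subalgebra_hist: "subalgebra M (H t)"
  unfolding subalgebra_def sets_hist
  by (auto intro!: sets.sigma_sets_subset measurable_sets[OF W_meas] measurable_sets[OF Y_obs_meas])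

lemma subalgebra_hist_future: "1 \<le> t \<Longrightarrow> subalgebra M (HF t)"
  unfolding subalgebra_def sets_hist_future
  by (auto intro!: sets.sigma_sets_subset measurable_sets[OF W_meas] measurable_sets[OF Y_obs_meas]
      measurable_sets[OF Y_meas])

lemma subalgebra_future: "1 \<le> t \<Longrightarrow> subalgebra M (future t)"
  unfolding subalgebra_def sets_future
  by (auto intro!: sets.sigma_sets_subset measurable_sets[OF Y_rv] simp: Y_events_def)

lemma hist_le_hist_future: "subalgebra (HF t) (H t)"
  unfolding subalgebra_def sets_hist sets_hist_future by (auto intro!: sigma_sets_mono')

lemma hist_mono: "s \<le> t \<Longrightarrow> subalgebra (H t) (H s)"
  unfolding subalgebra_def sets_hist by (intro conjI sigma_sets_mono' UN_mono) auto

text \<open>The arms index a product space, so measurability of every coordinate gives measurability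
  of the outcome vector.\<close>

lemma future_le_hist_future: "subalgebra (HF t) (future t)"
proof -
  have "Y s \<in> measurable (HF t) (PiM UNIV (\<lambda>_. borel))" if "t \<le> s" for s
  proof -
    have "(\<lambda>x v. Y s x v) \<in> measurable (HF t) (PiM UNIV (\<lambda>_. borel))"
    proof (rule measurable_PiM_single')
      show "(\<lambda>x. Y s x v) \<in> borel_measurable (HF t)" for v
        by (rule measurableI) (use that in \<open>auto simp: sets_hist_future intro!: sigma_sets.Basic\<close>)
    qed auto
    then show ?thesis by simp
  qed
  then have "(\<Union>s\<in>{t..}. Y_events s) \<subseteq> sets (HF t)"
    by (clarsimp simp: Y_events_def) (metis measurable_sets space_hist_future)
  then have "sigma_sets (space (HF t)) (\<Union>s\<in>{t..}. Y_events s) \<subseteq> sets (HF t)"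
    by (rule sets.sigma_sets_subset)
  then show ?thesis unfolding subalgebra_def sets_future by simp
qed

lemma W_hist: "1 \<le> s \<Longrightarrow> s < t \<Longrightarrow> W s \<in> measurable (H t) (count_space UNIV)"
  by (rule measurableI) (force simp: sets_hist intro!: sigma_sets.Basic)+

lemma Y_obs_hist: "1 \<le> s \<Longrightarrow> s < t \<Longrightarrow> (\<lambda>x. Y s x (W s x)) \<in> borel_measurable (H t)"
  by (rule measurableI) (force simp: sets_hist intro!: sigma_sets.Basic)+

lemma Y_future: "t \<le> s \<Longrightarrow> (\<lambda>x. Y s x v) \<in> borel_measurable (future t)"
proof -
  assume "t \<le> s"
  then have "Y s \<in> measurable (future t) (PiM UNIV (\<lambda>_. borel))"
    by (intro measurableI) (auto simp: sets_future Y_events_def space_PiM intro!: sigma_sets.Basic)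
  then show ?thesis by (rule measurable_compose[OF _ coord_meas])
qed

lemma arm_indicator_meas [measurable]: "indicat_real {x. W t x = v} \<in> borel_measurable M"
proof -
  have "(\<lambda>x. if W t x = v then 1 else 0 :: real) \<in> borel_measurable M" by measurable
  then show ?thesis by (simp add: indicator_def[abs_def] of_bool_def)
qed

lemma e_M [measurable]: "1 \<le> t \<Longrightarrow> e t v \<in> borel_measurable M"
  using measurable_from_subalg[OF subalgebra_hist e_meas] .

text \<open>\<open>real_cond_exp\<close> passes through \<open>enn2real\<close>, which sends an
  infinite value to 0. Comparison with the conditional expectation of 1 rules this out, so the
  hypothesis also identifies the nonnegative version, and the bound by 1 comes along.\<close>

lemma e_nn_cond_exp:
  assumes t: "1 \<le> t"
  shows "AE x in M. nn_cond_exp M (HF t) (indicator {x. W t x = v}) x = ennreal (e t v x)"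
    and "AE x in M. e t v x \<le> 1"
proof -
  interpret HF: sigma_finite_subalgebra M "HF t"
    by (intro finite_measure_subalgebra_is_sigma_finite finite_measure_subalgebra.intro
      finite_measure_axioms finite_measure_subalgebra_axioms.intro subalgebra_hist_future t)
  let ?f = "indicator {x. W t x = v} :: 'a \<Rightarrow> real"
  have fe: "(\<lambda>x. ennreal (?f x)) = indicator {x. W t x = v}" by (auto simp: indicator_def)
  have f0: "(\<lambda>x. ennreal (- ?f x)) = (\<lambda>_. 0)" by (auto simp: indicator_def ennreal_neg)
  have m: "(indicator {x. W t x = v} :: 'a \<Rightarrow> ennreal) \<in> borel_measurable M"
    by (subst fe[symmetric]) measurable
  have z: "AE x in M. nn_cond_exp M (HF t) (\<lambda>_. 0) x = 0"
    using HF.nn_cond_exp_F_meas[of "\<lambda>_. 0"] by auto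
  have "AE x in M. nn_cond_exp M (HF t) (indicator {x. W t x = v}) x \<le> nn_cond_exp M (HF t) (\<lambda>_. 1) x"
    by (rule HF.nn_cond_exp_mono) (use m in \<open>auto simp: fe[symmetric] indicator_def\<close>)
  moreover have "AE x in M. nn_cond_exp M (HF t) (\<lambda>_. 1) x = 1"
    using HF.nn_cond_exp_F_meas[of "\<lambda>_. 1"] by auto
  ultimately have le1: "AE x in M. nn_cond_exp M (HF t) (indicator {x. W t x = v}) x \<le> 1" by auto
  have "AE x in M. nn_cond_exp M (HF t) (indicator {x. W t x = v}) x = ennreal (e t v x) \<and> e t v x \<le> 1"
    using unconf[OF t, of v] z le1
  proof eventually_elim
    case (elim x)
    define y where "y = nn_cond_exp M (HF t) (indicator {x. W t x = v}) x"
    have "enn2real y = e t v x"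
      using elim(1,2) by (simp add: real_cond_exp_def fe f0 y_def)
    moreover have "y < top" using elim(3) by (simp add: y_def order_le_less_trans)
    ultimately have "y = ennreal (e t v x)" by (metis ennreal_enn2real)
    moreover have "e t v x \<le> 1" using elim(3) calculation by (simp add: y_def ennreal_le_1)
    ultimately show ?case by (simp add: y_def)
  qed
  then show "AE x in M. nn_cond_exp M (HF t) (indicator {x. W t x = v}) x = ennreal (e t v x)"
    and "AE x in M. e t v x \<le> 1" by auto
qed

text \<open>Unconfoundedness replaces the indicator by the propensity even in the presence of a
  future variable; independence then splits the product. Only \<open>Z * e\<close> has to be
  integrable, which admits weights containing \<open>1 / e\<close>. Independence is a premise
  because the induction establishing it uses this lemma at the previous time.\<close>

lemma expectation_arm_mult:
  assumes t: "1 \<le> t" and ind: "indep_set (sets (H t)) (sets (future t))"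
    and Z: "Z \<in> borel_measurable (H t)" "integrable M (\<lambda>x. Z x * e t v x)"
    and U: "U \<in> borel_measurable (future t)" "integrable M U"
  shows "integrable M (\<lambda>x. Z x * indicator {x. W t x = v} x * U x)"
    and "expectation (\<lambda>x. Z x * indicator {x. W t x = v} x * U x) =
      expectation (\<lambda>x. Z x * e t v x) * expectation U"
proof -
  interpret HF: sigma_finite_subalgebra M "HF t"
    by (intro finite_measure_subalgebra_is_sigma_finite finite_measure_subalgebra.intro
      finite_measure_axioms finite_measure_subalgebra_axioms.intro subalgebra_hist_future t)
  let ?f = "indicator {x. W t x = v} :: 'a \<Rightarrow> real"
  have ZeH: "(\<lambda>x. Z x * e t v x) \<in> borel_measurable (H t)" using Z(1) e_meas[OF t] by measurable
  note prod = indep_set_lebesgue_integral[OF subalgebra_hist subalgebra_future[OF t] ind ZeH Z(2) U]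
  have ZHF: "Z \<in> borel_measurable (HF t)" using measurable_from_subalg[OF hist_le_hist_future Z(1)] .
  have UHF: "U \<in> borel_measurable (HF t)" using measurable_from_subalg[OF future_le_hist_future U(1)] .
  have ZUHF: "(\<lambda>x. Z x * U x) \<in> borel_measurable (HF t)" using ZHF UHF by measurable
  note [measurable] = measurable_from_subalg[OF subalgebra_hist Z(1)] measurable_from_subalg[OF subalgebra_future[OF t] U(1)] e_M[OF t]
  \<comment> \<open>Done with nonnegative integrals, where the indicator may be replaced by its
    conditional expectation before integrability is known.\<close>
  have int: "integrable M (\<lambda>x. (Z x * U x) * ?f x)"
  proof (rule integrableI_bounded)
    have "(\<integral>\<^sup>+ x. ennreal (norm ((Z x * U x) * ?f x)) \<partial>M) = (\<integral>\<^sup>+ x. ennreal \<bar>Z x * U x\<bar> * ennreal (?f x) \<partial>M)"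
      by (intro nn_integral_cong) (auto simp: indicator_def)
    also have "\<dots> = (\<integral>\<^sup>+ x. ennreal \<bar>Z x * U x\<bar> * nn_cond_exp M (HF t) (\<lambda>x. ennreal (?f x)) x \<partial>M)"
    proof (rule HF.nn_cond_exp_intg[symmetric])
      show "(\<lambda>x. ennreal \<bar>Z x * U x\<bar>) \<in> borel_measurable (HF t)" using ZUHF by simp
      have "?f \<in> borel_measurable M" by measurable
      then show "(\<lambda>x. ennreal (?f x)) \<in> borel_measurable M" by simp
    qed
    also have "(\<lambda>x. ennreal (?f x)) = indicator {x. W t x = v}" by (auto simp: indicator_def)
    also have "(\<integral>\<^sup>+ x. ennreal \<bar>Z x * U x\<bar> * nn_cond_exp M (HF t) (indicator {x. W t x = v}) x \<partial>M)
        = (\<integral>\<^sup>+ x. ennreal (norm (Z x * e t v x * U x)) \<partial>M)"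
    proof (rule nn_integral_cong_AE)
      show "AE x in M. ennreal \<bar>Z x * U x\<bar> * nn_cond_exp M (HF t) (indicator {x. W t x = v}) x =
          ennreal (norm (Z x * e t v x * U x))"
        using e_nn_cond_exp(1)[OF t, of v] AE_space
      proof eventually_elim
        case (elim x)
        show ?case using e_pos[OF t elim(2), of v]
          by (simp add: elim(1) abs_mult mult_ac flip: ennreal_mult)
      qed
    qed
    also have "\<dots> < \<infinity>" using prod(1) by (simp add: integrable_iff_bounded)
    finally show "(\<integral>\<^sup>+ x. ennreal (norm ((Z x * U x) * ?f x)) \<partial>M) < \<infinity>" .
  qed measurable
  then show "integrable M (\<lambda>x. Z x * ?f x * U x)" by (simp add: mult_ac)
  have "expectation (\<lambda>x. (Z x * U x) * ?f x) =
      expectation (\<lambda>x. (Z x * U x) * real_cond_exp M (HF t) ?f x)"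
    using HF.real_cond_exp_intg(2)[OF int ZUHF] by simp
  also have "\<dots> = expectation (\<lambda>x. Z x * e t v x * U x)"
    by (rule integral_cong_AE) (use unconf[OF t, of v] in auto)
  finally show "expectation (\<lambda>x. Z x * ?f x * U x) = expectation (\<lambda>x. Z x * e t v x) * expectation U"
    unfolding prod(2) by (simp add: mult_ac)
qed

text \<open>Independence of the blocks \<open>{t}\<close> and \<open>{Suc t..}\<close>, indexed by
  the two booleans so that the grouping theorem for families applies.\<close>

lemma prob_Y_future:
  assumes t: "1 \<le> t" and B: "B \<in> sets borel" and F: "F \<in> sets (future (Suc t))"
  shows "prob ({x \<in> space M. Y t x v \<in> B} \<inter> F) = prob {x \<in> space M. Y t x v \<in> B} * prob F"
proof -
  define I where "I = (\<lambda>b. if b then {Suc t..} else {t})"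
  have "indep_sets Y_events {1..}" using Y_indep unfolding indep_vars_def2 Y_events_def[abs_def] by blast
  then have ind: "indep_sets Y_events (\<Union>b\<in>UNIV. I b)"
    by (rule indep_sets_mono_index[rotated]) (use t in \<open>auto simp: I_def\<close>)
  have "indep_sets (\<lambda>b. sigma_sets (space M) (\<Union>i\<in>I b. Y_events i)) UNIV"
  proof (rule indep_sets_collect_sigma[OF ind])
    show "Int_stable (Y_events i)" for i
      unfolding Y_events_def Int_stable_def
    proof clarsimp
      fix A B assume "A \<in> sets (PiM UNIV (\<lambda>_::'w. borel::real measure))" "B \<in> sets (PiM UNIV (\<lambda>_::'w. borel::real measure))"
      then show "\<exists>C. Y i -` A \<inter> space M \<inter> (Y i -` B \<inter> space M) = Y i -` C \<inter> space M \<and> C \<in> sets (PiM UNIV (\<lambda>_. borel))"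
        by (intro exI[of _ "A \<inter> B"]) auto
    qed
    show "disjoint_family_on I UNIV" by (auto simp: disjoint_family_on_def I_def)
  qed
  then have "prob (\<Inter>b\<in>UNIV. (if b then F else {x \<in> space M. Y t x v \<in> B})) =
      (\<Prod>b\<in>UNIV. prob (if b then F else {x \<in> space M. Y t x v \<in> B}))"
  proof (rule indep_setsD)
    have "{x \<in> space M. Y t x v \<in> B} \<in> Y_events t"
    proof -
      have "(\<lambda>y. y v) -` B \<inter> space (PiM UNIV (\<lambda>_::'w. borel::real measure)) \<in> sets (PiM UNIV (\<lambda>_. borel))"
        by (rule measurable_sets[OF coord_meas B])
      moreover have "{x \<in> space M. Y t x v \<in> B} =
          Y t -` ((\<lambda>y. y v) -` B \<inter> space (PiM UNIV (\<lambda>_::'w. borel::real measure))) \<inter> space M"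
        by (auto simp: space_PiM)
      ultimately show ?thesis unfolding Y_events_def by blast
    qed
    then show "\<forall>b\<in>UNIV. (if b then F else {x \<in> space M. Y t x v \<in> B}) \<in> sigma_sets (space M) (\<Union>i\<in>I b. Y_events i)"
      using F by (auto simp: I_def sets_future)
  qed auto
  then show ?thesis by (simp add: UNIV_bool ac_simps)
qed

text \<open>On the event that arm \<open>v\<close> is drawn, the observed outcome is
  \<open>Y t x v\<close>. Each generator of the new history, cut along the finitely many arms,
  therefore falls into pieces of the displayed form.\<close>

lemma sets_hist_Suc:
  assumes t: "1 \<le> t"
  shows "sets (H (Suc t)) \<subseteq> sigma_sets (space M)
    {A \<inter> {x\<in>space M. W t x = v} \<inter> {x\<in>space M. Y t x v \<in> B} | A v B. A \<in> sets (H t) \<and> B \<in> sets borel}"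
    (is "_ \<subseteq> sigma_sets _ ?D")
proof -
  have D: "?D \<subseteq> Pow (space M)" by auto
  interpret S: sigma_algebra "space M" "sigma_sets (space M) ?D" by (rule sigma_algebra_sigma_sets[OF D])
  have cover: "G \<in> sigma_sets (space M) ?D"
    if G: "G \<subseteq> space M" and c: "\<And>v. \<exists>A B. A \<in> sets (H t) \<and> B \<in> sets borel \<and>
      G \<inter> {x\<in>space M. W t x = v} = A \<inter> {x\<in>space M. W t x = v} \<inter> {x\<in>space M. Y t x v \<in> B}" for G
  proof -
    have "G \<inter> {x\<in>space M. W t x = v} \<in> sigma_sets (space M) ?D" for v
      using c[of v] by (intro sigma_sets.Basic) blast
    then have "(\<Union>v. G \<inter> {x\<in>space M. W t x = v}) \<in> sigma_sets (space M) ?D" by (intro S.finite_UN) auto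
    also have "(\<Union>v. G \<inter> {x\<in>space M. W t x = v}) = G" using G by auto
    finally show ?thesis .
  qed
  have sp: "space M \<in> sets (H t)" using sets.top[of "H t"] by simp
  have "G \<in> sigma_sets (space M) ?D"
    if "G \<in> (\<Union>s\<in>{1..<Suc t}. {(\<lambda>x. W s x) -` A \<inter> space M | A. True}
                 \<union> {(\<lambda>x. Y s x (W s x)) -` B \<inter> space M | B. B \<in> sets borel})" for G
  proof -
    from that obtain s where "s \<in> {1..<Suc t}" and
      Gs: "G \<in> {(\<lambda>x. W s x) -` A \<inter> space M | A. True} \<union> {(\<lambda>x. Y s x (W s x)) -` B \<inter> space M | B. B \<in> sets borel}"
      by blast
    then have s: "1 \<le> s" "s \<le> t" by auto
    show ?thesis
    proof (cases "s = t")
      case False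
      then have "s \<in> {1..<t}" using s by auto
      then have "G \<in> sets (H t)" unfolding sets_hist by (intro sigma_sets.Basic) (rule UN_I[of s], assumption, rule Gs)
      then show ?thesis
      proof (intro cover)
        show "G \<subseteq> space M" using sets.sets_into_space[OF \<open>G \<in> sets (H t)\<close>] by simp
        show "\<exists>A B. A \<in> sets (H t) \<and> B \<in> sets borel \<and>
             G \<inter> {x\<in>space M. W t x = v} = A \<inter> {x\<in>space M. W t x = v} \<inter> {x\<in>space M. Y t x v \<in> B}" for v
          by (intro exI[of _ G] exI[of _ UNIV]) (use \<open>G \<in> sets (H t)\<close> in auto)
      qed
    next
      case True
      from Gs consider A where "G = W t -` A \<inter> space M"
        | B where "B \<in> sets borel" "G = (\<lambda>x. Y t x (W t x)) -` B \<inter> space M" using True by auto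
      then show ?thesis
      proof cases
        case 1
        show ?thesis
        proof (rule cover)
          show "\<exists>A B. A \<in> sets (H t) \<and> B \<in> sets borel \<and>
             G \<inter> {x\<in>space M. W t x = v} = A \<inter> {x\<in>space M. W t x = v} \<inter> {x\<in>space M. Y t x v \<in> B}" for v
            by (intro exI[of _ "if v \<in> A then space M else {}"] exI[of _ UNIV]) (use sp 1 in auto)
        qed (use 1 in auto)
      next
        case 2
        show ?thesis
        proof (rule cover)
          show "\<exists>A B. A \<in> sets (H t) \<and> B \<in> sets borel \<and>
             G \<inter> {x\<in>space M. W t x = v} = A \<inter> {x\<in>space M. W t x = v} \<inter> {x\<in>space M. Y t x v \<in> B}" for v
            by (intro exI[of _ "space M"] exI[of _ B]) (use sp 2 in auto)
        qed (use 2 in auto)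
      qed
    qed
  qed
  note gen = this
  show ?thesis unfolding sets_hist[of "Suc t"] by (rule S.sigma_sets_subset[OF subsetI[OF gen]])
qed

text \<open>The arms depend on past outcomes, so independence has to be carried forward in time. The
  new history lies in the sigma-algebra of a pi-system of events, each recording a past event, the
  arm, and one outcome of that arm; these factor against the later outcomes.\<close>

lemma indep_hist_future:
  assumes "1 \<le> t"
  shows "indep_set (sets (H t)) (sets (future t))"
  using assms
proof (induction t rule: nat_induct_at_least)
  case base
  \<comment> \<open>No time lies in \<open>{1..<1}\<close>, so the first history is trivial.\<close>
  have "sets (H 1) = {{}, space M}" by (simp add: sets_hist sigma_sets_empty_eq)
  then show ?case
    using subalgebra_future[of 1]
    by (intro indep_setI) (auto simp: subalgebra_def prob_space dest: sets.sets_into_space[of _ M] intro!: arg_cong[where f=prob])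
next
  case (Suc t)
  let ?D = "{A \<inter> {x\<in>space M. W t x = v} \<inter> {x\<in>space M. Y t x v \<in> B} | A v B. A \<in> sets (H t) \<and> B \<in> sets borel}"
  have AM: "A \<in> sets M" if "A \<in> sets (H t)" for A using that subalgebra_hist[of t] by (auto simp: subalgebra_def)
  have FM: "F \<in> sets M" if "F \<in> sets (future (Suc t))" for F
    using that subalgebra_future[of "Suc t"] by (auto simp: subalgebra_def)
  have YM: "{x\<in>space M. Y t x v \<in> B} \<in> sets M" if "B \<in> sets borel" for v B
    using measurable_sets[OF Y_meas[OF Suc.hyps, of v] that] by (simp add: vimage_def Int_def conj_commute)
  have YF: "{x\<in>space M. Y t x v \<in> B} \<in> sets (future t)" if "B \<in> sets borel" for v B
    using measurable_sets[OF Y_future[OF order_refl, of t v] that] by (simp add: vimage_def Int_def conj_commute)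
  have FF: "F \<in> sets (future t)" if "F \<in> sets (future (Suc t))" for F
  proof -
    have "sets (future (Suc t)) \<subseteq> sets (future t)"
      unfolding sets_future by (intro sigma_sets_mono' UN_mono) auto
    then show ?thesis using that by auto
  qed
  \<comment> \<open>The event \<open>C\<close> may involve the outcomes at time \<open>t\<close>
    itself: unconfoundedness covers them, and the induction hypothesis separates \<open>C\<close>
    from the past.\<close>
  have key: "prob (A \<inter> {x\<in>space M. W t x = v} \<inter> C) = expectation (\<lambda>x. indicator A x * e t v x) * prob C"
    if A: "A \<in> sets (H t)" and C: "C \<in> sets (future t)" for A v C
  proof -
    have CM: "C \<in> sets M" using C subalgebra_future[OF Suc.hyps] by (auto simp: subalgebra_def)
    have A': "indicat_real A \<in> borel_measurable (H t)" using A by simp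
    have C': "indicat_real C \<in> borel_measurable (future t)" using C by simp
    note [measurable] = AM[OF A] CM e_M[OF Suc.hyps]
    have i1: "integrable M (\<lambda>x. indicator A x * e t v x)"
    proof (rule integrable_const_bound[where B=1])
      show "AE x in M. norm (indicator A x * e t v x) \<le> 1"
        using e_nn_cond_exp(2)[OF Suc.hyps, of v] AE_space
        by eventually_elim (use e_pos[OF Suc.hyps, of _ v] in \<open>auto simp: indicator_def abs_of_pos\<close>)
    qed measurable
    have i2: "integrable M (indicat_real C)" using CM by (intro integrable_real_indicator) (auto simp: emeasure_eq_measure)
    have "A \<inter> {x\<in>space M. W t x = v} \<inter> C \<inter> space M = A \<inter> {x\<in>space M. W t x = v} \<inter> C" by blast
    then have "prob (A \<inter> {x\<in>space M. W t x = v} \<inter> C) =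
      expectation (indicator (A \<inter> {x\<in>space M. W t x = v} \<inter> C))"
      by (simp only: Bochner_Integration.integral_indicator)
    also have "\<dots> = expectation (\<lambda>x. indicator A x * indicator {x. W t x = v} x * indicator C x)"
      by (intro Bochner_Integration.integral_cong) (auto simp: indicator_def)
    also have "\<dots> = expectation (\<lambda>x. indicator A x * e t v x) * expectation (indicat_real C)"
      by (rule expectation_arm_mult(2)[OF Suc.hyps Suc.IH A' i1 C' i2])
    also have "expectation (indicat_real C) = prob C"
      by (simp only: Bochner_Integration.integral_indicator Int_absorb2[OF sets.sets_into_space[OF CM]])
    finally show ?thesis .
  qed
  have WM: "{x\<in>space M. W t x = v} \<in> events" for v by measurable
  have DM: "?D \<subseteq> events"
    by (clarify, intro sets.Int AM YM WM)
  have "indep_set ?D (sets (future (Suc t)))"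
  proof (rule indep_setI[OF DM])
    show "sets (future (Suc t)) \<subseteq> events" using FM by auto
    fix a b assume "a \<in> ?D" and b: "b \<in> sets (future (Suc t))"
    then obtain A v B where a: "a = A \<inter> {x\<in>space M. W t x = v} \<inter> {x\<in>space M. Y t x v \<in> B}"
      and A: "A \<in> sets (H t)" and B: "B \<in> sets borel" by auto
    \<comment> \<open>\<open>key\<close> is used twice, first with the current outcome event
      intersected with \<open>b\<close> and then with the current outcome event alone;
      \<open>prob_Y_future\<close> links the two.\<close>
    have "prob (a \<inter> b) = expectation (\<lambda>x. indicator A x * e t v x) * prob ({x\<in>space M. Y t x v \<in> B} \<inter> b)"
      using key[OF A sets.Int[OF YF[OF B] FF[OF b]], of v v] unfolding a by (simp only: Int_assoc)
    also have "\<dots> = prob a * prob b"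
      unfolding prob_Y_future[OF Suc.hyps B b] a key[OF A YF[OF B]] by simp
    finally show "prob (a \<inter> b) = prob a * prob b" .
  qed
  then have ind: "indep_set (sigma_sets (space M) ?D) (sigma_sets (space M) (sets (future (Suc t))))"
  proof (rule indep_set_sigma_sets)
    show "Int_stable ?D" unfolding Int_stable_def
    proof (intro ballI)
      fix a b assume "a \<in> ?D" "b \<in> ?D"
      then obtain A v B A' v' B' where ab: "a = A \<inter> {x\<in>space M. W t x = v} \<inter> {x\<in>space M. Y t x v \<in> B}"
        "b = A' \<inter> {x\<in>space M. W t x = v'} \<inter> {x\<in>space M. Y t x v' \<in> B'}"
        "A \<in> sets (H t)" "A' \<in> sets (H t)" "B \<in> sets borel" "B' \<in> sets borel" by auto
      show "a \<inter> b \<in> ?D"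
      proof (cases "v = v'")
        case True
        then have "a \<inter> b = (A \<inter> A') \<inter> {x\<in>space M. W t x = v} \<inter> {x\<in>space M. Y t x v \<in> B \<inter> B'}"
          using ab by auto
        then show ?thesis using sets.Int[OF ab(3,4)] sets.Int[OF ab(5,6)] by blast
      next
        case False
        \<comment> \<open>Different arms exclude each other; the empty intersection is still written
          in the shape required by the pi-system.\<close>
        then have "a \<inter> b = {} \<inter> {x\<in>space M. W t x = v} \<inter> {x\<in>space M. Y t x v \<in> {}}"
          using ab by auto
        moreover have "{} \<in> sets (H t)" "{} \<in> sets (borel :: real measure)" by simp_all
        ultimately show ?thesis by blast
      qed
    qed
    show "Int_stable (sets (future (Suc t)))" by (auto simp: Int_stable_def)
  qed
  show ?case
  proof (rule indep_setI)
    show "sets (H (Suc t)) \<subseteq> events" using subalgebra_hist by (simp add: subalgebra_def)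
    show "sets (future (Suc t)) \<subseteq> events" using subalgebra_future by (simp add: subalgebra_def)
    show "prob (a \<inter> b) = prob a * prob b" if "a \<in> sets (H (Suc t))" "b \<in> sets (future (Suc t))" for a b
      by (rule indep_setD[OF ind subsetD[OF sets_hist_Suc[OF Suc.hyps] that(1)] sigma_sets.Basic[OF that(2)]])
  qed
qed

lemma expectation_arm_mult_outcome:
  fixes g :: "real \<Rightarrow> real"
  assumes t: "1 \<le> t" and Z: "Z \<in> borel_measurable (H t)" "integrable M (\<lambda>x. Z x * e t v x)"
    and g: "g \<in> borel_measurable borel" "integrable M (\<lambda>x. g (Y 1 x v))"
  shows "integrable M (\<lambda>x. Z x * indicator {x. W t x = v} x * g (Y t x v))"
    and "expectation (\<lambda>x. Z x * indicator {x. W t x = v} x * g (Y t x v)) =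
      expectation (\<lambda>x. Z x * e t v x) * expectation (\<lambda>x. g (Y 1 x v))"
proof -
  have gP: "(\<lambda>y. g (y v)) \<in> borel_measurable (PiM UNIV (\<lambda>_. borel))"
    by (rule measurable_compose[OF coord_meas g(1)])
  have U: "(\<lambda>x. g (Y t x v)) \<in> borel_measurable (future t)"
    by (rule measurable_compose[OF Y_future g(1)]) simp
  have "integrable (distr M (PiM UNIV (\<lambda>_. borel)) (Y 1)) (\<lambda>y. g (y v))"
    using g(2) gP by (subst integrable_distr_eq) auto
  then have i: "integrable M (\<lambda>x. g (Y t x v))"
    unfolding Y_ident[OF t, symmetric] using gP Y_rv[OF t] by (subst (asm) integrable_distr_eq) auto
  have "expectation (\<lambda>x. g (Y t x v)) = integral\<^sup>L (distr M (PiM UNIV (\<lambda>_. borel)) (Y t)) (\<lambda>y. g (y v))"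
    using gP Y_rv[OF t] by (subst integral_distr) auto
  also have "\<dots> = expectation (\<lambda>x. g (Y 1 x v))"
    unfolding Y_ident[OF t] using gP by (subst integral_distr) auto
  finally have E: "expectation (\<lambda>x. g (Y t x v)) = expectation (\<lambda>x. g (Y 1 x v))" .
  show "integrable M (\<lambda>x. Z x * indicator {x. W t x = v} x * g (Y t x v))"
    by (rule expectation_arm_mult(1)[OF t indep_hist_future[OF t] Z U i])
  show "expectation (\<lambda>x. Z x * indicator {x. W t x = v} x * g (Y t x v)) =
      expectation (\<lambda>x. Z x * e t v x) * expectation (\<lambda>x. g (Y 1 x v))"
    unfolding expectation_arm_mult(2)[OF t indep_hist_future[OF t] Z U i] E ..
qed

end

section \<open>A single AIPW score\<close>

locale aipw_experiment = adaptive_experiment M W Y e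
  for M :: "'a measure" and W :: "nat \<Rightarrow> 'a \<Rightarrow> 'w::finite" and Y e +
  fixes m :: "nat \<Rightarrow> 'a \<Rightarrow> real" and w :: 'w and B p :: real
  assumes m_meas: "\<And>t. 1 \<le> t \<Longrightarrow> m t \<in> borel_measurable (hist M W Y t)"
    and m_bdd: "\<And>t x. 1 \<le> t \<Longrightarrow> x \<in> space M \<Longrightarrow> \<bar>m t x\<bar> \<le> B"
    and p: "2 < p" "p \<le> 3"
    and Y_mom: "integrable M (\<lambda>x. \<bar>Y 1 x w\<bar> powr p)"
begin

definition Q :: real where "Q = expectation (\<lambda>x. Y 1 x w)"

definition \<sigma>2 :: real where "\<sigma>2 = variance (\<lambda>x. Y 1 x w)"

abbreviation \<Gamma> :: "nat \<Rightarrow> 'a \<Rightarrow> real" where "\<Gamma> \<equiv> aipw W Y e m w"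

abbreviation arm :: "nat \<Rightarrow> 'a \<Rightarrow> real" where "arm t \<equiv> indicator {x. W t x = w}"

text \<open>The propensities are at most one only almost surely; truncating them makes all predictable
  bounds hold pointwise.\<close>

definition e1 :: "nat \<Rightarrow> 'a \<Rightarrow> real" where "e1 t x = min (e t w x) 1"

text \<open>The conditional variance of the score with its factor \<open>1 / e1\<close> split off.
  What is left lies between \<open>\<sigma>2\<close> and \<open>\<sigma>2 + c0\<^sup>2\<close>,
  however small the propensity.\<close>

definition cvar :: "nat \<Rightarrow> 'a \<Rightarrow> real" where "cvar t x = \<sigma>2 + (1 - e1 t x) * (m t x - Q)\<^sup>2"

text \<open>Bounds \<open>\<bar>m\<bar> + \<bar>m - Q\<bar>\<close>, so that
  \<open>\<bar>Y - m\<bar> + \<bar>m - Q\<bar>\<close> is at most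
  \<open>\<bar>Y\<bar> + c0\<close>.\<close>

definition c0 :: real where "c0 = 2 * B + \<bar>Q\<bar>"

text \<open>One summand for each estimate: the p-th moment when the arm is drawn, the same when it
  is not, and the power \<open>p / 2\<close> of \<open>cvar\<close>. The final 1 makes
  \<open>C0\<close> positive, so that it can be divided out.\<close>

definition C0 :: real where
  "C0 = expectation (\<lambda>x. (\<bar>Y 1 x w\<bar> + c0) powr p) + c0 powr p + (\<sigma>2 + c0\<^sup>2) powr (p / 2) + 1"

lemma Y1_meas [measurable]: "(\<lambda>x. Y 1 x w) \<in> borel_measurable M"
  by (rule Y_meas) simp

lemma Y_sq: "integrable M (\<lambda>x. (Y 1 x w)\<^sup>2)"
proof (rule Bochner_Integration.integrable_bound)
  show "integrable M (\<lambda>x. 1 + \<bar>Y 1 x w\<bar> powr p)" using Y_mom by simp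
  have "y\<^sup>2 \<le> 1 + \<bar>y\<bar> powr p" for y :: real
  proof (cases "\<bar>y\<bar> \<le> 1")
    case True
    then have "y\<^sup>2 \<le> 1" by (simp add: abs_square_le_1)
    then show ?thesis using powr_ge_zero[of "\<bar>y\<bar>" p] by linarith
  next
    case False
    then have "y\<^sup>2 = \<bar>y\<bar> powr 2" by (simp add: powr_numeral)
    also have "\<dots> \<le> \<bar>y\<bar> powr p" using False p by (intro powr_mono) auto
    finally show ?thesis by simp
  qed
  then show "AE x in M. norm ((Y 1 x w)\<^sup>2) \<le> norm (1 + \<bar>Y 1 x w\<bar> powr p)" by simp
qed measurable

lemma Y_int: "integrable M (\<lambda>x. Y 1 x w)"
  by (rule square_integrable_imp_integrable[OF Y1_meas Y_sq])

lemma \<sigma>2_eq: "\<sigma>2 = expectation (\<lambda>x. (Y 1 x w)\<^sup>2) - Q\<^sup>2"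
  unfolding \<sigma>2_def Q_def by (rule variance_eq[OF Y_int Y_sq])

lemma \<sigma>2_nonneg: "0 \<le> \<sigma>2"
  unfolding \<sigma>2_def by (rule variance_positive)

lemma B_nonneg: "0 \<le> B"
proof -
  obtain x where "x \<in> space M" using not_empty by blast
  from m_bdd[OF order_refl this] show ?thesis by linarith
qed

lemma c0_nonneg: "0 \<le> c0" using B_nonneg by (simp add: c0_def)

lemma m_Q_bdd: "1 \<le> t \<Longrightarrow> x \<in> space M \<Longrightarrow> \<bar>m t x - Q\<bar> \<le> c0"
  using m_bdd[of t x] B_nonneg unfolding c0_def by linarith

lemma m_Q_sq_bdd: "1 \<le> t \<Longrightarrow> x \<in> space M \<Longrightarrow> (m t x - Q)\<^sup>2 \<le> c0\<^sup>2"
  using power_mono[OF m_Q_bdd, of t x 2] by simp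

lemma m_M [measurable]: "1 \<le> t \<Longrightarrow> m t \<in> borel_measurable M"
  using measurable_from_subalg[OF subalgebra_hist m_meas] .

lemma e1_pos: "1 \<le> t \<Longrightarrow> x \<in> space M \<Longrightarrow> 0 < e1 t x"
  using e_pos by (simp add: e1_def)

lemma e1_le: "e1 t x \<le> 1" by (simp add: e1_def)

lemma AE_e1: "1 \<le> t \<Longrightarrow> AE x in M. e1 t x = e t w x"
  using e_nn_cond_exp(2)[of t w] by (auto simp: e1_def)

lemma e1_meas: "1 \<le> t \<Longrightarrow> e1 t \<in> borel_measurable (H t)"
  unfolding e1_def using e_meas[of t w] by measurable

lemma e1_M [measurable]: "1 \<le> t \<Longrightarrow> e1 t \<in> borel_measurable M"
  using measurable_from_subalg[OF subalgebra_hist e1_meas] .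

lemma cvar_bounds:
  assumes "1 \<le> t" "x \<in> space M"
  shows "\<sigma>2 \<le> cvar t x" "cvar t x \<le> \<sigma>2 + c0\<^sup>2"
proof -
  have a: "0 \<le> 1 - e1 t x" "1 - e1 t x \<le> 1" using e1_le[of t x] e1_pos[OF assms] by auto
  show "\<sigma>2 \<le> cvar t x" using a by (simp add: cvar_def)
  have "(1 - e1 t x) * (m t x - Q)\<^sup>2 \<le> 1 * c0\<^sup>2" using a m_Q_sq_bdd[OF assms] by (intro mult_mono) auto
  then show "cvar t x \<le> \<sigma>2 + c0\<^sup>2" by (simp add: cvar_def)
qed

lemma cvar_M [measurable]: "1 \<le> t \<Longrightarrow> cvar t \<in> borel_measurable M"
  unfolding cvar_def[abs_def] by measurable

lemma score_decomp: "\<Gamma> t x - Q = arm t x / e t w x * (Y t x w - m t x) + (m t x - Q)"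
  by (cases "W t x = w") (auto simp: aipw_def algebra_simps)

lemma \<Gamma>_hist: "1 \<le> t \<Longrightarrow> \<Gamma> t \<in> borel_measurable (H (Suc t))"
proof -
  assume t: "1 \<le> t"
  note sub = measurable_from_subalg[OF hist_mono[of t "Suc t"]]
  have [measurable]: "W t \<in> measurable (H (Suc t)) (count_space UNIV)" using t by (intro W_hist) auto
  have [measurable]: "(\<lambda>x. Y t x (W t x)) \<in> borel_measurable (H (Suc t))" using t by (intro Y_obs_hist) auto
  have [measurable]: "e t w \<in> borel_measurable (H (Suc t))" "m t \<in> borel_measurable (H (Suc t))"
    using sub[OF _ e_meas[OF t]] sub[OF _ m_meas[OF t]] by auto
  have "(\<lambda>x. (if W t x = w then 1 else 0) / e t w x * Y t x (W t x)
     + (1 - (if W t x = w then 1 else 0) / e t w x) * m t x) \<in> borel_measurable (H (Suc t))" by measurable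
  then show ?thesis by (simp add: aipw_def[abs_def] indicator_def[abs_def] of_bool_def)
qed

lemma \<Gamma>_M [measurable]: "1 \<le> t \<Longrightarrow> \<Gamma> t \<in> borel_measurable M"
  using measurable_from_subalg[OF subalgebra_hist \<Gamma>_hist] .

text \<open>The weighted score and its square are polynomials of degree at most two in the outcome,
  multiplied by the arm indicator, plus a term \<open>R\<close> free of both. The mean of
  \<open>Y\<^sup>2\<close> enters as \<open>\<sigma>2 + Q\<^sup>2\<close>.\<close>

lemma expectation_arm_quadratic:
  assumes t: "1 \<le> t"
    and H: "Z2 \<in> borel_measurable (H t)" "Z1 \<in> borel_measurable (H t)" "Z0 \<in> borel_measurable (H t)"
    and i: "integrable M (\<lambda>x. Z2 x * e t w x)" "integrable M (\<lambda>x. Z1 x * e t w x)"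
      "integrable M (\<lambda>x. Z0 x * e t w x)" "integrable M R"
  defines "f \<equiv> \<lambda>x. Z2 x * arm t x * (Y t x w)\<^sup>2 + Z1 x * arm t x * Y t x w + Z0 x * arm t x * 1 + R x"
  shows "integrable M f"
    and "expectation f = expectation (\<lambda>x. Z2 x * e t w x * (\<sigma>2 + Q\<^sup>2) + Z1 x * e t w x * Q + Z0 x * e t w x + R x)"
proof -
  have m: "(\<lambda>y::real. y\<^sup>2) \<in> borel_measurable borel" "(\<lambda>y::real. y) \<in> borel_measurable borel"
    "(\<lambda>y::real. 1 :: real) \<in> borel_measurable borel" by measurable
  have one: "integrable M (\<lambda>x. 1 :: real)" by simp
  note a2 = expectation_arm_mult_outcome[OF t H(1) i(1) m(1) Y_sq]
  note a1 = expectation_arm_mult_outcome[OF t H(2) i(2) m(2) Y_int]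
  note a0 = expectation_arm_mult_outcome[OF t H(3) i(3) m(3) one]
  note I = a2(1) a1(1) a0(1)
  show "integrable M f" unfolding f_def using I i(4) by (intro Bochner_Integration.integrable_add)
  have "expectation f = expectation (\<lambda>x. Z2 x * arm t x * (Y t x w)\<^sup>2)
      + expectation (\<lambda>x. Z1 x * arm t x * Y t x w) + expectation (\<lambda>x. Z0 x * arm t x * 1) + expectation R"
    unfolding f_def using I i(4)
    by (simp only: Bochner_Integration.integral_add Bochner_Integration.integrable_add)
  also have "\<dots> = expectation (\<lambda>x. Z2 x * e t w x) * (\<sigma>2 + Q\<^sup>2) + expectation (\<lambda>x. Z1 x * e t w x) * Q
      + expectation (\<lambda>x. Z0 x * e t w x) + expectation R"
    unfolding a2(2) a1(2) a0(2) by (simp add: \<sigma>2_eq Q_def prob_space)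
  also have "\<dots> = expectation (\<lambda>x. Z2 x * e t w x * (\<sigma>2 + Q\<^sup>2) + Z1 x * e t w x * Q + Z0 x * e t w x + R x)"
    using i by (simp add: Bochner_Integration.integral_add)
  finally show "expectation f = \<dots>" .
qed

text \<open>Conditional expectations are identified by testing against predictable \<open>b\<close>
  bounded by 1. The constant \<open>b = 1\<close> yields integrability, indicators of history events
  yield the defining equations.\<close>

lemma score_step:
  assumes t: "1 \<le> t" and a: "a \<in> borel_measurable (H t)" and ia: "integrable M (\<lambda>x. (a x)\<^sup>2 / e t w x)"
  shows "integrable M (\<lambda>x. (a x * (\<Gamma> t x - Q))\<^sup>2)"
    and "AE x in M. real_cond_exp M (H t) (\<lambda>x. a x * (\<Gamma> t x - Q)) x = 0"
    and "AE x in M. real_cond_exp M (H t) (\<lambda>x. (a x * (\<Gamma> t x - Q))\<^sup>2) x = (a x)\<^sup>2 / e1 t x * cvar t x"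
proof -
  interpret Ht: sigma_finite_subalgebra M "H t"
    by (intro finite_measure_subalgebra_is_sigma_finite finite_measure_subalgebra.intro
      finite_measure_axioms finite_measure_subalgebra_axioms.intro subalgebra_hist)
  note HM = a e_meas[OF t, of w] m_meas[OF t] e1_meas[OF t]
  have fromH: "f \<in> borel_measurable M" if "f \<in> borel_measurable (H t)" for f :: "'a \<Rightarrow> real"
    using measurable_from_subalg[OF subalgebra_hist that] .
  note [measurable] = fromH[OF a] e_M[OF t] m_M[OF t] \<Gamma>_M[OF t] e1_M[OF t] cvar_M[OF t]
  have e0: "e t w x \<noteq> 0" if "x \<in> space M" for x using e_pos[OF t that, of w] by simp
  have ia2: "integrable M (\<lambda>x. (a x)\<^sup>2)"
  proof (rule Bochner_Integration.integrable_bound[OF ia])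
    show "AE x in M. norm ((a x)\<^sup>2) \<le> norm ((a x)\<^sup>2 / e t w x)"
      using e_nn_cond_exp(2)[OF t, of w] AE_space
    proof eventually_elim
      case (elim x)
      have "(a x)\<^sup>2 * e t w x \<le> (a x)\<^sup>2" using elim(1) by (intro mult_left_le) auto
      then show ?case using e_pos[OF t elim(2), of w] by (simp add: field_simps)
    qed
  qed measurable
  have ia1: "integrable M a" by (rule square_integrable_imp_integrable[OF _ ia2]) simp
  have bdd: "integrable M (\<lambda>x. c x * g x)"
    if g: "integrable M g" and c: "c \<in> borel_measurable (H t)" "\<And>x. x \<in> space M \<Longrightarrow> \<bar>c x\<bar> \<le> K"
    for c g :: "'a \<Rightarrow> real" and K
  proof (rule Bochner_Integration.integrable_bound[of _ "\<lambda>x. K * g x"])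
    show "AE x in M. norm (c x * g x) \<le> norm (K * g x)"
    proof (rule AE_I2)
      fix x assume s: "x \<in> space M"
      have "\<bar>c x\<bar> \<le> \<bar>K\<bar>" using c(2)[OF s] by linarith
      then show "norm (c x * g x) \<le> norm (K * g x)" by (simp add: abs_mult mult_right_mono)
    qed
  qed (use g fromH[OF c(1)] in auto)
  have mean: "integrable M (\<lambda>x. b x * (a x * (\<Gamma> t x - Q))) \<and>
      expectation (\<lambda>x. b x * (a x * (\<Gamma> t x - Q))) = 0"
    if b: "b \<in> borel_measurable (H t)" and b1: "\<And>x. \<bar>b x\<bar> \<le> 1" for b
  proof -
    define Z1 where "Z1 x = b x * a x / e t w x" for x
    define Z0 where "Z0 x = - (b x * a x * m t x / e t w x)" for x
    define R where "R x = b x * a x * (m t x - Q)" for x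
    have ZH: "Z1 \<in> borel_measurable (H t)" "Z0 \<in> borel_measurable (H t)"
      unfolding Z1_def Z0_def using HM b by measurable
    note [measurable] = fromH[OF ZH(1)] fromH[OF ZH(2)] fromH[OF b]
    have ba: "integrable M (\<lambda>x. b x * a x)" using b1 by (intro bdd[OF ia1 b]) auto
    have mba: "integrable M (\<lambda>x. m t x * (b x * a x))" by (rule bdd[OF ba m_meas[OF t] m_bdd[OF t]])
    have i1: "integrable M (\<lambda>x. Z1 x * e t w x)"
      by (rule Bochner_Integration.integrable_cong[THEN iffD1, OF refl _ ba]) (simp add: Z1_def e0)
    have i0: "integrable M (\<lambda>x. Z0 x * e t w x)"
      by (rule Bochner_Integration.integrable_cong[THEN iffD1, OF refl _ Bochner_Integration.integrable_minus[OF mba]])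
        (simp add: Z0_def e0)
    have iR: "integrable M R"
    proof -
      have "integrable M (\<lambda>x. m t x * (b x * a x) - Q * (b x * a x))" using ba mba by simp
      then show ?thesis by (simp add: R_def[abs_def] algebra_simps)
    qed
    have eq: "b x * (a x * (\<Gamma> t x - Q)) =
        0 * arm t x * (Y t x w)\<^sup>2 + Z1 x * arm t x * Y t x w + Z0 x * arm t x * 1 + R x" for x
      unfolding score_decomp by (simp add: Z1_def Z0_def R_def algebra_simps diff_divide_distrib)
    note q = expectation_arm_quadratic[OF t _ ZH _ i1 i0 iR, of "\<lambda>_. 0"]
    \<comment> \<open>After replacing the indicator by \<open>e\<close> and \<open>Y\<close> by
      \<open>Q\<close>, the integrand is \<open>b * a * (Q - m + m - Q)\<close>: inverse propensity
      weighting cancels any error in \<open>m\<close>.\<close>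
    have "expectation (\<lambda>x. 0 * e t w x * (\<sigma>2 + Q\<^sup>2) + Z1 x * e t w x * Q + Z0 x * e t w x + R x) = expectation (\<lambda>x. 0)"
      by (intro Bochner_Integration.integral_cong refl) (simp add: Z1_def Z0_def R_def e0 algebra_simps)
    then show ?thesis unfolding eq using q by simp
  qed
  have sq: "integrable M (\<lambda>x. b x * (a x * (\<Gamma> t x - Q))\<^sup>2) \<and>
      integrable M (\<lambda>x. b x * ((a x)\<^sup>2 / e1 t x * cvar t x)) \<and>
      expectation (\<lambda>x. b x * (a x * (\<Gamma> t x - Q))\<^sup>2) = expectation (\<lambda>x. b x * ((a x)\<^sup>2 / e1 t x * cvar t x))"
    if b: "b \<in> borel_measurable (H t)" and b1: "\<And>x. \<bar>b x\<bar> \<le> 1" for b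
  proof -
    \<comment> \<open>The coefficients come from expanding the square of the decomposed score, with
      the indicator equal to its own square. \<open>Z2\<close> carries \<open>1 / e\<^sup>2\<close>;
      one power cancels against the propensity, and the rest is integrable by the assumption on
      \<open>a\<^sup>2 / e\<close>.\<close>
    define Z2 where "Z2 x = b x * (a x)\<^sup>2 / (e t w x)\<^sup>2" for x
    define Z1 where "Z1 x = b x * (a x)\<^sup>2 * (2 * (m t x - Q)) / e t w x - b x * (a x)\<^sup>2 * (2 * m t x) / (e t w x)\<^sup>2" for x
    define Z0 where "Z0 x = b x * (a x)\<^sup>2 * (m t x)\<^sup>2 / (e t w x)\<^sup>2 - b x * (a x)\<^sup>2 * (2 * (m t x - Q) * m t x) / e t w x" for x
    define R where "R x = b x * (a x)\<^sup>2 * (m t x - Q)\<^sup>2" for x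
    have ZH: "Z2 \<in> borel_measurable (H t)" "Z1 \<in> borel_measurable (H t)" "Z0 \<in> borel_measurable (H t)"
      unfolding Z2_def Z1_def Z0_def using HM b by measurable
    note [measurable] = fromH[OF ZH(1)] fromH[OF ZH(2)] fromH[OF ZH(3)] fromH[OF b]
    have g1: "integrable M (\<lambda>x. b x * (a x)\<^sup>2)" using b1 by (intro bdd[OF ia2 b]) auto
    have g2: "integrable M (\<lambda>x. b x * ((a x)\<^sup>2 / e t w x))" using b1 by (intro bdd[OF ia b]) auto
    have mQ: "(\<lambda>x. m t x - Q) \<in> borel_measurable (H t)" using HM by measurable
    note h1 = bdd[OF g1 mQ m_Q_bdd[OF t]] note h2 = bdd[OF g2 m_meas[OF t] m_bdd[OF t]]
    note h3 = bdd[OF h2 m_meas[OF t] m_bdd[OF t]] note h4 = bdd[OF h1 m_meas[OF t] m_bdd[OF t]]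
    note h5 = bdd[OF h1 mQ m_Q_bdd[OF t]]
    note h6 = bdd[OF bdd[OF g2 mQ m_Q_bdd[OF t]] mQ m_Q_bdd[OF t]]
    have i2: "integrable M (\<lambda>x. Z2 x * e t w x)"
      by (rule Bochner_Integration.integrable_cong[THEN iffD1, OF refl _ g2])
        (simp add: Z2_def e0 power2_eq_square)
    have i1: "integrable M (\<lambda>x. Z1 x * e t w x)"
    proof (rule Bochner_Integration.integrable_cong[THEN iffD1, OF refl])
      show "integrable M (\<lambda>x. 2 * ((m t x - Q) * (b x * (a x)\<^sup>2)) - 2 * (m t x * (b x * ((a x)\<^sup>2 / e t w x))))"
        by (intro Bochner_Integration.integrable_diff integrable_mult_right h1 h2)
    qed (simp add: Z1_def e0 power2_eq_square field_simps)
    have i0: "integrable M (\<lambda>x. Z0 x * e t w x)"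
    proof (rule Bochner_Integration.integrable_cong[THEN iffD1, OF refl])
      show "integrable M (\<lambda>x. m t x * (m t x * (b x * ((a x)\<^sup>2 / e t w x))) - 2 * (m t x * ((m t x - Q) * (b x * (a x)\<^sup>2))))"
        by (intro Bochner_Integration.integrable_diff integrable_mult_right h3 h4)
    qed (simp add: Z0_def e0 power2_eq_square field_simps)
    have iR: "integrable M R"
      by (rule Bochner_Integration.integrable_cong[THEN iffD1, OF refl _ h5]) (simp add: R_def power2_eq_square)
    have arm2: "arm t x * arm t x = arm t x" for x by (simp add: indicator_def)
    have eq: "b x * (a x * (\<Gamma> t x - Q))\<^sup>2 =
        Z2 x * arm t x * (Y t x w)\<^sup>2 + Z1 x * arm t x * Y t x w + Z0 x * arm t x * 1 + R x"
      if s: "x \<in> space M" for x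
    proof (cases "W t x = w")
      case True
      show ?thesis unfolding score_decomp using True e0[OF s]
        by (simp add: Z2_def Z1_def Z0_def R_def field_simps power2_eq_square)
    next
      case False
      then show ?thesis unfolding score_decomp by (simp add: R_def power_mult_distrib)
    qed
    note q = expectation_arm_quadratic[OF t ZH i2 i1 i0 iR]
    have I: "integrable M (\<lambda>x. b x * (a x * (\<Gamma> t x - Q))\<^sup>2)"
      by (rule Bochner_Integration.integrable_cong[THEN iffD1, OF refl _ q(1)]) (simp add: eq)
    have E: "expectation (\<lambda>x. b x * (a x * (\<Gamma> t x - Q))\<^sup>2) =
       expectation (\<lambda>x. Z2 x * e t w x * (\<sigma>2 + Q\<^sup>2) + Z1 x * e t w x * Q + Z0 x * e t w x + R x)"
      unfolding q(2)[symmetric] by (intro Bochner_Integration.integral_cong refl) (simp add: eq)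
    have "integrable M (\<lambda>x. Z2 x * e t w x * (\<sigma>2 + Q\<^sup>2) + Z1 x * e t w x * Q + Z0 x * e t w x + R x)"
      using i2 i1 i0 iR by simp
    moreover have ae: "AE x in M. Z2 x * e t w x * (\<sigma>2 + Q\<^sup>2) + Z1 x * e t w x * Q + Z0 x * e t w x + R x
        = b x * ((a x)\<^sup>2 / e1 t x * cvar t x)"
      using AE_e1[OF t] AE_space
    proof eventually_elim
      case (elim x)
      show ?case unfolding cvar_def elim(1) using e0[OF elim(2)]
        by (simp add: Z2_def Z1_def Z0_def R_def field_simps power2_eq_square)
    qed
    moreover have [measurable]: "(\<lambda>x. b x * ((a x)\<^sup>2 / e1 t x * cvar t x)) \<in> borel_measurable M"
      unfolding cvar_def by measurable
    moreover have [measurable]: "R \<in> borel_measurable M" unfolding R_def by measurable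
    ultimately have "integrable M (\<lambda>x. b x * ((a x)\<^sup>2 / e1 t x * cvar t x))"
      by (subst integrable_cong_AE[symmetric]) (auto)
    moreover have "expectation (\<lambda>x. b x * (a x * (\<Gamma> t x - Q))\<^sup>2) = expectation (\<lambda>x. b x * ((a x)\<^sup>2 / e1 t x * cvar t x))"
      unfolding E by (rule integral_cong_AE) (use ae in auto)
    ultimately show ?thesis using I by blast
  qed
  have m1: "integrable M (\<lambda>x. a x * (\<Gamma> t x - Q))" using mean[of "\<lambda>_. 1"] by simp
  show s1: "integrable M (\<lambda>x. (a x * (\<Gamma> t x - Q))\<^sup>2)" using sq[of "\<lambda>_. 1"] by simp
  have v1: "integrable M (\<lambda>x. (a x)\<^sup>2 / e1 t x * cvar t x)" using sq[of "\<lambda>_. 1"] by simp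
  show "AE x in M. real_cond_exp M (H t) (\<lambda>x. a x * (\<Gamma> t x - Q)) x = 0"
  proof (rule Ht.real_cond_exp_charact[OF _ m1])
    fix A assume "A \<in> sets (H t)"
    then show "(LINT x:A|M. a x * (\<Gamma> t x - Q)) = (LINT x:A|M. 0)"
      using mean[of "indicator A"] by (simp add: set_lebesgue_integral_def)
  qed auto
  show "AE x in M. real_cond_exp M (H t) (\<lambda>x. (a x * (\<Gamma> t x - Q))\<^sup>2) x = (a x)\<^sup>2 / e1 t x * cvar t x"
  proof (rule Ht.real_cond_exp_charact[OF _ s1 v1])
    fix A assume "A \<in> sets (H t)"
    then show "(LINT x:A|M. (a x * (\<Gamma> t x - Q))\<^sup>2) = (LINT x:A|M. (a x)\<^sup>2 / e1 t x * cvar t x)"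
      using sq[of "indicator A"] by (simp add: set_lebesgue_integral_def)
  next
    show "(\<lambda>x. (a x)\<^sup>2 / e1 t x * cvar t x) \<in> borel_measurable (H t)"
      unfolding cvar_def using HM by measurable
  qed
qed

lemma Y_shift_mom: "integrable M (\<lambda>x. (\<bar>Y 1 x w\<bar> + c0) powr p)"
proof (rule Bochner_Integration.integrable_bound)
  show "integrable M (\<lambda>x. 2 powr p * (\<bar>Y 1 x w\<bar> powr p + c0 powr p))" using Y_mom by simp
  have "(\<bar>y\<bar> + c0) powr p \<le> 2 powr p * (\<bar>y\<bar> powr p + c0 powr p)" for y :: real
  proof -
    have "(\<bar>y\<bar> + c0) powr p \<le> (2 * max \<bar>y\<bar> c0) powr p" using c0_nonneg p by (intro powr_mono2) auto
    also have "\<dots> = 2 powr p * max \<bar>y\<bar> c0 powr p" using c0_nonneg by (simp add: powr_mult)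
    also have "\<dots> \<le> 2 powr p * (\<bar>y\<bar> powr p + c0 powr p)" by (intro mult_left_mono) (auto simp: max_def)
    finally show ?thesis .
  qed
  then show "AE x in M. norm ((\<bar>Y 1 x w\<bar> + c0) powr p) \<le> norm (2 powr p * (\<bar>Y 1 x w\<bar> powr p + c0 powr p))" by simp
qed measurable

text \<open>If the arm is drawn, the centred score is at most
  \<open>(\<bar>Y\<bar> + c0) / e\<close>; otherwise it is at most \<open>c0\<close>. The first case
  has conditional probability \<open>e\<close>, which reduces \<open>e powr p\<close> in the
  denominator to \<open>e powr (p - 1)\<close>.\<close>

lemma score_moment:
  assumes t: "1 \<le> t" and a: "a \<in> borel_measurable (H t)" and a0: "\<And>x. x \<in> space M \<Longrightarrow> 0 \<le> a x"
    and Z: "Z \<in> borel_measurable (H t)" and Z0: "\<And>x. x \<in> space M \<Longrightarrow> 0 \<le> Z x"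
    and i: "integrable M (\<lambda>x. Z x * (a x powr p / e1 t x powr (p - 1)))"
  shows "integrable M (\<lambda>x. Z x * \<bar>a x * (\<Gamma> t x - Q)\<bar> powr p)"
    and "expectation (\<lambda>x. Z x * \<bar>a x * (\<Gamma> t x - Q)\<bar> powr p) \<le>
      C0 * expectation (\<lambda>x. Z x * (a x powr p / e1 t x powr (p - 1)))"
proof -
  have fromH: "f \<in> borel_measurable M" if "f \<in> borel_measurable (H t)" for f :: "'a \<Rightarrow> real"
    using measurable_from_subalg[OF subalgebra_hist that] .
  note [measurable] = fromH[OF a] fromH[OF Z] e_M[OF t] m_M[OF t] \<Gamma>_M[OF t] e1_M[OF t]
  define D where "D x = Z x * (a x powr p / e1 t x powr (p - 1))" for x
  have iD: "integrable M D" using i by (simp add: D_def[abs_def])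
  have [measurable]: "D \<in> borel_measurable M" using iD by simp
  have D0: "0 \<le> D x" if "x \<in> space M" for x using Z0[OF that] by (simp add: D_def)
  \<comment> \<open>Chosen so that multiplication by the propensity gives \<open>D\<close>
    back.\<close>
  define Z' where "Z' x = Z x * (a x powr p / e1 t x powr p)" for x
  have Z'H: "Z' \<in> borel_measurable (H t)" unfolding Z'_def using Z a e1_meas[OF t] by measurable
  have Z'e: "AE x in M. Z' x * e t w x = D x"
    using AE_e1[OF t] AE_space
  proof eventually_elim
    case (elim x)
    have "e1 t x powr p = e1 t x * e1 t x powr (p - 1)"
      using e1_pos[OF t elim(2)] by (simp add: powr_mult_base)
    then show ?case using e1_pos[OF t elim(2)] by (simp add: Z'_def D_def elim(1)[symmetric])
  qed
  note [measurable] = fromH[OF Z'H]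
  have iZ': "integrable M (\<lambda>x. Z' x * e t w x)"
    using iD Z'e by (subst integrable_cong_AE[where g=D]) auto
  note ex = expectation_arm_mult_outcome[OF t Z'H iZ', of "\<lambda>y. (\<bar>y\<bar> + c0) powr p"]
  have ex1: "integrable M (\<lambda>x. Z' x * arm t x * (\<bar>Y t x w\<bar> + c0) powr p)"
    and ex2: "expectation (\<lambda>x. Z' x * arm t x * (\<bar>Y t x w\<bar> + c0) powr p) =
      expectation D * expectation (\<lambda>x. (\<bar>Y 1 x w\<bar> + c0) powr p)"
    using ex Y_shift_mom integral_cong_AE[OF _ _ Z'e] by auto
  let ?U = "\<lambda>x. Z' x * arm t x * (\<bar>Y t x w\<bar> + c0) powr p + c0 powr p * D x"
  have iU: "integrable M ?U" using ex1 iD by simp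
  have bound: "AE x in M. Z x * \<bar>a x * (\<Gamma> t x - Q)\<bar> powr p \<le> ?U x"
    using AE_e1[OF t] AE_space
  proof eventually_elim
    case (elim x)
    note s = elim(2)
    have ep: "0 < e1 t x" "e1 t x \<le> 1" using e1_pos[OF t s] e1_le by auto
    have Z'0: "0 \<le> Z' x" using Z0[OF s] by (simp add: Z'_def)
    have pm: "\<bar>a x * (\<Gamma> t x - Q)\<bar> powr p = a x powr p * \<bar>\<Gamma> t x - Q\<bar> powr p"
      using a0[OF s] by (simp add: abs_mult powr_mult)
    show ?case
    proof (cases "W t x = w")
      case True
      have "\<Gamma> t x - Q = (Y t x w - m t x) / e1 t x + (m t x - Q)"
        unfolding score_decomp elim(1) using True by simp
      then have "\<bar>\<Gamma> t x - Q\<bar> \<le> \<bar>(Y t x w - m t x) / e1 t x\<bar> + \<bar>m t x - Q\<bar>"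
        by (simp only: abs_triangle_ineq)
      also have "\<bar>(Y t x w - m t x) / e1 t x\<bar> = \<bar>Y t x w - m t x\<bar> / e1 t x"
        using ep(1) by (simp only: abs_divide abs_of_pos)
      \<comment> \<open>\<open>e1 \<le> 1\<close> brings both terms over the same
        denominator.\<close>
      also have "\<bar>m t x - Q\<bar> \<le> \<bar>m t x - Q\<bar> / e1 t x"
        using ep by (simp add: pos_le_divide_eq mult_left_le)
      finally have "\<bar>\<Gamma> t x - Q\<bar> \<le> (\<bar>Y t x w - m t x\<bar> + \<bar>m t x - Q\<bar>) / e1 t x"
        by (simp add: add_divide_distrib)
      also have "\<dots> \<le> (\<bar>Y t x w\<bar> + c0) / e1 t x"
        using ep m_bdd[OF t s] B_nonneg unfolding c0_def by (intro divide_right_mono) auto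
      finally have "\<bar>\<Gamma> t x - Q\<bar> powr p \<le> ((\<bar>Y t x w\<bar> + c0) / e1 t x) powr p"
        using p by (intro powr_mono2) auto
      also have "\<dots> = (\<bar>Y t x w\<bar> + c0) powr p / e1 t x powr p"
        using ep c0_nonneg by (simp add: powr_divide)
      finally have "Z x * (a x powr p * \<bar>\<Gamma> t x - Q\<bar> powr p) \<le>
          Z x * (a x powr p * ((\<bar>Y t x w\<bar> + c0) powr p / e1 t x powr p))"
        using Z0[OF s] by (intro mult_left_mono) auto
      also have "\<dots> = Z' x * arm t x * (\<bar>Y t x w\<bar> + c0) powr p" using True by (simp add: Z'_def)
      also have "\<dots> \<le> ?U x" using D0[OF s] by simp
      finally show ?thesis unfolding pm .
    next
      case False
      have "\<bar>\<Gamma> t x - Q\<bar> powr p \<le> c0 powr p"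
        unfolding score_decomp using False m_Q_bdd[OF t s] p by (intro powr_mono2) auto
      then have "Z x * (a x powr p * \<bar>\<Gamma> t x - Q\<bar> powr p) \<le> Z x * (a x powr p * c0 powr p)"
        using Z0[OF s] by (intro mult_left_mono) auto
      also have "\<dots> \<le> c0 powr p * D x"
      proof -
        have "e1 t x powr (p - 1) \<le> 1" using ep p by (intro powr_le1) auto
        then have "a x powr p \<le> a x powr p / e1 t x powr (p - 1)"
          using ep by (simp add: pos_le_divide_eq mult_left_le)
        then have "Z x * a x powr p \<le> D x" unfolding D_def using Z0[OF s] by (intro mult_left_mono)
        then have "c0 powr p * (Z x * a x powr p) \<le> c0 powr p * D x" by (intro mult_left_mono) auto
        then show ?thesis by (simp add: mult_ac)
      qed
      also have "\<dots> = ?U x" using False by simp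
      finally show ?thesis unfolding pm .
    qed
  qed
  show I: "integrable M (\<lambda>x. Z x * \<bar>a x * (\<Gamma> t x - Q)\<bar> powr p)"
  proof (rule Bochner_Integration.integrable_bound[OF iU])
    show "AE x in M. norm (Z x * \<bar>a x * (\<Gamma> t x - Q)\<bar> powr p) \<le> norm (?U x)"
      using bound AE_space
    proof eventually_elim
      case (elim x)
      have "0 \<le> Z x * \<bar>a x * (\<Gamma> t x - Q)\<bar> powr p" using Z0[OF elim(2)] by simp
      then show ?case using elim(1) by (simp only: real_norm_def)
    qed
  qed measurable
  have "expectation (\<lambda>x. Z x * \<bar>a x * (\<Gamma> t x - Q)\<bar> powr p) \<le> expectation ?U"
    using bound by (intro integral_mono_AE I iU)
  also have "\<dots> = (expectation (\<lambda>x. (\<bar>Y 1 x w\<bar> + c0) powr p) + c0 powr p) * expectation D"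
    using ex1 iD ex2 by (simp add: Bochner_Integration.integral_add algebra_simps)
  also have "\<dots> \<le> C0 * expectation D"
    unfolding C0_def using D0 by (intro mult_right_mono Bochner_Integration.integral_nonneg) auto
  finally show "expectation (\<lambda>x. Z x * \<bar>a x * (\<Gamma> t x - Q)\<bar> powr p) \<le>
      C0 * expectation (\<lambda>x. Z x * (a x powr p / e1 t x powr (p - 1)))" unfolding D_def[abs_def] .
qed

lemma C0_bounds: "0 < C0" "(\<sigma>2 + c0\<^sup>2) powr (p / 2) \<le> C0"
proof -
  have "0 \<le> expectation (\<lambda>x. (\<bar>Y 1 x w\<bar> + c0) powr p)" by (intro Bochner_Integration.integral_nonneg) auto
  then show "(\<sigma>2 + c0\<^sup>2) powr (p / 2) \<le> C0" and "0 < C0"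
    using powr_ge_zero[of c0 p] powr_ge_zero[of "\<sigma>2 + c0\<^sup>2" "p / 2"] unfolding C0_def by linarith+
qed

lemma martingale_row_scores:
  assumes a: "\<And>t. 1 \<le> t \<Longrightarrow> t \<le> N \<Longrightarrow> a t \<in> borel_measurable (H t)"
    and a0: "\<And>t x. x \<in> space M \<Longrightarrow> 0 \<le> a t x"
    and ia: "\<And>t. 1 \<le> t \<Longrightarrow> t \<le> N \<Longrightarrow> integrable M (\<lambda>x. (a t x)\<^sup>2 / e t w x)"
  shows "martingale_row M H N (\<lambda>t x. a t x * (\<Gamma> t x - Q)) (\<lambda>t x. (a t x)\<^sup>2 / e1 t x * cvar t x)
    (\<lambda>t x. C0 * (a t x powr p / e1 t x powr (p - 1))) p"
proof
  show "2 < p" "p \<le> 3" by (fact p)+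
  show "subalgebra M (H t)" "subalgebra (H (Suc t)) (H t)" for t
    by (rule subalgebra_hist) (rule hist_mono, simp)
  fix t assume t: "1 \<le> t" "t \<le> N"
  note HM = a[OF t] m_meas[OF t(1)] e1_meas[OF t(1)]
  have "a t \<in> borel_measurable (H (Suc t))" using measurable_from_subalg[OF hist_mono a[OF t]] by simp
  then show "(\<lambda>x. a t x * (\<Gamma> t x - Q)) \<in> borel_measurable (H (Suc t))"
    using \<Gamma>_hist[OF t(1)] by measurable
  show "(\<lambda>x. (a t x)\<^sup>2 / e1 t x * cvar t x) \<in> borel_measurable (H t)"
    unfolding cvar_def using HM by measurable
  show "(\<lambda>x. C0 * (a t x powr p / e1 t x powr (p - 1))) \<in> borel_measurable (H t)"
    using HM by measurable
  show "0 \<le> (a t x)\<^sup>2 / e1 t x * cvar t x" if s: "x \<in> space M" for x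
    using e1_pos[OF t(1) s] cvar_bounds(1)[OF t(1) s] \<sigma>2_nonneg by simp
  show "((a t x)\<^sup>2 / e1 t x * cvar t x) powr (p / 2) \<le> C0 * (a t x powr p / e1 t x powr (p - 1))"
    if s: "x \<in> space M" for x
  proof -
    note ep = e1_pos[OF t(1) s]
    have c: "0 \<le> cvar t x" using cvar_bounds(1)[OF t(1) s] \<sigma>2_nonneg by simp
    have "((a t x)\<^sup>2 / e1 t x * cvar t x) powr (p / 2) = ((a t x)\<^sup>2) powr (p / 2) / e1 t x powr (p / 2) * cvar t x powr (p / 2)"
      using ep c by (simp add: powr_mult powr_divide)
    also have "((a t x)\<^sup>2) powr (p / 2) = a t x powr p"
    proof -
      have "(a t x)\<^sup>2 = a t x powr 2" using a0[OF s] by (cases "a t x = 0") (auto simp: powr_numeral)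
      then show ?thesis by (simp only: powr_powr) simp
    qed
    also have "a t x powr p / e1 t x powr (p / 2) * cvar t x powr (p / 2)
        \<le> a t x powr p / e1 t x powr (p - 1) * C0"
    proof (intro mult_mono divide_left_mono)
      \<comment> \<open>For a base in (0, 1] the larger exponent gives the smaller power, and
        \<open>p / 2 \<le> p - 1\<close> as \<open>p > 2\<close>.\<close>
      show "e1 t x powr (p - 1) \<le> e1 t x powr (p / 2)"
        using ep e1_le p by (intro powr_mono') auto
      have "cvar t x powr (p / 2) \<le> (\<sigma>2 + c0\<^sup>2) powr (p / 2)"
        using cvar_bounds[OF t(1) s] c p by (intro powr_mono2) auto
      then show "cvar t x powr (p / 2) \<le> C0" using C0_bounds by simp
    qed (use ep in auto)
    finally show ?thesis by (simp add: mult_ac)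
  qed
  show "integrable M (\<lambda>x. (a t x * (\<Gamma> t x - Q))\<^sup>2)"
    "AE x in M. real_cond_exp M (H t) (\<lambda>x. a t x * (\<Gamma> t x - Q)) x = 0"
    "AE x in M. real_cond_exp M (H t) (\<lambda>x. (a t x * (\<Gamma> t x - Q))\<^sup>2) x = (a t x)\<^sup>2 / e1 t x * cvar t x"
    using score_step[OF t(1) a[OF t] ia[OF t]] by auto
  fix Z assume Z: "Z \<in> borel_measurable (H t)" "\<And>x. x \<in> space M \<Longrightarrow> 0 \<le> Z x"
    "integrable M (\<lambda>x. Z x * (C0 * (a t x powr p / e1 t x powr (p - 1))))"
  have "integrable M (\<lambda>x. inverse C0 * (Z x * (C0 * (a t x powr p / e1 t x powr (p - 1)))))"
    using Z(3) by (rule integrable_mult_right)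
  moreover have "inverse C0 * (z * (C0 * y)) = z * y" for z y using C0_bounds(1) by simp
  ultimately have i: "integrable M (\<lambda>x. Z x * (a t x powr p / e1 t x powr (p - 1)))" by simp
  have "expectation (\<lambda>x. Z x * (C0 * (a t x powr p / e1 t x powr (p - 1)))) =
      C0 * expectation (\<lambda>x. Z x * (a t x powr p / e1 t x powr (p - 1)))"
    by (subst integral_mult_right_zero[symmetric]) (simp only: mult.left_commute)
  with score_moment[OF t(1) a[OF t] a0 Z(1,2) i]
  show "integrable M (\<lambda>x. Z x * \<bar>a t x * (\<Gamma> t x - Q)\<bar> powr p) \<and>
      expectation (\<lambda>x. Z x * \<bar>a t x * (\<Gamma> t x - Q)\<bar> powr p) \<le>
      expectation (\<lambda>x. Z x * (C0 * (a t x powr p / e1 t x powr (p - 1))))"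
    by simp
qed

end

section \<open>Weighted AIPW estimators\<close>

text \<open>The initial terms lose their weight, and the tail, where \<open>c\<close> is within
  \<open>r/4\<close> of its limit, has total weight below 2. The row length \<open>N n\<close> is
  general because rows are visited along a subsequence.\<close>

lemma toeplitz_weights:
  fixes q :: "nat \<Rightarrow> nat \<Rightarrow> real" and c :: "nat \<Rightarrow> real"
  assumes q0: "\<And>n t. 1 \<le> t \<Longrightarrow> t \<le> N n \<Longrightarrow> 0 \<le> q n t"
    and N: "filterlim N at_top sequentially"
    and sum: "(\<lambda>n. \<Sum>t=1..N n. q n t) \<longlonglongrightarrow> 1"
    and each: "\<And>t. 1 \<le> t \<Longrightarrow> (\<lambda>n. q n t) \<longlonglongrightarrow> 0"
    and c: "c \<longlonglongrightarrow> l"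
  shows "(\<lambda>n. \<Sum>t=1..N n. q n t * c t) \<longlonglongrightarrow> l"
proof -
  have D: "(\<lambda>n. \<Sum>t=1..N n. q n t * (c t - l)) \<longlonglongrightarrow> 0"
  proof (rule LIMSEQ_I)
    fix r :: real assume r: "0 < r"
    from LIMSEQ_D[OF c, of "r/4"] r obtain t0 where t0: "\<And>t. t \<ge> t0 \<Longrightarrow> \<bar>c t - l\<bar> < r/4" by auto
    have "(\<lambda>n. \<Sum>t=1..t0. q n t * \<bar>c t - l\<bar>) \<longlonglongrightarrow> (\<Sum>t=1..t0. 0 * \<bar>c t - l\<bar>)"
      by (intro tendsto_intros each) auto
    then have "eventually (\<lambda>n. (\<Sum>t=1..t0. q n t * \<bar>c t - l\<bar>) < r/2) sequentially"
      using r by (intro order_tendstoD(2)[where a="r/2"]) auto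
    moreover have "eventually (\<lambda>n. (\<Sum>t=1..N n. q n t) < 2) sequentially"
      using order_tendstoD(2)[OF sum, of 2] by simp
    moreover have "eventually (\<lambda>n. t0 \<le> N n) sequentially"
      using N by (simp add: filterlim_at_top)
    ultimately have "eventually (\<lambda>n. norm ((\<Sum>t=1..N n. q n t * (c t - l)) - 0) < r) sequentially"
    proof eventually_elim
      case (elim n)
      have "\<bar>\<Sum>t=1..N n. q n t * (c t - l)\<bar> \<le> (\<Sum>t=1..N n. q n t * \<bar>c t - l\<bar>)"
        using q0 by (intro order_trans[OF sum_abs] sum_mono) (auto simp: abs_mult)
      also have "\<dots> \<le> (\<Sum>t=1..N n. (if t \<le> t0 then q n t * \<bar>c t - l\<bar> else 0) + r/4 * q n t)"
      proof (rule sum_mono)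
        fix t assume "t \<in> {1..N n}"
        then have q: "0 \<le> q n t" using q0 by auto
        show "q n t * \<bar>c t - l\<bar> \<le> (if t \<le> t0 then q n t * \<bar>c t - l\<bar> else 0) + r/4 * q n t"
        proof (cases "t \<le> t0")
          case False
          then have "q n t * \<bar>c t - l\<bar> \<le> q n t * (r/4)" using t0[of t] q by (intro mult_left_mono) auto
          then show ?thesis using False by (simp add: mult.commute)
        qed (use q r in simp)
      qed
      also have "\<dots> = (\<Sum>t=1..N n. if t \<le> t0 then q n t * \<bar>c t - l\<bar> else 0) + r/4 * (\<Sum>t=1..N n. q n t)"
        by (simp add: sum.distrib sum_distrib_left)
      also have "(\<Sum>t=1..N n. if t \<le> t0 then q n t * \<bar>c t - l\<bar> else 0) = (\<Sum>t=1..t0. q n t * \<bar>c t - l\<bar>)"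
        using elim(3) by (intro sum.mono_neutral_cong_right) auto
      also have "r/4 * (\<Sum>t=1..N n. q n t) \<le> r/4 * 2" using elim(2) r by (intro mult_left_mono) auto
      finally show ?case using elim(1) by simp
    qed
    then show "\<exists>no. \<forall>n\<ge>no. norm ((\<Sum>t=1..N n. q n t * (c t - l)) - 0) < r"
      by (simp add: eventually_sequentially)
  qed
  have "(\<lambda>n. (\<Sum>t=1..N n. q n t * (c t - l)) + l * (\<Sum>t=1..N n. q n t)) \<longlonglongrightarrow> 0 + l * 1"
    by (intro tendsto_intros D sum)
  moreover have "(\<Sum>t=1..N n. q n t * (c t - l)) + l * (\<Sum>t=1..N n. q n t) = (\<Sum>t=1..N n. q n t * c t)" for n
    by (simp add: sum_distrib_left sum.distrib[symmetric] algebra_simps)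
  ultimately show ?thesis by simp
qed

text \<open>\<open>\<epsilon>\<close> is fixed first, to make the coefficient of the bounded sum
  small; its other power may be huge, but it multiplies a sum tending to 0.\<close>

lemma powr_interpolate_limit:
  fixes S S1 S3 :: "nat \<Rightarrow> real"
  assumes d: "0 < d" and S0: "\<And>n. 0 \<le> S n" and S1: "S1 \<longlonglongrightarrow> 1" and S3: "S3 \<longlonglongrightarrow> 0"
    and le: "\<And>n \<epsilon>. 0 < \<epsilon> \<Longrightarrow> S n \<le> \<epsilon> powr d * S1 n + \<epsilon> powr (d - d') * S3 n"
  shows "S \<longlonglongrightarrow> 0"
proof (rule LIMSEQ_I)
  fix r :: real assume r: "0 < r"
  define \<epsilon> where "\<epsilon> = (r/2) powr (1/d)"
  have \<epsilon>: "0 < \<epsilon>" "\<epsilon> powr d = r/2" using r d by (auto simp: \<epsilon>_def powr_powr)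
  have lim: "(\<lambda>n. \<epsilon> powr d * S1 n + \<epsilon> powr (d - d') * S3 n) \<longlonglongrightarrow> \<epsilon> powr d * 1 + \<epsilon> powr (d - d') * 0"
    by (intro tendsto_intros S1 S3)
  have "\<epsilon> powr d * 1 + \<epsilon> powr (d - d') * 0 < r" using r \<epsilon>(2) by simp
  from order_tendstoD(2)[OF lim this]
  have "eventually (\<lambda>n. \<epsilon> powr d * S1 n + \<epsilon> powr (d - d') * S3 n < r) sequentially" .
  then have "eventually (\<lambda>n. norm (S n - 0) < r) sequentially"
  proof eventually_elim
    case (elim n)
    then show ?case using S0[of n] le[OF \<epsilon>(1), of n] by simp
  qed
  then show "\<exists>no. \<forall>n\<ge>no. norm (S n - 0) < r" by (simp add: eventually_sequentially)
qed

text \<open>All three expressions are \<open>a\<^sup>2 / e\<close> times a power of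
  \<open>x = a / e\<close>. Below \<open>\<epsilon>\<close> the power \<open>x powr d\<close> is at
  most \<open>\<epsilon> powr d\<close>; above it, the higher power \<open>d'\<close> absorbs the
  difference.\<close>

lemma powr_interpolate:
  fixes a e \<epsilon> d d' :: real
  assumes a: "0 \<le> a" and e: "0 < e" and \<epsilon>: "0 < \<epsilon>" and d: "0 \<le> d" "d \<le> d'"
  shows "a powr (2 + d) / e powr (1 + d) \<le> \<epsilon> powr d * (a\<^sup>2 / e) + \<epsilon> powr (d - d') * (a powr (2 + d') / e powr (1 + d'))"
proof (cases "a = 0")
  case True
  then show ?thesis by simp
next
  case False
  define x where "x = a / e"
  have x: "0 < x" using a e False by (simp add: x_def)
  have eq: "a powr (2 + s) / e powr (1 + s) = a\<^sup>2 / e * x powr s" for s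
    using a e False by (simp add: x_def powr_add powr_divide powr_numeral)
  have "x powr d \<le> \<epsilon> powr d + \<epsilon> powr (d - d') * x powr d'"
  proof (cases "x \<le> \<epsilon>")
    case True
    then have "x powr d \<le> \<epsilon> powr d" using x d by (intro powr_mono2) auto
    moreover have "0 \<le> \<epsilon> powr (d - d') * x powr d'" by simp
    ultimately show ?thesis by linarith
  next
    case False
    have "x powr d = x powr (d - d') * x powr d'" using x by (simp flip: powr_add)
    also have "\<dots> \<le> \<epsilon> powr (d - d') * x powr d'"
      using False \<epsilon> d by (intro mult_right_mono powr_mono2') auto
    finally show ?thesis using powr_ge_zero[of \<epsilon> d] by linarith
  qed
  then have "a\<^sup>2 / e * x powr d \<le> a\<^sup>2 / e * (\<epsilon> powr d + \<epsilon> powr (d - d') * x powr d')"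
    using e by (intro mult_left_mono) auto
  then show ?thesis unfolding eq by (simp add: algebra_simps)
qed

lemma (in prob_space) conv_in_Lp_imp_conv_in_prob:
  assumes X: "\<And>n. X n \<in> borel_measurable M" and p: "0 < p" and c: "conv_in_Lp M p X c"
  shows "conv_in_prob M X c"
  unfolding conv_in_prob_def
proof (intro allI impI)
  fix \<epsilon> :: real assume \<epsilon>: "0 < \<epsilon>"
  note [measurable] = X
  have int: "integrable M (\<lambda>x. \<bar>X n x - c\<bar> powr p)" for n using c by (simp add: conv_in_Lp_def)
  have lim: "(\<lambda>n. expectation (\<lambda>x. \<bar>X n x - c\<bar> powr p) / \<epsilon> powr p) \<longlonglongrightarrow> 0"
    using c by (intro tendsto_divide_zero) (simp add: conv_in_Lp_def)
  have b: "measure M {x\<in>space M. \<bar>X n x - c\<bar> > \<epsilon>} \<le> expectation (\<lambda>x. \<bar>X n x - c\<bar> powr p) / \<epsilon> powr p" for n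
  proof -
    have "measure M {x\<in>space M. \<bar>X n x - c\<bar> > \<epsilon>} \<le> measure M {x\<in>space M. \<bar>X n x - c\<bar> powr p \<ge> \<epsilon> powr p}"
      using \<epsilon> p by (intro finite_measure_mono) (auto intro!: powr_mono2)
    also have "\<dots> \<le> expectation (\<lambda>x. \<bar>X n x - c\<bar> powr p) / \<epsilon> powr p"
      using \<epsilon> by (intro integral_Markov_inequality_measure[where A="space M"] int) auto
    finally show ?thesis .
  qed
  show "(\<lambda>n. measure M {x\<in>space M. \<bar>X n x - c\<bar> > \<epsilon>}) \<longlonglongrightarrow> 0"
    by (rule tendsto_sandwich[OF _ _ tendsto_const lim]) (intro always_eventually allI b measure_nonneg)+
qed

text \<open>Both alternatives of the theorem enter only through the almost sure limit
  \<open>V\<close> of \<open>cvar\<close>. Its positivity is what permits studentisation.\<close>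

locale weighted_aipw = aipw_experiment M W Y e m w B p
  for M :: "'a measure" and W :: "nat \<Rightarrow> 'a \<Rightarrow> 'w::finite" and Y e m w B p +
  fixes h :: "nat \<Rightarrow> nat \<Rightarrow> 'a \<Rightarrow> real" and \<delta> V :: real
  assumes h_nonneg: "\<And>T t x. x \<in> space M \<Longrightarrow> h T t x \<ge> 0"
    and h_meas: "\<And>T t. 1 \<le> t \<Longrightarrow> t \<le> T \<Longrightarrow> h T t \<in> borel_measurable (hist M W Y t)"
    and S_int: "\<And>T. integrable M (\<lambda>x. \<Sum>t=1..T. (h T t x)\<^sup>2 / e t w x)"
    and cond_i: "conv_in_prob_infty M (\<lambda>T x. (\<Sum>t=1..T. h T t x)\<^sup>2 /
        integral\<^sup>L M (\<lambda>x. \<Sum>t=1..T. (h T t x)\<^sup>2 / e t w x))"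
    and cond_ii: "conv_in_prob M (\<lambda>T x. (\<Sum>t=1..T. (h T t x)\<^sup>2 / e t w x) /
        integral\<^sup>L M (\<lambda>x. \<Sum>t=1..T. (h T t x)\<^sup>2 / e t w x)) 1"
    and cond_iii: "conv_in_prob M (\<lambda>T x.
        (\<Sum>t=1..T. h T t x powr (2 + \<delta>) / e t w x powr (1 + \<delta>)) /
        integral\<^sup>L M (\<lambda>x. \<Sum>t=1..T. (h T t x)\<^sup>2 / e t w x) powr (1 + \<delta> / 2)) 0"
    and \<delta>: "p \<le> 2 + \<delta>"
    and V_pos: "0 < V"
    and cvar_lim: "AE x in M. (\<lambda>t. cvar t x) \<longlonglongrightarrow> V"
begin

definition A :: "nat \<Rightarrow> real" where
  "A T = integral\<^sup>L M (\<lambda>x. \<Sum>t=1..T. (h T t x)\<^sup>2 / e t w x)"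

text \<open>If \<open>A T = 0\<close>, division by zero gives zero weights, so the martingale rows
  and the second moment bound hold for every \<open>T\<close>.\<close>

definition a :: "nat \<Rightarrow> nat \<Rightarrow> 'a \<Rightarrow> real" where "a T t x = h T t x / sqrt (A T)"

definition S :: "nat \<Rightarrow> 'a \<Rightarrow> real" where "S T x = (\<Sum>t=1..T. a T t x * (\<Gamma> t x - Q))"

abbreviation q :: "nat \<Rightarrow> nat \<Rightarrow> 'a \<Rightarrow> real" where "q T t x \<equiv> (a T t x)\<^sup>2 / e1 t x"

abbreviation Lb :: "nat \<Rightarrow> nat \<Rightarrow> 'a \<Rightarrow> real" where "Lb T t x \<equiv> C0 * (a T t x powr p / e1 t x powr (p - 1))"

lemma h_M [measurable]: "1 \<le> t \<Longrightarrow> t \<le> T \<Longrightarrow> h T t \<in> borel_measurable M"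
  using measurable_from_subalg[OF subalgebra_hist h_meas] .

lemma A_nonneg: "0 \<le> A T"
  unfolding A_def using e_pos by (intro Bochner_Integration.integral_nonneg sum_nonneg) (auto intro!: divide_nonneg_pos)

lemma a_hist: "1 \<le> t \<Longrightarrow> t \<le> T \<Longrightarrow> a T t \<in> borel_measurable (H t)"
  unfolding a_def[abs_def] using h_meas[of t T] by measurable

lemma a_M [measurable]: "1 \<le> t \<Longrightarrow> t \<le> T \<Longrightarrow> a T t \<in> borel_measurable M"
  using measurable_from_subalg[OF subalgebra_hist a_hist] .

lemma a_nonneg: "x \<in> space M \<Longrightarrow> 0 \<le> a T t x"
  unfolding a_def using h_nonneg A_nonneg by simp

lemma a_sq: "(a T t x)\<^sup>2 = (h T t x)\<^sup>2 / A T"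
  unfolding a_def using A_nonneg by (simp add: power_divide)

lemma a_powr:
  assumes "x \<in> space M"
  shows "a T t x powr (2 + d) = h T t x powr (2 + d) / A T powr (1 + d / 2)"
proof -
  have "sqrt (A T) powr (2 + d) = A T powr (1 + d / 2)"
    using A_nonneg[of T] by (simp add: powr_half_sqrt[symmetric] powr_powr add_divide_distrib)
  then show ?thesis unfolding a_def using h_nonneg[OF assms] A_nonneg by (simp add: powr_divide)
qed

lemma sum_meas:
  assumes "\<And>t. 1 \<le> t \<Longrightarrow> t \<le> T \<Longrightarrow> f t \<in> borel_measurable M"
  shows "(\<lambda>x. \<Sum>t=1..T. f t x :: real) \<in> borel_measurable M"
  using assms by (intro borel_measurable_sum) auto

lemma integrable_a_sq:
  assumes "1 \<le> t" "t \<le> T"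
  shows "integrable M (\<lambda>x. (a T t x)\<^sup>2 / e t w x)"
proof -
  note [measurable] = h_M[OF assms] e_M[OF assms(1)]
  have "integrable M (\<lambda>x. (h T t x)\<^sup>2 / e t w x)"
  proof (rule Bochner_Integration.integrable_bound[OF S_int[of T]])
    show "AE x in M. norm ((h T t x)\<^sup>2 / e t w x) \<le> norm (\<Sum>t=1..T. (h T t x)\<^sup>2 / e t w x)"
    proof (rule AE_I2)
      fix x assume s: "x \<in> space M"
      have nn: "0 \<le> (h T t x)\<^sup>2 / e t w x" if "1 \<le> t" for t using e_pos[OF that s, of w] by simp
      have "(h T t x)\<^sup>2 / e t w x \<le> (\<Sum>t=1..T. (h T t x)\<^sup>2 / e t w x)"
        using assms nn by (intro member_le_sum[where f="\<lambda>t. (h T t x)\<^sup>2 / e t w x"]) auto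
      moreover have "0 \<le> (\<Sum>t=1..T. (h T t x)\<^sup>2 / e t w x)" using nn by (intro sum_nonneg) auto
      ultimately show "norm ((h T t x)\<^sup>2 / e t w x) \<le> norm (\<Sum>t=1..T. (h T t x)\<^sup>2 / e t w x)"
        using nn[OF assms(1)] by simp
    qed
  qed measurable
  then have "integrable M (\<lambda>x. (h T t x)\<^sup>2 / e t w x / A T)" by (rule integrable_divide)
  moreover have "(\<lambda>x. (a T t x)\<^sup>2 / e t w x) = (\<lambda>x. (h T t x)\<^sup>2 / e t w x / A T)"
    by (simp add: a_sq mult.commute)
  ultimately show ?thesis by (simp only:)
qed

lemma AE_e1_all: "AE x in M. \<forall>t\<ge>1. e1 t x = e t w x"
proof -
  have "AE x in M. \<forall>t. 1 \<le> t \<longrightarrow> e1 t x = e t w x"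
    using AE_e1 by (subst AE_all_countable) (auto intro: AE_impI)
  then show ?thesis by simp
qed

lemma a_sq_e1: "1 \<le> t \<Longrightarrow> t \<le> T \<Longrightarrow> (\<lambda>x. q T t x) \<in> borel_measurable M"
  using a_M[of t T] e1_M[of t] by measurable

lemma powr_ratio_M:
  assumes "1 \<le> t" "t \<le> T"
  shows "(\<lambda>x. a T t x powr d / e1 t x powr d') \<in> borel_measurable M"
proof -
  note [measurable] = a_M[OF assms] e1_M[OF assms(1)]
  show ?thesis by measurable
qed

lemma L_sum_M: "(\<lambda>x. \<Sum>t=1..T. Lb T t x) \<in> borel_measurable M"
  by (intro sum_meas borel_measurable_times borel_measurable_const powr_ratio_M)

lemma conv_sum_a_sq: "conv_in_prob M (\<lambda>T x. \<Sum>t=1..T. q T t x) 1"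
proof (rule conv_in_prob_cong_AE[OF _ _ _ cond_ii])
  show "(\<lambda>x. \<Sum>t=1..T. q T t x) \<in> borel_measurable M" for T
    by (intro sum_meas a_sq_e1)
  show "(\<lambda>x. (\<Sum>t=1..T. (h T t x)\<^sup>2 / e t w x) / (integral\<^sup>L M (\<lambda>x. \<Sum>t=1..T. (h T t x)\<^sup>2 / e t w x))) \<in> borel_measurable M" for T
    using borel_measurable_integrable[OF S_int[of T]] by measurable
  show "AE x in M. (\<Sum>t=1..T. (h T t x)\<^sup>2 / e t w x) / (integral\<^sup>L M (\<lambda>x. \<Sum>t=1..T. (h T t x)\<^sup>2 / e t w x)) =
      (\<Sum>t=1..T. q T t x)" for T
    unfolding A_def[symmetric] using AE_e1_all by eventually_elim (simp add: a_sq sum_divide_distrib mult.commute)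
qed

lemma conv_sum_a_powr: "conv_in_prob M (\<lambda>T x. \<Sum>t=1..T. a T t x powr (2 + \<delta>) / e1 t x powr (1 + \<delta>)) 0"
proof (rule conv_in_prob_cong_AE[OF _ _ _ cond_iii])
  show "(\<lambda>x. \<Sum>t=1..T. a T t x powr (2 + \<delta>) / e1 t x powr (1 + \<delta>)) \<in> borel_measurable M" for T
    by (intro sum_meas powr_ratio_M)
  show "(\<lambda>x. (\<Sum>t=1..T. h T t x powr (2 + \<delta>) / e t w x powr (1 + \<delta>)) /
      (integral\<^sup>L M (\<lambda>x. \<Sum>t=1..T. (h T t x)\<^sup>2 / e t w x)) powr (1 + \<delta> / 2)) \<in> borel_measurable M" for T
  proof (intro borel_measurable_divide sum_meas borel_measurable_const)
    fix t assume "1 \<le> t" "t \<le> T"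
    note [measurable] = h_M[OF this] e_M[OF this(1)]
    show "(\<lambda>x. h T t x powr (2 + \<delta>)) \<in> borel_measurable M"
      "(\<lambda>x. e t w x powr (1 + \<delta>)) \<in> borel_measurable M" by measurable
  qed
  show "AE x in M. (\<Sum>t=1..T. h T t x powr (2 + \<delta>) / e t w x powr (1 + \<delta>)) /
      (integral\<^sup>L M (\<lambda>x. \<Sum>t=1..T. (h T t x)\<^sup>2 / e t w x)) powr (1 + \<delta> / 2) =
      (\<Sum>t=1..T. a T t x powr (2 + \<delta>) / e1 t x powr (1 + \<delta>))" for T
    unfolding A_def[symmetric] using AE_e1_all AE_space
    by eventually_elim (simp add: a_powr sum_divide_distrib mult.commute)
qed

text \<open>Interpolation between the quadratic sum, tending to 1, and the sum of condition (iii),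
  tending to 0, with \<open>d = p - 2\<close> and \<open>d' = \<delta>\<close>.\<close>

lemma conv_sum_L: "conv_in_prob M (\<lambda>T x. \<Sum>t=1..T. Lb T t x) 0"
proof (rule conv_in_prob_transfer2[OF sum_meas[OF a_sq_e1] conv_sum_a_sq sum_meas[OF powr_ratio_M] conv_sum_a_powr L_sum_M])
  show "AE x in M. True" by simp
  fix x and r :: "nat \<Rightarrow> nat"
  assume s: "x \<in> space M" and l: "(\<lambda>n. \<Sum>t=1..r n. q (r n) t x) \<longlonglongrightarrow> 1"
    "(\<lambda>n. \<Sum>t=1..r n. a (r n) t x powr (2 + \<delta>) / e1 t x powr (1 + \<delta>)) \<longlonglongrightarrow> 0"
    have "(\<lambda>n. \<Sum>t=1..r n. a (r n) t x powr p / e1 t x powr (p - 1)) \<longlonglongrightarrow> 0"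
    proof (rule powr_interpolate_limit[OF _ _ l])
      show "0 < p - 2" using p by simp
      show "0 \<le> (\<Sum>t=1..r n. a (r n) t x powr p / e1 t x powr (p - 1))" for n by (intro sum_nonneg) auto
      show "(\<Sum>t=1..r n. a (r n) t x powr p / e1 t x powr (p - 1)) \<le>
          \<epsilon> powr (p - 2) * (\<Sum>t=1..r n. q (r n) t x) +
          \<epsilon> powr (p - 2 - \<delta>) * (\<Sum>t=1..r n. a (r n) t x powr (2 + \<delta>) / e1 t x powr (1 + \<delta>))" if "0 < \<epsilon>" for n \<epsilon>
        unfolding sum_distrib_left sum.distrib[symmetric]
      proof (rule sum_mono)
        fix t assume "t \<in> {1..r n}"
        then have "0 < e1 t x" using e1_pos s by simp
        from powr_interpolate[OF a_nonneg[OF s] this that, of "p - 2" \<delta>]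
        show "a (r n) t x powr p / e1 t x powr (p - 1) \<le> \<epsilon> powr (p - 2) * (q (r n) t x) +
          \<epsilon> powr (p - 2 - \<delta>) * (a (r n) t x powr (2 + \<delta>) / e1 t x powr (1 + \<delta>))"
          using p \<delta> by (simp add: add.commute)
      qed
    qed
    then show "(\<lambda>n. \<Sum>t=1..r n. Lb (r n) t x) \<longlonglongrightarrow> 0"
      unfolding sum_distrib_left[symmetric] by (rule tendsto_mult_right_zero)
qed

text \<open>On each path the \<open>q\<close> serve as Toeplitz weights for \<open>cvar\<close>. A
  single weight vanishes because its power \<open>p / 2\<close> is at most one summand of the
  Lyapunov sum divided by \<open>C0\<close>.\<close>

lemma conv_sum_v: "conv_in_prob M (\<lambda>T x. \<Sum>t=1..T. q T t x * cvar t x) V"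
proof (rule conv_in_prob_transfer2[OF sum_meas[OF a_sq_e1] conv_sum_a_sq L_sum_M conv_sum_L _ cvar_lim])
  show "(\<lambda>x. \<Sum>t=1..T. q T t x * cvar t x) \<in> borel_measurable M" for T
    by (intro sum_meas borel_measurable_times a_sq_e1 cvar_M)
  fix x and r :: "nat \<Rightarrow> nat"
  assume s: "x \<in> space M" and c: "(\<lambda>t. cvar t x) \<longlonglongrightarrow> V" and r: "strict_mono r"
    and l1: "(\<lambda>n. \<Sum>t=1..r n. q (r n) t x) \<longlonglongrightarrow> 1"
    and l2: "(\<lambda>n. \<Sum>t=1..r n. Lb (r n) t x) \<longlonglongrightarrow> 0"
    show "(\<lambda>n. \<Sum>t=1..r n. q (r n) t x * cvar t x) \<longlonglongrightarrow> V"
    proof (rule toeplitz_weights[OF _ filterlim_subseq[OF r] l1 _ c])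
      show nn: "0 \<le> q (r n) t x" if "1 \<le> t" for n t using e1_pos[OF that s] by simp
      fix t :: nat assume t: "1 \<le> t"
      note ep = e1_pos[OF t s]
      have l3: "(\<lambda>n. inverse C0 * (\<Sum>t=1..r n. Lb (r n) t x)) \<longlonglongrightarrow> 0"
        by (rule tendsto_mult_right_zero[OF l2])
      have "eventually (\<lambda>n. t \<le> r n) sequentially"
        using filterlim_subseq[OF r] by (simp add: filterlim_at_top)
      then have "eventually (\<lambda>n. (q (r n) t x) powr (p / 2) \<le>
          inverse C0 * (\<Sum>t=1..r n. Lb (r n) t x)) sequentially"
      proof eventually_elim
        case (elim n)
        have "(a (r n) t x)\<^sup>2 = a (r n) t x powr 2" using a_nonneg[OF s] by (cases "a (r n) t x = 0") (auto simp: powr_numeral)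
        then have sq: "((a (r n) t x)\<^sup>2) powr (p / 2) = a (r n) t x powr p" by (simp only: powr_powr) simp
        have "(q (r n) t x) powr (p / 2) = a (r n) t x powr p / e1 t x powr (p / 2)"
          using ep by (simp add: powr_divide sq)
        also have "\<dots> \<le> a (r n) t x powr p / e1 t x powr (p - 1)"
        proof (rule divide_left_mono)
          show "e1 t x powr (p - 1) \<le> e1 t x powr (p / 2)" using ep e1_le p by (intro powr_mono') auto
        qed (use ep in auto)
        also have "\<dots> \<le> (\<Sum>t=1..r n. a (r n) t x powr p / e1 t x powr (p - 1))"
          using elim t by (intro member_le_sum[where f="\<lambda>t. a (r n) t x powr p / e1 t x powr (p - 1)"]) auto
        also have "\<dots> = inverse C0 * (\<Sum>t=1..r n. Lb (r n) t x)"
          unfolding sum_distrib_left[symmetric] using C0_bounds(1) by simp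
        finally show ?case .
      qed
      then have "(\<lambda>n. (q (r n) t x) powr (p / 2)) \<longlonglongrightarrow> 0"
        by (intro tendsto_sandwich[OF _ _ tendsto_const l3]) auto
      have pp: "p / 2 * (2 / p) = 1" using p by simp
      \<comment> \<open>Raising to the power \<open>2 / p\<close> recovers the weight
        itself.\<close>
      from \<open>(\<lambda>n. (q (r n) t x) powr (p / 2)) \<longlonglongrightarrow> 0\<close>
      have "(\<lambda>n. ((q (r n) t x) powr (p / 2)) powr (2 / p)) \<longlonglongrightarrow> 0 powr (2 / p)"
        using p by (intro tendsto_powr') auto
      moreover have "((q (r n) t x) powr (p / 2)) powr (2 / p) = q (r n) t x" for n
        unfolding powr_powr pp by (rule powr_one[OF nn[OF t]])
      ultimately show "(\<lambda>n. q (r n) t x) \<longlonglongrightarrow> 0" by simp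
    qed
qed

section \<open>Limit law and second moment of the normalised sum\<close>

lemma row: "martingale_row M H T (\<lambda>t x. a T t x * (\<Gamma> t x - Q)) (\<lambda>t x. q T t x * cvar t x)
    (\<lambda>t x. Lb T t x) p"
  by (rule martingale_row_scores[OF a_hist a_nonneg integrable_a_sq])

lemmas conv_sum_sq = martingale_array_conv_in_prob(1)[OF row conv_sum_v conv_sum_L]

lemma char_S: "(\<lambda>T. expectation (\<lambda>x. iexp (u * S T x))) \<longlonglongrightarrow> of_real (exp (- (u\<^sup>2 * V / 2)))"
  unfolding S_def by (rule martingale_array_conv_in_prob(2)[OF row conv_sum_v conv_sum_L])

lemma S_M [measurable]: "S T \<in> borel_measurable M"
  unfolding S_def[abs_def]
  by (intro sum_meas borel_measurable_times borel_measurable_diff a_M \<Gamma>_M borel_measurable_const)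

lemma S_L2: "integrable M (\<lambda>x. (S T x)\<^sup>2)" "expectation (\<lambda>x. (S T x)\<^sup>2) \<le> \<sigma>2 + c0\<^sup>2"
proof -
  have I: "integrable M (\<lambda>x. q T t x)" and
    E: "expectation (\<lambda>x. q T t x) = expectation (\<lambda>x. (a T t x)\<^sup>2 / e t w x)"
    if t: "1 \<le> t" "t \<le> T" for t
  proof -
    have ae: "AE x in M. (a T t x)\<^sup>2 / e t w x = q T t x" using AE_e1[OF t(1)] by eventually_elim simp
    note m = borel_measurable_integrable[OF integrable_a_sq[OF t]] a_sq_e1[OF t]
    show "integrable M (\<lambda>x. q T t x)"
      using integrable_cong_AE[OF m ae] integrable_a_sq[OF t] by blast
    show "expectation (\<lambda>x. q T t x) = expectation (\<lambda>x. (a T t x)\<^sup>2 / e t w x)"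
      using integral_cong_AE[OF m ae] by simp
  qed
  have sum1: "(\<Sum>t=1..T. expectation (\<lambda>x. q T t x)) \<le> 1"
  proof -
    have "(\<Sum>t=1..T. expectation (\<lambda>x. q T t x)) = (\<Sum>t=1..T. expectation (\<lambda>x. (a T t x)\<^sup>2 / e t w x))"
      using E by (intro sum.cong) auto
    also have "\<dots> = expectation (\<lambda>x. \<Sum>t=1..T. (a T t x)\<^sup>2 / e t w x)"
      using integrable_a_sq by (intro Bochner_Integration.integral_sum[symmetric]) auto
    also have "\<dots> = expectation (\<lambda>x. (\<Sum>t=1..T. (h T t x)\<^sup>2 / e t w x) / A T)"
      by (intro Bochner_Integration.integral_cong refl) (simp add: a_sq sum_divide_distrib mult.commute)
    \<comment> \<open>This quotient is 0 if \<open>A T = 0\<close> and 1 otherwise, so the claim is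
      an inequality.\<close>
    also have "\<dots> = A T / A T" by (simp add: A_def)
    finally show ?thesis by simp
  qed
  have vle: "expectation (\<lambda>x. q T t x * cvar t x) \<le> (\<sigma>2 + c0\<^sup>2) * expectation (\<lambda>x. q T t x)"
    if t: "1 \<le> t" "t \<le> T" for t
  proof -
    have "expectation (\<lambda>x. q T t x * cvar t x) \<le> expectation (\<lambda>x. (\<sigma>2 + c0\<^sup>2) * q T t x)"
    proof (rule integral_mono[OF martingale_row.integrable_v[OF row t]])
      show "integrable M (\<lambda>x. (\<sigma>2 + c0\<^sup>2) * q T t x)" using I[OF t] by (rule integrable_mult_right)
      fix x assume s: "x \<in> space M"
      have "q T t x * cvar t x \<le> q T t x * (\<sigma>2 + c0\<^sup>2)"
        using cvar_bounds(2)[OF t(1) s] e1_pos[OF t(1) s] by (intro mult_left_mono) auto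
      then show "q T t x * cvar t x \<le> (\<sigma>2 + c0\<^sup>2) * q T t x"
        by (simp only: mult.commute)
    qed
    then show ?thesis by (simp only: integral_mult_right_zero)
  qed
  note sq = martingale_row.expectation_square_sum[OF row order_refl, of T]
  show "integrable M (\<lambda>x. (S T x)\<^sup>2)" using sq by (simp add: S_def)
  have "expectation (\<lambda>x. (S T x)\<^sup>2) = (\<Sum>t=1..T. expectation (\<lambda>x. q T t x * cvar t x))"
    using sq by (simp add: S_def)
  also have "\<dots> \<le> (\<Sum>t=1..T. (\<sigma>2 + c0\<^sup>2) * expectation (\<lambda>x. q T t x))"
    using vle by (intro sum_mono) auto
  also have "\<dots> \<le> (\<sigma>2 + c0\<^sup>2) * 1"
    unfolding sum_distrib_left[symmetric] using sum1 \<sigma>2_nonneg by (intro mult_left_mono) auto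
  finally show "expectation (\<lambda>x. (S T x)\<^sup>2) \<le> \<sigma>2 + c0\<^sup>2" by simp
qed

section \<open>Normalising factor and consistency\<close>

lemma conv_S_mult:
  assumes "\<And>T. Z T \<in> borel_measurable M" "conv_in_prob M Z 0"
  shows "conv_in_prob M (\<lambda>T x. S T x * Z T x) 0"
  by (rule conv_in_prob_L2_bounded_mult[OF S_M assms(1) S_L2(1) always_eventually[OF allI[OF S_L2(2)]] assms(2)])

text \<open>The ratio of condition (i). Where it is positive, \<open>1 / sqrt gain\<close> converts
  the normalised sum \<open>S\<close> into the estimation error.\<close>

definition gain :: "nat \<Rightarrow> 'a \<Rightarrow> real" where "gain T x = (\<Sum>t=1..T. h T t x)\<^sup>2 / A T"

lemma gain_M [measurable]: "gain T \<in> borel_measurable M"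
  unfolding gain_def[abs_def]
  by (intro borel_measurable_divide borel_measurable_power sum_meas h_M borel_measurable_const)

lemma prob_gain: "(\<lambda>T. measure M {x\<in>space M. gain T x \<le> K}) \<longlonglongrightarrow> 0"
  using cond_i unfolding conv_in_prob_infty_def gain_def A_def by blast

lemma conv_inv_sqrt_gain: "conv_in_prob M (\<lambda>T x. 1 / sqrt (gain T x)) 0"
  unfolding conv_in_prob_def
proof (intro allI impI)
  fix \<epsilon> :: real assume \<epsilon>: "0 < \<epsilon>"
  have b: "measure M {x\<in>space M. \<bar>1 / sqrt (gain T x) - 0\<bar> > \<epsilon>} \<le> measure M {x\<in>space M. gain T x \<le> 1 / \<epsilon>\<^sup>2}" for T
  proof (rule finite_measure_mono)
    show "{x\<in>space M. \<bar>1 / sqrt (gain T x) - 0\<bar> > \<epsilon>} \<subseteq> {x\<in>space M. gain T x \<le> 1 / \<epsilon>\<^sup>2}"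
    proof (rule subsetI, rule ccontr)
      fix x assume "x \<in> {x\<in>space M. \<bar>1 / sqrt (gain T x) - 0\<bar> > \<epsilon>}" "x \<notin> {x\<in>space M. gain T x \<le> 1 / \<epsilon>\<^sup>2}"
      then have a: "\<epsilon> < \<bar>1 / sqrt (gain T x)\<bar>" and R: "1 / \<epsilon>\<^sup>2 < gain T x" by auto
      have "sqrt (1 / \<epsilon>\<^sup>2) < sqrt (gain T x)" using R by (simp only: real_sqrt_less_iff)
      then have "1 / \<epsilon> < sqrt (gain T x)" using \<epsilon> by (simp add: real_sqrt_divide)
      moreover have "0 < 1 / \<epsilon>" using \<epsilon> by simp
      ultimately have "0 < sqrt (gain T x)" "1 / \<epsilon> < sqrt (gain T x)" by linarith+
      then have "1 / sqrt (gain T x) < \<epsilon>" using \<epsilon> by (simp add: field_simps)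
      then show False using a \<open>0 < sqrt (gain T x)\<close> by simp
    qed
  qed measurable
  show "(\<lambda>T. measure M {x\<in>space M. \<bar>1 / sqrt (gain T x) - 0\<bar> > \<epsilon>}) \<longlonglongrightarrow> 0"
    by (rule tendsto_sandwich[OF _ _ tendsto_const prob_gain[of "1 / \<epsilon>\<^sup>2"]]) (intro always_eventually allI b measure_nonneg)+
qed

text \<open>Marks the paths on which the normalisation degenerates. As a sequence converging to 0 in
  probability it fits the subsequence transfer: on almost every path of a suitable subsequence it is
  eventually 0, and identities requiring \<open>0 < gain\<close> become available.\<close>

definition bad :: "nat \<Rightarrow> 'a \<Rightarrow> real" where "bad T x = (if gain T x \<le> 0 then 1 else 0)"

lemma bad_M [measurable]: "bad T \<in> borel_measurable M"
  unfolding bad_def[abs_def] by measurable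

lemma conv_bad: "conv_in_prob M bad 0"
  unfolding conv_in_prob_def
proof (intro allI impI)
  fix \<epsilon> :: real assume \<epsilon>: "0 < \<epsilon>"
  have b: "measure M {x\<in>space M. \<bar>bad T x - 0\<bar> > \<epsilon>} \<le> measure M {x\<in>space M. gain T x \<le> 0}" for T
    using \<epsilon> by (intro finite_measure_mono) (auto simp: bad_def)
  show "(\<lambda>T. measure M {x\<in>space M. \<bar>bad T x - 0\<bar> > \<epsilon>}) \<longlonglongrightarrow> 0"
    by (rule tendsto_sandwich[OF _ _ tendsto_const prob_gain[of 0]]) (intro always_eventually allI b measure_nonneg)+
qed

lemma eventually_good:
  assumes "(\<lambda>n. bad (r n) x) \<longlonglongrightarrow> 0"
  shows "eventually (\<lambda>n. 0 < gain (r n) x) sequentially"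
proof -
  have "eventually (\<lambda>n. bad (r n) x < 1) sequentially" using order_tendstoD(2)[OF assms] by simp
  then show ?thesis by eventually_elim (auto simp: bad_def split: if_splits)
qed

abbreviation Qh :: "nat \<Rightarrow> 'a \<Rightarrow> real" where "Qh \<equiv> Qhat h \<Gamma>"

lemma Qh_M [measurable]: "Qh T \<in> borel_measurable M"
  unfolding Qhat_def[abs_def]
  by (intro borel_measurable_divide sum_meas borel_measurable_times h_M \<Gamma>_M)

lemma good_cases:
  assumes "x \<in> space M" "0 < gain T x"
  shows "0 < A T" "0 < (\<Sum>t=1..T. h T t x)" "1 / sqrt (gain T x) = sqrt (A T) / (\<Sum>t=1..T. h T t x)"
proof -
  have A: "A T \<noteq> 0" and H: "(\<Sum>t=1..T. h T t x) \<noteq> 0" using assms(2) by (auto simp: gain_def)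
  moreover have "0 \<le> (\<Sum>t=1..T. h T t x)" using h_nonneg[OF assms(1)] by (intro sum_nonneg)
  ultimately show "0 < A T" and Hp: "0 < (\<Sum>t=1..T. h T t x)" using A_nonneg[of T] by auto
  show "1 / sqrt (gain T x) = sqrt (A T) / (\<Sum>t=1..T. h T t x)" using Hp by (simp add: gain_def real_sqrt_divide)
qed

lemma Qh_diff:
  assumes "x \<in> space M" "0 < gain T x"
  shows "Qh T x - Q = S T x * (1 / sqrt (gain T x))"
proof -
  note g = good_cases[OF assms]
  have "(\<Sum>t=1..T. h T t x * (\<Gamma> t x - Q)) = (\<Sum>t=1..T. h T t x * \<Gamma> t x) - (\<Sum>t=1..T. h T t x) * Q"
    by (simp add: right_diff_distrib sum_subtractf sum_distrib_right)
  then have "Qh T x - Q = (\<Sum>t=1..T. h T t x * (\<Gamma> t x - Q)) / (\<Sum>t=1..T. h T t x)"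
    using g(2) by (simp add: Qhat_def diff_divide_distrib)
  also have "(\<Sum>t=1..T. h T t x * (\<Gamma> t x - Q)) = S T x * sqrt (A T)"
    unfolding S_def sum_distrib_right using g(1) by (intro sum.cong) (auto simp: a_def)
  finally show ?thesis unfolding g(3) by simp
qed

text \<open>The error is an L2-bounded sum times a factor vanishing in probability, except on
  degenerate paths, which \<open>bad\<close> removes eventually.\<close>

lemma consistency: "conv_in_prob M Qh Q"
proof (rule conv_in_prob_transfer2[OF _ conv_S_mult[OF _ conv_inv_sqrt_gain] bad_M conv_bad Qh_M])
  show "AE x in M. True" by simp
  fix x and r :: "nat \<Rightarrow> nat"
  assume s: "x \<in> space M" and l: "(\<lambda>n. S (r n) x * (1 / sqrt (gain (r n) x))) \<longlonglongrightarrow> 0" "(\<lambda>n. bad (r n) x) \<longlonglongrightarrow> 0"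
  have "eventually (\<lambda>n. S (r n) x * (1 / sqrt (gain (r n) x)) = Qh (r n) x - Q) sequentially"
    using eventually_good[OF l(2)] by eventually_elim (simp only: Qh_diff[OF s])
  from Lim_transform_eventually[OF l(1) this] show "(\<lambda>n. Qh (r n) x) \<longlonglongrightarrow> Q" by (rule LIM_zero_cancel)
qed measurable

section \<open>Variance estimation and studentisation\<close>

definition Bn :: "nat \<Rightarrow> 'a \<Rightarrow> real" where
  "Bn T x = (\<Sum>t=1..T. (a T t x)\<^sup>2 * (\<Gamma> t x - Qh T x)\<^sup>2)"

lemma Bn_M [measurable]: "Bn T \<in> borel_measurable M"
  unfolding Bn_def[abs_def]
  by (intro sum_meas borel_measurable_times borel_measurable_power borel_measurable_diff a_M \<Gamma>_M Qh_M)

text \<open>Recentring from \<open>Q\<close> to the estimate changes each squared deviation by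
  \<open>D\<^sup>2 - 2 * D * g\<close>, where \<open>g\<close> is the centred score. The bound
  contains only sums with known limits, each multiplied by a power of the vanishing error
  \<open>D\<close>.\<close>

lemma Bn_diff:
  assumes "x \<in> space M"
  shows "\<bar>Bn T x - (\<Sum>t=1..T. (a T t x * (\<Gamma> t x - Q))\<^sup>2)\<bar> \<le>
    2 * \<bar>Qh T x - Q\<bar> * ((\<Sum>t=1..T. q T t x) + (\<Sum>t=1..T. (a T t x * (\<Gamma> t x - Q))\<^sup>2))
      + (Qh T x - Q)\<^sup>2 * (\<Sum>t=1..T. q T t x)"
proof -
  define D where "D = Qh T x - Q"
  have le: "(a T t x)\<^sup>2 \<le> q T t x" if "1 \<le> t" for t
    using e1_pos[OF that assms] e1_le[of t x] by (simp add: pos_le_divide_eq mult_left_le)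
  have eq: "Bn T x - (\<Sum>t=1..T. (a T t x * (\<Gamma> t x - Q))\<^sup>2) =
      (\<Sum>t=1..T. (a T t x)\<^sup>2 * (D\<^sup>2 - 2 * D * (\<Gamma> t x - Q)))"
    unfolding Bn_def sum_subtractf[symmetric]
    by (intro sum.cong refl) (simp add: D_def power2_eq_square algebra_simps)
  have "\<bar>\<Sum>t=1..T. (a T t x)\<^sup>2 * (D\<^sup>2 - 2 * D * (\<Gamma> t x - Q))\<bar> \<le> (\<Sum>t=1..T. 2 * \<bar>D\<bar> * (q T t x + (a T t x * (\<Gamma> t x - Q))\<^sup>2) + D\<^sup>2 * q T t x)"
  proof (intro order_trans[OF sum_abs] sum_mono)
    fix t assume "t \<in> {1..T}"
    then have t: "1 \<le> t" by simp
    define g where "g = \<Gamma> t x - Q"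
    \<comment> \<open>Trades the mixed sum of \<open>a\<^sup>2 * \<bar>g\<bar>\<close> for the two
      sums already controlled.\<close>
    have g: "\<bar>g\<bar> \<le> 1 + g\<^sup>2" using sum_squares_bound[of 1 "\<bar>g\<bar>"] by simp
    have "\<bar>D\<^sup>2 - 2 * D * g\<bar> \<le> D\<^sup>2 + 2 * \<bar>D\<bar> * \<bar>g\<bar>"
      using abs_triangle_ineq4[of "D\<^sup>2" "2 * D * g"] by (simp add: abs_mult)
    also have "2 * \<bar>D\<bar> * \<bar>g\<bar> \<le> 2 * \<bar>D\<bar> * (1 + g\<^sup>2)" using g by (intro mult_left_mono) auto
    finally have "\<bar>D\<^sup>2 - 2 * D * g\<bar> \<le> D\<^sup>2 + 2 * \<bar>D\<bar> * (1 + g\<^sup>2)" by simp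
    then have "(a T t x)\<^sup>2 * \<bar>D\<^sup>2 - 2 * D * g\<bar> \<le> (a T t x)\<^sup>2 * (D\<^sup>2 + 2 * \<bar>D\<bar> * (1 + g\<^sup>2))"
      by (intro mult_left_mono) auto
    also have "\<dots> = 2 * \<bar>D\<bar> * ((a T t x)\<^sup>2 + (a T t x * g)\<^sup>2) + D\<^sup>2 * (a T t x)\<^sup>2"
      by (simp add: power_mult_distrib algebra_simps)
    also have "\<dots> \<le> 2 * \<bar>D\<bar> * (q T t x + (a T t x * g)\<^sup>2) + D\<^sup>2 * q T t x"
      using le[OF t] by (intro add_mono mult_left_mono) auto
    finally show "\<bar>(a T t x)\<^sup>2 * (D\<^sup>2 - 2 * D * (\<Gamma> t x - Q))\<bar> \<le>
        2 * \<bar>D\<bar> * (q T t x + (a T t x * (\<Gamma> t x - Q))\<^sup>2) + D\<^sup>2 * q T t x"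
      by (simp add: g_def abs_mult)
  qed
  then show ?thesis unfolding eq by (simp only: sum.distrib sum_distrib_left[symmetric] D_def)
qed

lemma sq_M: "(\<lambda>x. \<Sum>t=1..T. (a T t x * (\<Gamma> t x - Q))\<^sup>2) \<in> borel_measurable M"
  by (intro sum_meas borel_measurable_times borel_measurable_power borel_measurable_diff a_M \<Gamma>_M borel_measurable_const)

lemma conv_Bn: "conv_in_prob M Bn V"
proof (rule conv_in_prob_transfer3[OF Qh_M consistency sq_M conv_sum_sq sum_meas[OF a_sq_e1] conv_sum_a_sq Bn_M])
  show "AE x in M. True" by simp
  fix x and r :: "nat \<Rightarrow> nat"
  let ?q = "\<lambda>n. \<Sum>t=1..r n. q (r n) t x"
  let ?X = "\<lambda>n. \<Sum>t=1..r n. (a (r n) t x * (\<Gamma> t x - Q))\<^sup>2"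
  let ?b = "\<lambda>n. 2 * \<bar>Qh (r n) x - Q\<bar> * (?q n + ?X n) + (Qh (r n) x - Q)\<^sup>2 * ?q n"
  assume s: "x \<in> space M" and l: "(\<lambda>n. Qh (r n) x) \<longlonglongrightarrow> Q" "?X \<longlonglongrightarrow> V" "?q \<longlonglongrightarrow> 1"
  have "?b \<longlonglongrightarrow> 2 * \<bar>Q - Q\<bar> * (1 + V) + (Q - Q)\<^sup>2 * 1" by (intro tendsto_intros l)
  then have "?b \<longlonglongrightarrow> 0" by simp
  moreover have "eventually (\<lambda>n. norm (Bn (r n) x - ?X n) \<le> ?b n) sequentially"
    unfolding real_norm_def by (intro always_eventually allI Bn_diff[OF s])
  ultimately have "(\<lambda>n. Bn (r n) x - ?X n) \<longlonglongrightarrow> 0" by (rule Lim_null_comparison[rotated])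
  from tendsto_add[OF this l(2)] show "(\<lambda>n. Bn (r n) x) \<longlonglongrightarrow> V" by simp
qed

definition stud :: "nat \<Rightarrow> 'a \<Rightarrow> real" where "stud T x = (Qh T x - Q) / sqrt (Vhat h \<Gamma> T x)"

lemma Vhat_M [measurable]: "Vhat h \<Gamma> T \<in> borel_measurable M"
  unfolding Vhat_def[abs_def]
  by (intro borel_measurable_divide borel_measurable_power sum_meas borel_measurable_times borel_measurable_diff h_M \<Gamma>_M Qh_M)

lemma stud_M [measurable]: "stud T \<in> borel_measurable M"
  unfolding stud_def[abs_def] by measurable

lemma stud_eq:
  assumes "x \<in> space M" "0 < gain T x"
  shows "stud T x = S T x * (1 / sqrt (Bn T x))"
proof -
  note g = good_cases[OF assms]
  have "(\<Sum>t=1..T. (h T t x)\<^sup>2 * (\<Gamma> t x - Qh T x)\<^sup>2) = A T * Bn T x"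
    unfolding Bn_def sum_distrib_left using g(1) by (intro sum.cong) (auto simp: a_sq)
  then have "sqrt (Vhat h \<Gamma> T x) = sqrt (A T) * sqrt (Bn T x) / (\<Sum>t=1..T. h T t x)"
    using g(2) by (simp add: Vhat_def real_sqrt_divide real_sqrt_mult)
  then show ?thesis unfolding stud_def Qh_diff[OF assms] g(3) using g(1,2) by simp
qed

text \<open>\<open>S\<close> converges only in distribution, so the quotient has no pathwise limit
  to transfer. The difference is \<open>S\<close> times \<open>1 / sqrt Bn - 1 / sqrt V\<close>, and
  the L2 bound on \<open>S\<close> applies.\<close>

lemma conv_stud_diff: "conv_in_prob M (\<lambda>T x. stud T x - S T x / sqrt V) 0"
proof -
  define Z where "Z T x = 1 / sqrt (Bn T x) - 1 / sqrt V" for T x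
  have Z_M [measurable]: "Z T \<in> borel_measurable M" for T unfolding Z_def[abs_def] by measurable
  have "conv_in_prob M Z 0"
  proof (rule conv_in_prob_transfer1[OF Bn_M conv_Bn Z_M])
    fix x and r :: "nat \<Rightarrow> nat"
    assume "(\<lambda>n. Bn (r n) x) \<longlonglongrightarrow> V"
    then have "(\<lambda>n. 1 / sqrt (Bn (r n) x) - 1 / sqrt V) \<longlonglongrightarrow> 1 / sqrt V - 1 / sqrt V"
      using V_pos by (intro tendsto_intros) auto
    then show "(\<lambda>n. Z (r n) x) \<longlonglongrightarrow> 0" by (simp add: Z_def)
  next
    show "AE x in M. True" by simp
  qed
  then have SZ: "conv_in_prob M (\<lambda>T x. S T x * Z T x) 0" by (rule conv_S_mult[OF Z_M])
  show ?thesis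
  proof (rule conv_in_prob_transfer2[OF _ SZ bad_M conv_bad])
    show "AE x in M. True" by simp
    fix x and r :: "nat \<Rightarrow> nat"
    assume s: "x \<in> space M" and l: "(\<lambda>n. S (r n) x * Z (r n) x) \<longlonglongrightarrow> 0" "(\<lambda>n. bad (r n) x) \<longlonglongrightarrow> 0"
    have "eventually (\<lambda>n. S (r n) x * Z (r n) x = stud (r n) x - S (r n) x / sqrt V) sequentially"
      using eventually_good[OF l(2)]
      by eventually_elim (simp only: stud_eq[OF s] Z_def right_diff_distrib times_divide_eq_right mult_1_right)
    from Lim_transform_eventually[OF l(1) this]
    show "(\<lambda>n. stud (r n) x - S (r n) x / sqrt V) \<longlonglongrightarrow> 0" .
  qed measurable
qed

lemma studentized_clt: "weak_conv_m (\<lambda>T. distr M borel (stud T)) std_normal_distribution"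
proof (rule levy_continuity)
  show "real_distribution (distr M borel (stud T))" for T by (rule real_distribution_distr) simp
  show "real_distribution std_normal_distribution" by (rule real_dist_normal_dist)
  fix u :: real
  have "(\<lambda>T. expectation (\<lambda>x. iexp (u * stud T x)) - expectation (\<lambda>x. iexp (u * (S T x / sqrt V)))) \<longlonglongrightarrow> 0"
    by (rule char_diff_conv_in_prob[OF _ _ conv_stud_diff]) measurable
  moreover have "(\<lambda>T. expectation (\<lambda>x. iexp (u * (S T x / sqrt V)))) \<longlonglongrightarrow> of_real (exp (- (u\<^sup>2) / 2))"
  proof -
    have "(u / sqrt V)\<^sup>2 * V / 2 = u\<^sup>2 / 2" using V_pos by (simp add: power_divide)
    moreover have "u / sqrt V * y = u * (y / sqrt V)" for y by simp
    ultimately show ?thesis using char_S[of "u / sqrt V"] by (simp only: minus_divide_left)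
  qed
  ultimately have "(\<lambda>T. expectation (\<lambda>x. iexp (u * stud T x)) - expectation (\<lambda>x. iexp (u * (S T x / sqrt V)))
      + expectation (\<lambda>x. iexp (u * (S T x / sqrt V)))) \<longlonglongrightarrow> 0 + of_real (exp (- (u\<^sup>2) / 2))"
    by (rule tendsto_add)
  then show "(\<lambda>T. char (distr M borel (stud T)) u) \<longlonglongrightarrow> char std_normal_distribution u"
    by (simp add: char_distr char_std_normal_distribution)
qed

end

section \<open>Choice of constants and reduction to a common conditional variance limit\<close>

theorem theorem1:
  fixes M :: "'a measure"
    and W :: "nat \<Rightarrow> 'a \<Rightarrow> 'w::finite"
    and Y :: "nat \<Rightarrow> 'a \<Rightarrow> 'w \<Rightarrow> real"
    and e :: "nat \<Rightarrow> 'w \<Rightarrow> 'a \<Rightarrow> real"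
    and m :: "nat \<Rightarrow> 'a \<Rightarrow> real"
    and h :: "nat \<Rightarrow> nat \<Rightarrow> 'a \<Rightarrow> real"
    and w :: 'w
  assumes P: "prob_space M"
    (* potential outcome vectors: i.i.d. over t = 1,2,... *)
    and Y_indep: "prob_space.indep_vars M (\<lambda>_. PiM UNIV (\<lambda>_. borel)) (\<lambda>t \<omega>. Y t \<omega>) {1..}"
    and Y_ident: "\<And>t. t \<ge> 1 \<Longrightarrow>
        distr M (PiM UNIV (\<lambda>_. borel)) (\<lambda>\<omega>. Y t \<omega>) = distr M (PiM UNIV (\<lambda>_. borel)) (\<lambda>\<omega>. Y 1 \<omega>)"
    and Y_var: "\<And>t v. t \<ge> 1 \<Longrightarrow> prob_space.variance M (\<lambda>\<omega>. Y t \<omega> v) \<noteq> 0"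
    and Y_mom: "\<exists>\<delta>>0. \<forall>t\<ge>1. \<forall>v. integrable M (\<lambda>\<omega>. \<bar>Y t \<omega> v\<bar> powr (2 + \<delta>))"
    (* arms *)
    and W_meas: "\<And>t. W t \<in> measurable M (count_space UNIV)"
    (* known, positive assignment probabilities e_t(v) = P[W_t = v | H^{t-1}] *)
    and e_meas: "\<And>t v. t \<ge> 1 \<Longrightarrow> e t v \<in> borel_measurable (hist M W Y t)"
    and e_pos: "\<And>t v \<omega>. t \<ge> 1 \<Longrightarrow> \<omega> \<in> space M \<Longrightarrow> e t v \<omega> > 0"
    and e_prop: "\<And>t v. t \<ge> 1 \<Longrightarrow> AE \<omega> in M.
        e t v \<omega> = real_cond_exp M (hist M W Y t) (indicator {\<omega>. W t \<omega> = v}) \<omega>"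
    (* law of W_t given H^{t-1} and future potential outcomes depends only on H^{t-1} *)
    and unconf: "\<And>t v. t \<ge> 1 \<Longrightarrow> AE \<omega> in M.
        real_cond_exp M (hist_future M W Y t) (indicator {\<omega>. W t \<omega> = v}) \<omega> = e t v \<omega>"
    (* plug-in regression estimates for arm w *)
    and m_meas: "\<And>t. t \<ge> 1 \<Longrightarrow> m t \<in> borel_measurable (hist M W Y t)"
    and m_bdd: "\<exists>B. \<forall>t\<ge>1. \<forall>\<omega>\<in>space M. \<bar>m t \<omega>\<bar> \<le> B"
    and m_conv: "\<exists>m_inf. AE \<omega> in M. (\<lambda>t. m t \<omega>) \<longlonglongrightarrow> m_inf"
    (* adaptive weights *)
    and h_nonneg: "\<And>T t \<omega>. \<omega> \<in> space M \<Longrightarrow> h T t \<omega> \<ge> 0"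
    and h_meas: "\<And>T t. 1 \<le> t \<Longrightarrow> t \<le> T \<Longrightarrow> h T t \<in> borel_measurable (hist M W Y t)"
    and S_int: "\<And>T. integrable M (\<lambda>\<omega>. \<Sum>t=1..T. (h T t \<omega>)\<^sup>2 / e t w \<omega>)"
    and cond_i: "conv_in_prob_infty M (\<lambda>T \<omega>. (\<Sum>t=1..T. h T t \<omega>)\<^sup>2 /
        integral\<^sup>L M (\<lambda>\<omega>. \<Sum>t=1..T. (h T t \<omega>)\<^sup>2 / e t w \<omega>))"
    and cond_ii: "\<exists>p>1. conv_in_Lp M p (\<lambda>T \<omega>. (\<Sum>t=1..T. (h T t \<omega>)\<^sup>2 / e t w \<omega>) /
        integral\<^sup>L M (\<lambda>\<omega>. \<Sum>t=1..T. (h T t \<omega>)\<^sup>2 / e t w \<omega>)) 1"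
    and cond_iii: "\<exists>\<delta>>0. conv_in_prob M (\<lambda>T \<omega>.
        (\<Sum>t=1..T. h T t \<omega> powr (2 + \<delta>) / e t w \<omega> powr (1 + \<delta>)) /
        integral\<^sup>L M (\<lambda>\<omega>. \<Sum>t=1..T. (h T t \<omega>)\<^sup>2 / e t w \<omega>) powr (1 + \<delta> / 2)) 0"
    (* either consistent regression or convergent propensities *)
    and either: "(AE \<omega> in M. (\<lambda>t. m t \<omega>) \<longlonglongrightarrow> prob_space.expectation M (\<lambda>\<omega>. Y 1 \<omega> w))
        \<or> (\<exists>e_inf\<in>{0..1}. AE \<omega> in M. (\<lambda>t. e t w \<omega>) \<longlonglongrightarrow> e_inf)"
  shows "conv_in_prob M (Qhat h (aipw W Y e m w))
           (prob_space.expectation M (\<lambda>\<omega>. Y 1 \<omega> w))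
      \<and> weak_conv_m
           (\<lambda>T. distr M borel (\<lambda>\<omega>.
              (Qhat h (aipw W Y e m w) T \<omega> - prob_space.expectation M (\<lambda>\<omega>. Y 1 \<omega> w))
              / sqrt (Vhat h (aipw W Y e m w) T \<omega>)))
           std_normal_distribution"
proof -
  interpret adaptive_experiment M W Y e
    by (intro adaptive_experiment.intro adaptive_experiment_axioms.intro P Y_indep Y_ident W_meas e_meas e_pos unconf)
  obtain \<delta>\<^sub>Y where \<delta>Y: "0 < \<delta>\<^sub>Y" "\<And>t v. 1 \<le> t \<Longrightarrow> integrable M (\<lambda>\<omega>. \<bar>Y t \<omega> v\<bar> powr (2 + \<delta>\<^sub>Y))"
    using Y_mom by blast
  obtain \<delta> where \<delta>: "0 < \<delta>" and ciii: "conv_in_prob M (\<lambda>T \<omega>.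
        (\<Sum>t=1..T. h T t \<omega> powr (2 + \<delta>) / e t w \<omega> powr (1 + \<delta>)) /
        integral\<^sup>L M (\<lambda>\<omega>. \<Sum>t=1..T. (h T t \<omega>)\<^sup>2 / e t w \<omega>) powr (1 + \<delta> / 2)) 0"
    using cond_iii by blast
  obtain B where B: "\<And>t \<omega>. 1 \<le> t \<Longrightarrow> \<omega> \<in> space M \<Longrightarrow> \<bar>m t \<omega>\<bar> \<le> B" using m_bdd by blast
  \<comment> \<open>The largest exponent compatible with the Taylor bound, the moments of the
    outcomes and condition (iii).\<close>
  define p where "p = 2 + min 1 (min \<delta>\<^sub>Y \<delta>)"
  have p: "2 < p" "p \<le> 3" "p \<le> 2 + \<delta>\<^sub>Y" "p \<le> 2 + \<delta>" using \<delta> \<delta>Y(1) by (auto simp: p_def)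
  note p_le = p(4)
  have Y1: "integrable M (\<lambda>\<omega>. \<bar>Y 1 \<omega> w\<bar> powr p)"
  proof (rule Bochner_Integration.integrable_bound)
    show "integrable M (\<lambda>\<omega>. 1 + \<bar>Y 1 \<omega> w\<bar> powr (2 + \<delta>\<^sub>Y))" using \<delta>Y(2)[of 1 w] by simp
    have "\<bar>x\<bar> powr p \<le> 1 + \<bar>x\<bar> powr (2 + \<delta>\<^sub>Y)" for x :: real
    proof (cases "\<bar>x\<bar> \<le> 1")
      case True
      then have "\<bar>x\<bar> powr p \<le> 1" using p by (intro powr_le1) auto
      then show ?thesis using powr_ge_zero[of "\<bar>x\<bar>" "2 + \<delta>\<^sub>Y"] by linarith
    next
      case False
      then have "\<bar>x\<bar> powr p \<le> \<bar>x\<bar> powr (2 + \<delta>\<^sub>Y)" using p by (intro powr_mono) auto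
      then show ?thesis by linarith
    qed
    then show "AE \<omega> in M. norm (\<bar>Y 1 \<omega> w\<bar> powr p) \<le> norm (1 + \<bar>Y 1 \<omega> w\<bar> powr (2 + \<delta>\<^sub>Y))" by simp
    have [measurable]: "(\<lambda>\<omega>. Y 1 \<omega> w) \<in> borel_measurable M" by (rule Y_meas) simp
    show "(\<lambda>\<omega>. \<bar>Y 1 \<omega> w\<bar> powr p) \<in> borel_measurable M" by measurable
  qed
  interpret aipw_experiment M W Y e m w B p
    by unfold_locales (use m_meas B p Y1 in auto)
  have "\<sigma>2 \<noteq> 0" using Y_var[of 1 w] by (simp add: \<sigma>2_def)
  then have \<sigma>2_pos: "0 < \<sigma>2" using \<sigma>2_nonneg by simp
  obtain V where V: "0 < V" "AE \<omega> in M. (\<lambda>t. cvar t \<omega>) \<longlonglongrightarrow> V"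
  proof -
    from either show ?thesis
    proof
      assume m: "AE \<omega> in M. (\<lambda>t. m t \<omega>) \<longlonglongrightarrow> expectation (\<lambda>\<omega>. Y 1 \<omega> w)"
      have "AE \<omega> in M. (\<lambda>t. cvar t \<omega>) \<longlonglongrightarrow> \<sigma>2"
        using m AE_space
      proof eventually_elim
        case (elim \<omega>)
        have "(\<lambda>t. (m t \<omega> - Q)\<^sup>2) \<longlonglongrightarrow> (Q - Q)\<^sup>2"
          using elim(1) unfolding Q_def by (intro tendsto_intros)
        then have l: "(\<lambda>t. (m t \<omega> - Q)\<^sup>2) \<longlonglongrightarrow> 0" by simp
        \<comment> \<open>\<open>1 - e1\<close> lies in the unit interval, so the vanishing
          regression error alone determines the limit. The bound starts at time 1, where positivity
          of the propensities begins.\<close>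
        have "eventually (\<lambda>t. norm (cvar t \<omega> - \<sigma>2) \<le> (m t \<omega> - Q)\<^sup>2) sequentially"
          using eventually_ge_at_top[of 1]
        proof eventually_elim
          case (elim t)
          have "0 \<le> 1 - e1 t \<omega>" "1 - e1 t \<omega> \<le> 1"
            using e1_le[of t \<omega>] e1_pos[OF elim \<open>\<omega> \<in> space M\<close>] by auto
          then show ?case by (simp add: cvar_def abs_mult mult_left_le_one_le)
        qed
        from Lim_null_comparison[OF this l] show ?case by (rule LIM_zero_cancel)
      qed
      with \<sigma>2_pos that show ?thesis by blast
    next
      assume "\<exists>e_inf\<in>{0..1}. AE \<omega> in M. (\<lambda>t. e t w \<omega>) \<longlonglongrightarrow> e_inf"
      then obtain e_inf where ei: "0 \<le> e_inf" "e_inf \<le> 1" "AE \<omega> in M. (\<lambda>t. e t w \<omega>) \<longlonglongrightarrow> e_inf" by auto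
      obtain m_inf where mi: "AE \<omega> in M. (\<lambda>t. m t \<omega>) \<longlonglongrightarrow> m_inf" using m_conv by blast
      \<comment> \<open>\<open>min e_inf 1\<close> mirrors the truncation in \<open>e1\<close>, so
        the limit follows by continuity.\<close>
      define V where "V = \<sigma>2 + (1 - min e_inf 1) * (m_inf - Q)\<^sup>2"
      have "AE \<omega> in M. (\<lambda>t. cvar t \<omega>) \<longlonglongrightarrow> V"
        using ei(3) mi
      proof eventually_elim
        case (elim \<omega>)
        show ?case unfolding cvar_def V_def e1_def using elim by (intro tendsto_intros)
      qed
      moreover have "0 < V" using \<sigma>2_pos by (simp add: V_def add_pos_nonneg)
      ultimately show ?thesis using that by blast
    qed
  qed
  obtain q where q: "1 < q" and cii: "conv_in_Lp M q (\<lambda>T \<omega>. (\<Sum>t=1..T. (h T t \<omega>)\<^sup>2 / e t w \<omega>) /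
        integral\<^sup>L M (\<lambda>\<omega>. \<Sum>t=1..T. (h T t \<omega>)\<^sup>2 / e t w \<omega>)) 1" using cond_ii by blast
  have cii': "conv_in_prob M (\<lambda>T \<omega>. (\<Sum>t=1..T. (h T t \<omega>)\<^sup>2 / e t w \<omega>) /
        integral\<^sup>L M (\<lambda>\<omega>. \<Sum>t=1..T. (h T t \<omega>)\<^sup>2 / e t w \<omega>)) 1"
  proof (rule conv_in_Lp_imp_conv_in_prob[OF _ _ cii])
    show "(\<lambda>\<omega>. (\<Sum>t=1..T. (h T t \<omega>)\<^sup>2 / e t w \<omega>) / integral\<^sup>L M (\<lambda>\<omega>. \<Sum>t=1..T. (h T t \<omega>)\<^sup>2 / e t w \<omega>))
        \<in> borel_measurable M" for T
      using borel_measurable_integrable[OF S_int[of T]] by measurable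
  qed (use q in simp)
  interpret weighted_aipw M W Y e m w B p h \<delta> V
    by (intro weighted_aipw.intro weighted_aipw_axioms.intro aipw_experiment_axioms
        h_nonneg h_meas S_int cond_i cii' ciii p_le V)
  show ?thesis
    using consistency studentized_clt unfolding stud_def[abs_def] Q_def by blast
qed

end
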